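(* Let $p\in(\frac{10}{3},6)$ and $c>0$. For each $u_c\in\mathcal{M}_c$ there exists $\lambda_c\le0$ such that $(u_c,\lambda_c)\in H^1(\mathbb{R}^3)\times\mathbb{R}$ solves $$-\Delta v-\lambda v+(|x|^{-1}*|v|^2)v-|v|^{p-2}v=0\quad\text{in }\mathbb{R}^3$$ (with $v=u_c$, $\lambda=\lambda_c$).
   Context: Functions are complex-valued and $\|\cdot\|_s$ is the $L^s(\mathbb{R}^3)$ norm. For $u\in H^1(\mathbb{R}^3)$ set $A(u)=\int_{\mathbb{R}^3}|\nabla u|^2dx$, $B(u)=\int_{\mathbb{R}^3}\int_{\mathbb{R}^3}\frac{|u(x)|^2|u(y)|^2}{|x-y|}dxdy$, $$F(u)=\frac12A(u)+\frac14B(u)-\frac1p\|u\|_p^p,\qquad Q(u)=A(u)+\frac14B(u)-\frac{3(p-2)}{2p}\|u\|_p^p.$$ For $c>0$: $S(c)=\{u\in H^1(\mathbb{R}^3):\|u\|_2^2=c\}$, $V(c)=\{u\in S(c):Q(u)=0\}$, and $$\mathcal{M}_c=\{u_c\in V(c):F(u_c)=\inf_{u\in V(c)}F(u)\}.$$ *)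

theory Defs
  imports "HOL-Analysis.Analysis"
begin

text \<open>
  Elements of Lebesgue and Sobolev spaces are represented by Borel functions; every almost-everywhere
  class has such a representative, and all functionals below only depend on the class.
\<close>

definition partial_deriv :: "3 \<Rightarrow> (real^3 \<Rightarrow> complex) \<Rightarrow> real^3 \<Rightarrow> complex" where
  "partial_deriv i f x = frechet_derivative f (at x) (axis i 1)"

primrec C_k :: "nat \<Rightarrow> (real^3 \<Rightarrow> complex) \<Rightarrow> bool" where
  "C_k 0 f \<longleftrightarrow> continuous_on UNIV f"
| "C_k (Suc k) f \<longleftrightarrow> (\<forall>x. f differentiable at x) \<and> (\<forall>i. C_k k (partial_deriv i f))"

definition test_functions :: "(real^3 \<Rightarrow> complex) set" where
  "test_functions = {\<phi>. (\<forall>k. C_k k \<phi>) \<and> compact (closure {x. \<phi> x \<noteq> 0})}"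

definition Lnorm :: "real \<Rightarrow> (real^3 \<Rightarrow> complex) \<Rightarrow> real" where
  "Lnorm s u = (LINT x|lborel. cmod (u x) powr s) powr (1 / s)"

definition L2 :: "(real^3 \<Rightarrow> 'a::euclidean_space) set" where
  "L2 = {f. f \<in> borel_measurable lborel \<and> integrable lborel (\<lambda>x. (norm (f x))\<^sup>2)}"

definition has_weak_gradient :: "(real^3 \<Rightarrow> complex) \<Rightarrow> (real^3 \<Rightarrow> complex^3) \<Rightarrow> bool" where
  "has_weak_gradient u g \<longleftrightarrow> u \<in> L2 \<and> g \<in> L2 \<and>
     (\<forall>\<phi>\<in>test_functions. \<forall>i.
        (LINT x|lborel. u x * partial_deriv i \<phi> x) = - (LINT x|lborel. g x $ i * \<phi> x))"

definition H1 :: "(real^3 \<Rightarrow> complex) set" where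
  "H1 = {u. \<exists>g. has_weak_gradient u g}"

text \<open>The weak gradient is unique up to null sets, so the choice made here is immaterial.\<close>

definition weak_gradient :: "(real^3 \<Rightarrow> complex) \<Rightarrow> real^3 \<Rightarrow> complex^3" where
  "weak_gradient u = (SOME g. has_weak_gradient u g)"

definition A_fun :: "(real^3 \<Rightarrow> complex) \<Rightarrow> real" where
  "A_fun u = (LINT x|lborel. (norm (weak_gradient u x))\<^sup>2)"

definition B_fun :: "(real^3 \<Rightarrow> complex) \<Rightarrow> real" where
  "B_fun u = (LINT x|lborel. LINT y|lborel. (cmod (u x))\<^sup>2 * (cmod (u y))\<^sup>2 / norm (x - y))"

definition F_fun :: "real \<Rightarrow> (real^3 \<Rightarrow> complex) \<Rightarrow> real" where
  "F_fun p u = 1/2 * A_fun u + 1/4 * B_fun u - 1/p * Lnorm p u powr p"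

definition Q_fun :: "real \<Rightarrow> (real^3 \<Rightarrow> complex) \<Rightarrow> real" where
  "Q_fun p u = A_fun u + 1/4 * B_fun u - 3 * (p - 2) / (2 * p) * Lnorm p u powr p"

definition S_set :: "real \<Rightarrow> (real^3 \<Rightarrow> complex) set" where
  "S_set c = {u \<in> H1. (Lnorm 2 u)\<^sup>2 = c}"

definition V_set :: "real \<Rightarrow> real \<Rightarrow> (real^3 \<Rightarrow> complex) set" where
  "V_set p c = {u \<in> S_set c. Q_fun p u = 0}"

text \<open>
  For \<open>p > 10/3\<close> the functional is nonnegative on the constraint set, because
  \<open>F - 2 / (3 * (p - 2)) * Q\<close> is nonnegative; hence the infimum below is the genuine one.
\<close>

definition M_set :: "real \<Rightarrow> real \<Rightarrow> (real^3 \<Rightarrow> complex) set" where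
  "M_set p c = {u \<in> V_set p c. F_fun p u = (INF v\<in>V_set p c. F_fun p v)}"

definition hartree :: "(real^3 \<Rightarrow> complex) \<Rightarrow> real^3 \<Rightarrow> real" where
  "hartree v x = (LINT y|lborel. (cmod (v y))\<^sup>2 / norm (x - y))"

text \<open>
  The equation is understood in the weak sense. The integrability clauses state that the convolution
  is finite almost everywhere and that the nonlinear terms can be tested, so that no integral
  below takes its default value; for the other terms this is automatic in \<open>H1\<close>.
\<close>

definition weak_solution :: "real \<Rightarrow> (real^3 \<Rightarrow> complex) \<Rightarrow> real \<Rightarrow> bool" where
  "weak_solution p v l \<longleftrightarrow>
     (AE x in lborel. integrable lborel (\<lambda>y. (cmod (v y))\<^sup>2 / norm (x - y))) \<and>
     (\<forall>\<phi>\<in>test_functions.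
        integrable lborel (\<lambda>x. of_real (hartree v x) * v x * \<phi> x) \<and>
        integrable lborel (\<lambda>x. of_real (cmod (v x) powr (p - 2)) * v x * \<phi> x) \<and>
        (LINT x|lborel. (\<Sum>i\<in>UNIV. weak_gradient v x $ i * partial_deriv i \<phi> x))
        - of_real l * (LINT x|lborel. v x * \<phi> x)
        + (LINT x|lborel. of_real (hartree v x) * v x * \<phi> x)
        - (LINT x|lborel. of_real (cmod (v x) powr (p - 2)) * v x * \<phi> x) = 0)"

end

theory Submission
  imports Defs
begin

text \<open>
  The dilations \<open>u\<^sup>t(x) = t\<^bsup>3/2\<^esup> u(t x)\<close> preserve the mass, and along them
  \<open>F(u\<^sup>t) = t\<^sup>2/2 A + t/4 B - t\<^bsup>3(p-2)/2\<^esup>/p C\<close>, where \<open>C\<close> is the \<open>p\<close>-th power of the \<open>L\<^sup>p\<close> norm, while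
  \<open>Q(u\<^sup>t)\<close> is \<open>t\<close> times the derivative of this function. As \<open>3(p-2)/2 > 2\<close>, the function has a
  single critical point, which is its maximum, and \<open>t\<close> is critical exactly when \<open>u\<^sup>t\<close> lies in
  \<open>V(c)\<close>. A minimizer \<open>u\<close> of \<open>F\<close> on \<open>V(c)\<close> is therefore a mountain pass point: for every \<open>w\<close> of mass
  \<open>c\<close> the fibre of \<open>w\<close> rises at least to the level \<open>F(u)\<close> (lemma \<open>above_level_same_mass\<close>).

  The same holds for every \<open>w \<noteq> 0\<close> of mass at most \<open>c\<close> (lemma \<open>above_level_smaller_mass\<close>). The missing
  mass is added in the form of a multiple of \<open>u\<^sup>t\<close> with \<open>t\<close> tending to 0. Such a function spreads
  out: its gradient, its Coulomb energy and its \<open>L\<^sup>p\<close> norm vanish in the limit, so that it leaves no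
  trace except in the mass.

  Now let \<open>w = u + s v\<close> with \<open>s > 0\<close> small and the real inner product \<open>(u, v)\<close> negative. Then \<open>w\<close> has
  mass at most \<open>c\<close>, and the maximum of its fibre is at least \<open>F(u)\<close>, with equality at \<open>s = 0\<close>, where
  the maximum is attained at \<open>t = 1\<close>. By the envelope principle \<open>dF(u) v \<ge> 0\<close>
  (lemma \<open>energy_derivative_nonneg\<close>). The choice \<open>v = -u\<close> gives \<open>dF(u) u \<le> 0\<close>. The choice
  \<open>v = \<phi> - \<alpha> u\<close> with \<open>\<alpha>\<close> decreasing to \<open>(u, \<phi>)/c\<close>, applied to \<open>\<phi>\<close> and to \<open>-\<phi>\<close>, gives
  \<open>dF(u) \<phi> = \<lambda> (u, \<phi>)\<close> with \<open>\<lambda> = dF(u) u / c \<le> 0\<close>. This is the equation together with the sign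
  of the multiplier; the maximum over the fibre has absorbed the constraint \<open>Q = 0\<close>.

  The analytic facts behind this are elementary. A function in \<open>V(c)\<close> has an integrable \<open>p\<close>-th power:
  otherwise \<open>Q = 0\<close> would read \<open>A + B/4 = 0\<close>, the gradient would vanish, and so would the function
  (lemma \<open>A_fun_zero_imp_zero\<close>). For \<open>u\<close> in \<open>L\<^sup>2\<close> and \<open>L\<^sup>p\<close> with \<open>p > 10/3\<close> the density
  \<open>|u|\<^sup>2\<close> lies in \<open>L\<^sup>1\<close> and \<open>L\<^bsup>5/3\<^esup>\<close>, hence has a bounded Newtonian potential
  (lemma \<open>bounded_potentialI\<close>), which turns the Coulomb energy into a finite symmetric bilinear form
  of densities. The functional \<open>A\<close> is a quadratic form because weak gradients are unique, by the
  fundamental lemma of the calculus of variations.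
\<close>

section \<open>Dilation fibres\<close>

text \<open>
  These are \<open>F(u\<^sup>t)\<close> and \<open>Q(u\<^sup>t)\<close> as functions of \<open>t\<close>, for \<open>u\<close> with gradient term \<open>A\<close>, Coulomb term
  \<open>B\<close> and \<open>p\<close>-th power integral \<open>C\<close>.
\<close>

definition fibre_energy :: "real \<Rightarrow> real \<Rightarrow> real \<Rightarrow> real \<Rightarrow> real \<Rightarrow> real" where
  "fibre_energy p A B C t = t\<^sup>2 / 2 * A + t / 4 * B - t powr (3 * (p - 2) / 2) / p * C"

definition fibre_virial :: "real \<Rightarrow> real \<Rightarrow> real \<Rightarrow> real \<Rightarrow> real \<Rightarrow> real" where
  "fibre_virial p A B C t =
     t\<^sup>2 * A + t / 4 * B - 3 * (p - 2) / (2 * p) * (t powr (3 * (p - 2) / 2) * C)"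

text \<open>
  A convex function lies above its tangent at 1; here it is obtained from the inequality between
  weighted arithmetic and geometric means of \<open>x powr q\<close> and 1.
\<close>

lemma powr_tangent_bound:
  fixes q x :: real
  assumes "1 \<le> q" "0 < x"
  shows "q * (x - 1) \<le> x powr q - 1"
proof -
  have "(x powr q) powr (1 / q) * 1 powr (1 - 1 / q) \<le> (1 / q) * (x powr q) + (1 - 1 / q) * 1"
    using assms by (intro Youngs_inequality_0) auto
  hence "x \<le> (1 / q) * (x powr q) + (1 - 1 / q)"
    using assms by (simp add: powr_powr)
  hence "q * x \<le> q * ((1 / q) * (x powr q) + (1 - 1 / q))"
    using assms by (intro mult_left_mono) auto
  also have "\<dots> = x powr q + q - 1"
    using assms by (simp add: field_simps)
  finally show ?thesis by (simp add: algebra_simps)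
qed

text \<open>
  Criticality expresses \<open>C\<close> through \<open>A\<close> and \<open>B\<close>. The difference of the two energies is then a
  combination, with weights \<open>A\<close> and \<open>B / 4\<close>, of tangent bounds for the power \<open>q = 3 (p - 2) / 2\<close>: one
  in the variable \<open>t\<^sup>2\<close>, which needs \<open>q \<ge> 2\<close>, and one in \<open>t\<close>.
\<close>

lemma fibre_energy_le_at_critical:
  assumes p: "10/3 < p" and nonneg: "0 \<le> A" "0 \<le> B"
    and crit: "fibre_virial p A B C 1 = 0" and t: "0 < t"
  shows "fibre_energy p A B C t \<le> fibre_energy p A B C 1"
proof -
  define q where "q = 3 * (p - 2) / 2"
  have q: "2 < q" using p by (simp add: q_def)
  have C: "C / p = (A + B / 4) / q"
    using crit p by (simp add: fibre_virial_def q_def field_simps)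
  have "q / 2 * (t\<^sup>2 - 1) \<le> (t\<^sup>2) powr (q / 2) - 1"
    using q t by (intro powr_tangent_bound) auto
  also have "(t\<^sup>2) powr (q / 2) = t powr q"
    using t by (simp add: powr_powr flip: powr_numeral)
  finally have 1: "(t\<^sup>2 - 1) / 2 \<le> (t powr q - 1) / q"
    using q by (simp add: field_simps)
  have "q * (t - 1) \<le> t powr q - 1"
    using q t by (intro powr_tangent_bound) auto
  hence 2: "t - 1 \<le> (t powr q - 1) / q"
    using q by (simp add: field_simps)
  have "(t\<^sup>2 - 1) / 2 * A + (t - 1) * (B / 4)
      \<le> (t powr q - 1) / q * A + (t powr q - 1) / q * (B / 4)"
    using nonneg by (intro add_mono mult_right_mono 1 2) auto
  also have "\<dots> = (t powr q - 1) * (C / p)"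
    unfolding C using q by (simp add: field_simps)
  finally have "(t\<^sup>2 - 1) / 2 * A + (t - 1) * (B / 4) \<le> (t powr q - 1) * (C / p)" .
  moreover have "fibre_energy p A B C 1 - fibre_energy p A B C t =
      (t powr q - 1) * (C / p) - ((t\<^sup>2 - 1) / 2 * A + (t - 1) * (B / 4))"
    unfolding fibre_energy_def q_def[symmetric] using p by (simp add: field_simps)
  ultimately show ?thesis by linarith
qed

text \<open>
  After division by \<open>t\<^sup>2\<close> the virial is strictly decreasing in \<open>t\<close>, since \<open>q > 2\<close>. In particular
  its zero is unique.
\<close>

lemma fibre_virial_sign:
  assumes p: "10/3 < p" and pos: "0 < A" "0 \<le> B" "0 < C"
    and s: "0 < s" "fibre_virial p A B C s = 0" and t: "0 < t"
  shows "t < s \<Longrightarrow> 0 < fibre_virial p A B C t" "s < t \<Longrightarrow> fibre_virial p A B C t < 0"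
proof -
  define q where "q = 3 * (p - 2) / 2"
  have q: "2 < q" using p by (simp add: q_def)
  define h where "h r = A + B / (4 * r) - q / p * C * r powr (q - 2)" for r
  have eq: "fibre_virial p A B C r = r\<^sup>2 * h r" if "0 < r" for r
  proof -
    have "r powr q = r\<^sup>2 * r powr (q - 2)"
      using that by (simp flip: powr_add powr_numeral)
    thus ?thesis
      using that p unfolding fibre_virial_def h_def q_def[symmetric]
      by (simp add: field_simps power2_eq_square q_def)
  qed
  have dec: "h r' < h r" if "0 < r" "r < r'" for r r'
  proof -
    have "r powr (q - 2) < r' powr (q - 2)"
      using that q by (intro powr_less_mono2) auto
    hence "q / p * C * r powr (q - 2) < q / p * C * r' powr (q - 2)"
      using q p pos by (intro mult_strict_left_mono) auto
    moreover have "B / (4 * r') \<le> B / (4 * r)"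
      using that pos by (intro divide_left_mono) auto
    ultimately show ?thesis unfolding h_def by linarith
  qed
  have "h s = 0" using s eq[of s] by simp
  thus "t < s \<Longrightarrow> 0 < fibre_virial p A B C t" "s < t \<Longrightarrow> fibre_virial p A B C t < 0"
    using dec[of t s] dec[of s t] s t eq[of t] by (auto simp: mult_less_0_iff)
qed

text \<open>
  The critical point depends continuously on the coefficients: the virial of the limit changes sign
  at \<open>s\<close>, so the virials of the sequence change sign close to \<open>s\<close>.
\<close>

lemma fibre_virial_zero_tendsto:
  fixes An Bn Cn :: "nat \<Rightarrow> real"
  assumes p: "10/3 < p" and pos: "0 < A" "0 < C" and Bn: "\<And>n. 0 \<le> Bn n"
    and lim: "An \<longlonglongrightarrow> A" "Bn \<longlonglongrightarrow> B" "Cn \<longlonglongrightarrow> C"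
    and s: "0 < s" "fibre_virial p A B C s = 0"
  obtains \<tau> where "\<tau> \<longlonglongrightarrow> s"
    "\<forall>\<^sub>F n in sequentially. 0 < \<tau> n \<and> fibre_virial p (An n) (Bn n) (Cn n) (\<tau> n) = 0"
proof -
  have B: "0 \<le> B" using Bn lim(2) by (intro LIMSEQ_le_const) auto
  \<comment> \<open>The zero is unique, so an arbitrary choice picks the one found near \<open>s\<close> below.\<close>
  define \<tau> where "\<tau> n = (SOME t. 0 < t \<and> fibre_virial p (An n) (Bn n) (Cn n) t = 0)" for n
  have fl: "(\<lambda>n. fibre_virial p (An n) (Bn n) (Cn n) t) \<longlonglongrightarrow> fibre_virial p A B C t" for t
    unfolding fibre_virial_def by (intro tendsto_intros lim)
  have near: "\<forall>\<^sub>F n in sequentially. 0 < \<tau> n \<and> fibre_virial p (An n) (Bn n) (Cn n) (\<tau> n) = 0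
      \<and> \<bar>\<tau> n - s\<bar> \<le> e" if e: "0 < e" "e < s" for e
  proof -
    have "0 < fibre_virial p A B C (s - e)"
      by (rule fibre_virial_sign(1)[of p A B C s]) (use p pos B s e in auto)
    hence 1: "\<forall>\<^sub>F n in sequentially. 0 < fibre_virial p (An n) (Bn n) (Cn n) (s - e)"
      using fl order_tendstoD(1) by blast
    have "fibre_virial p A B C (s + e) < 0"
      by (rule fibre_virial_sign(2)[of p A B C s]) (use p pos B s e in auto)
    hence 2: "\<forall>\<^sub>F n in sequentially. fibre_virial p (An n) (Bn n) (Cn n) (s + e) < 0"
      using fl order_tendstoD(2) by blast
    have 3: "\<forall>\<^sub>F n in sequentially. 0 < An n" "\<forall>\<^sub>F n in sequentially. 0 < Cn n"
      using lim pos order_tendstoD(1) by blast+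
    show ?thesis using 1 2 3
    proof eventually_elim
      case (elim n)
      let ?v = "fibre_virial p (An n) (Bn n) (Cn n)"
      have "\<exists>t\<ge>s - e. t \<le> s + e \<and> ?v t = 0"
        by (rule IVT2')
          (use elim e s p in \<open>auto simp: fibre_virial_def intro!: continuous_intros\<close>)
      then obtain t where t: "s - e \<le> t" "t \<le> s + e" "?v t = 0" by blast
      hence "0 < t \<and> ?v t = 0" using e by linarith
      hence \<tau>: "0 < \<tau> n" "?v (\<tau> n) = 0"
        unfolding \<tau>_def by (metis (mono_tags, lifting) someI_ex)+
      have "\<tau> n = t"
        using fibre_virial_sign[of p "An n" "Bn n" "Cn n" t "\<tau> n"] \<tau> t elim p Bn e
        by (cases "\<tau> n" t rule: linorder_cases) auto
      thus ?case using \<tau> t by auto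
    qed
  qed
  have "\<tau> \<longlonglongrightarrow> s"
    unfolding tendsto_iff
  proof (intro allI impI)
    fix e :: real assume "0 < e"
    hence "0 < min (e/2) (s/2)" "min (e/2) (s/2) < s" using s by auto
    from near[OF this] show "\<forall>\<^sub>F n in sequentially. dist (\<tau> n) s < e"
      by eventually_elim (use \<open>0 < e\<close> in \<open>auto simp: dist_real_def\<close>)
  qed
  moreover have "\<forall>\<^sub>F n in sequentially. 0 < \<tau> n \<and> fibre_virial p (An n) (Bn n) (Cn n) (\<tau> n) = 0"
    using near[of "s/2"] s by (auto elim: eventually_mono)
  ultimately show thesis using that by blast
qed

text \<open>
  A fibre is above the level \<open>\<gamma>\<close> if its maximum is at least \<open>\<gamma>\<close>. The maximum is referred to as a
  critical value because critical points are what membership in \<open>V(c)\<close> provides.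
\<close>

definition above_level :: "real \<Rightarrow> real \<Rightarrow> real \<Rightarrow> real \<Rightarrow> real \<Rightarrow> bool" where
  "above_level p \<gamma> A B C \<longleftrightarrow>
     (\<forall>t>0. fibre_virial p A B C t = 0 \<longrightarrow> \<gamma> \<le> fibre_energy p A B C t)"

lemma above_level_limit:
  fixes An Bn Cn :: "nat \<Rightarrow> real"
  assumes p: "10/3 < p" and pos: "0 < A" "0 < C" and Bn: "\<And>n. 0 \<le> Bn n"
    and lim: "An \<longlonglongrightarrow> A" "Bn \<longlonglongrightarrow> B" "Cn \<longlonglongrightarrow> C"
    and above: "\<forall>\<^sub>F n in sequentially. above_level p \<gamma> (An n) (Bn n) (Cn n)"
  shows "above_level p \<gamma> A B C"
  unfolding above_level_def
proof (intro allI impI)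
  fix s :: real assume s: "0 < s" "fibre_virial p A B C s = 0"
  obtain \<tau> where \<tau>: "\<tau> \<longlonglongrightarrow> s"
    "\<forall>\<^sub>F n in sequentially. 0 < \<tau> n \<and> fibre_virial p (An n) (Bn n) (Cn n) (\<tau> n) = 0"
    using fibre_virial_zero_tendsto[OF p pos Bn lim s] by blast
  have "(\<lambda>n. fibre_energy p (An n) (Bn n) (Cn n) (\<tau> n)) \<longlonglongrightarrow> fibre_energy p A B C s"
    unfolding fibre_energy_def by (intro tendsto_intros lim \<tau>(1)) (use p s in auto)
  moreover have "\<forall>\<^sub>F n in sequentially. \<gamma> \<le> fibre_energy p (An n) (Bn n) (Cn n) (\<tau> n)"
    using \<tau>(2) above by eventually_elim (auto simp: above_level_def)
  ultimately show "\<gamma> \<le> fibre_energy p A B C s"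
    by (intro tendsto_lowerbound[where F = sequentially]) auto
qed

lemma tendsto_if_difference_quotient:
  fixes X s :: "nat \<Rightarrow> real"
  assumes "(\<lambda>n. (X n - x) / s n) \<longlonglongrightarrow> x'" and s: "\<And>n. 0 < s n" "s \<longlonglongrightarrow> 0"
  shows "X \<longlonglongrightarrow> x"
proof -
  have "(\<lambda>n. (X n - x) / s n * s n + x) \<longlonglongrightarrow> x' * 0 + x"
    by (intro tendsto_intros assms)
  moreover have "(\<lambda>n. (X n - x) / s n * s n + x) = X"
    using s(1) by (auto simp: fun_eq_iff less_imp_neq[symmetric])
  ultimately show ?thesis by simp
qed

text \<open>
  The envelope principle: in the derivative of the maximum of a fibre, the motion of the maximizer
  does not contribute. With \<open>\<tau> n\<close> the maximizer of the \<open>n\<close>-th fibre, the energy of that fibre at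
  \<open>\<tau> n\<close> is at least the level, and the level is at least the energy of the limit fibre at the same
  \<open>\<tau> n\<close>. The difference of these two energies is linear in the differences of the coefficients.
\<close>

lemma above_level_directional_derivative:
  fixes An Bn Cn s :: "nat \<Rightarrow> real"
  assumes p: "10/3 < p" and pos: "0 < A" "0 < C" and Bn: "\<And>n. 0 \<le> Bn n"
    and s: "\<And>n. 0 < s n" "s \<longlonglongrightarrow> 0"
    and der: "(\<lambda>n. (An n - A) / s n) \<longlonglongrightarrow> A'" "(\<lambda>n. (Bn n - B) / s n) \<longlonglongrightarrow> B'"
      "(\<lambda>n. (Cn n - C) / s n) \<longlonglongrightarrow> C'"
    and crit: "fibre_virial p A B C 1 = 0"
    and above: "\<forall>\<^sub>F n in sequentially. above_level p (fibre_energy p A B C 1) (An n) (Bn n) (Cn n)"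
  shows "0 \<le> A' / 2 + B' / 4 - C' / p"
proof -
  note lim = tendsto_if_difference_quotient[OF _ s]
  note lims = lim[OF der(1)] lim[OF der(2)] lim[OF der(3)]
  have B: "0 \<le> B" using Bn lims(2) by (intro LIMSEQ_le_const) auto
  obtain \<tau> where \<tau>: "\<tau> \<longlonglongrightarrow> 1"
    "\<forall>\<^sub>F n in sequentially. 0 < \<tau> n \<and> fibre_virial p (An n) (Bn n) (Cn n) (\<tau> n) = 0"
    using fibre_virial_zero_tendsto[OF p pos Bn lims _ crit] by auto
  define d where "d n = (\<tau> n)\<^sup>2 / 2 * ((An n - A) / s n) + \<tau> n / 4 * ((Bn n - B) / s n)
      - \<tau> n powr (3 * (p - 2) / 2) / p * ((Cn n - C) / s n)" for n
  have "d \<longlonglongrightarrow> 1\<^sup>2 / 2 * A' + 1 / 4 * B' - 1 powr (3 * (p - 2) / 2) / p * C'"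
    unfolding d_def by (intro tendsto_intros der \<tau>(1)) (use p in auto)
  moreover have "\<forall>\<^sub>F n in sequentially. 0 \<le> d n"
    using \<tau>(2) above
  proof eventually_elim
    case (elim n)
    have "fibre_energy p A B C (\<tau> n) \<le> fibre_energy p A B C 1"
      using fibre_energy_le_at_critical[OF p _ B crit] elim pos by auto
    also have "\<dots> \<le> fibre_energy p (An n) (Bn n) (Cn n) (\<tau> n)"
      using elim by (auto simp: above_level_def)
    finally have "0 \<le> (fibre_energy p (An n) (Bn n) (Cn n) (\<tau> n) - fibre_energy p A B C (\<tau> n)) / s n"
      using s(1)[of n] by simp
    also have "\<dots> = d n"
      using s(1)[of n] p unfolding d_def fibre_energy_def by (simp add: field_simps)
    finally show ?case .
  qed
  ultimately have "0 \<le> 1\<^sup>2 / 2 * A' + 1 / 4 * B' - 1 powr (3 * (p - 2) / 2) / p * C'"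
    by (intro tendsto_lowerbound[where F = sequentially]) auto
  thus ?thesis by simp
qed

section \<open>Newtonian potentials and Coulomb energy\<close>

lemma integrable_lborel_affine_iff:
  fixes a :: "'a::euclidean_space" and f :: "'a \<Rightarrow> 'b::{banach, second_countable_topology}"
  assumes [measurable]: "f \<in> borel_measurable borel" and t: "t \<noteq> 0"
  shows "integrable lborel (\<lambda>x. f (a + t *\<^sub>R x)) \<longleftrightarrow> integrable lborel f"
proof -
  have "integrable lborel f \<longleftrightarrow>
      integrable (density (distr lborel borel (\<lambda>x. a + t *\<^sub>R x)) (\<lambda>_. \<bar>t\<bar> ^ DIM('a))) f"
    using lborel_affine[OF t, of a] by simp
  also have "\<dots> \<longleftrightarrow> integrable lborel (\<lambda>x. \<bar>t\<bar> ^ DIM('a) *\<^sub>R f (a + t *\<^sub>R x))"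
    by (subst integrable_density) (auto simp: integrable_distr_eq)
  also have "\<dots> \<longleftrightarrow> integrable lborel (\<lambda>x. f (a + t *\<^sub>R x))"
  proof
    assume "integrable lborel (\<lambda>x. \<bar>t\<bar> ^ DIM('a) *\<^sub>R f (a + t *\<^sub>R x))"
    from integrable_scaleR_right[OF this, of "1 / \<bar>t\<bar> ^ DIM('a)"]
    show "integrable lborel (\<lambda>x. f (a + t *\<^sub>R x))" using t by simp
  qed (rule integrable_scaleR_right)
  finally show ?thesis by simp
qed

lemma integral_lborel_affine:
  fixes a :: "'a::euclidean_space" and f :: "'a \<Rightarrow> 'b::{banach, second_countable_topology}"
  assumes [measurable]: "f \<in> borel_measurable borel" and t: "t \<noteq> 0"
  shows "(LINT x|lborel. f (a + t *\<^sub>R x)) = (1 / \<bar>t\<bar> ^ DIM('a)) *\<^sub>R (LINT x|lborel. f x)"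
proof -
  have "(LINT x|lborel. f x) =
      (LINT x|density (distr lborel borel (\<lambda>x. a + t *\<^sub>R x)) (\<lambda>_. \<bar>t\<bar> ^ DIM('a)). f x)"
    using lborel_affine[OF t, of a] by simp
  also have "\<dots> = (LINT x|lborel. \<bar>t\<bar> ^ DIM('a) *\<^sub>R f (a + t *\<^sub>R x))"
    by (subst integral_density) (auto simp: integral_distr)
  also have "\<dots> = \<bar>t\<bar> ^ DIM('a) *\<^sub>R (LINT x|lborel. f (a + t *\<^sub>R x))"
    by simp
  finally show ?thesis using t by simp
qed

text \<open>
  The exponent \<open>5/2\<close> is below the dimension, so the singularity is integrable. The kernel is
  dominated by the sum of \<open>32\<^bsup>k+1\<^esup>\<close> times the indicator of the ball of radius \<open>4\<^bsup>-k\<^esup>\<close>; the volumes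
  of these balls are proportional to \<open>64\<^bsup>-k\<^esup>\<close>, which leaves a geometric series of ratio \<open>1/2\<close>.
\<close>

lemma near_kernel_integral_bounded:
  obtains N :: real where "0 \<le> N"
    "\<And>x::real^3. (\<integral>\<^sup>+ y. ennreal (indicator (cball x 1) y * norm (x - y) powr (-5/2)) \<partial>lborel) \<le> ennreal N"
proof
  define V where "V = unit_ball_vol (real DIM(real^3))"
  have V: "0 \<le> V" by (simp add: V_def)
  show "0 \<le> 64 * V" using V by simp
  fix x :: "real^3"
  have cball[measurable]: "cball x r \<in> sets borel" for r by simp
  have pw: "ennreal (indicator (cball x 1) y * norm (x - y) powr (-5/2))
      \<le> (\<Sum>k. ennreal (32 ^ Suc k) * indicator (cball x (1 / 4 ^ k)) y)" for y
  proof (cases "y \<in> cball x 1 \<and> y \<noteq> x")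
    case True
    define r where "r = norm (x - y)"
    have r: "0 < r" "r \<le> 1" using True by (auto simp: r_def dist_norm)
    define n where "n = (LEAST k. 1 / 4 ^ k < r)"
    obtain k0 where "(1 / 4) ^ k0 < r" using real_arch_pow_inv[OF r(1), of "1/4"] by auto
    hence ex: "1 / 4 ^ k0 < r" by (simp add: power_one_over)
    have n: "1 / 4 ^ n < r" unfolding n_def by (rule LeastI[of _ k0]) (rule ex)
    have "n \<noteq> 0" using n r by (intro notI) auto
    then obtain k where k: "n = Suc k" by (cases n) auto
    have "\<not> 1 / 4 ^ k < r" using not_less_Least[of k "\<lambda>k. 1 / 4 ^ k < r"] k n_def by auto
    hence rk: "r \<le> 1 / 4 ^ k" by simp
    have "r powr (-5/2) \<le> (1 / 4 ^ Suc k) powr (-5/2)"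
      using n r k by (intro powr_mono2') auto
    also have "1 / 4 ^ Suc k = (4::real) powr (- real (Suc k))"
      by (simp only: powr_minus_divide powr_realpow zero_less_numeral)
    also have "\<dots> powr (-5/2) = (4 powr (5/2)) powr real (Suc k)"
      unfolding powr_powr by (rule arg_cong[of _ _ "\<lambda>a. 4 powr a"]) linarith
    also have "\<dots> = (4 powr (5/2)) ^ Suc k"
      by (rule powr_realpow) simp
    also have "(4::real) powr (5/2) = 32"
    proof -
      have "(4::real) powr (5/2) = (2 powr 2) powr (5/2)" by (subst powr_numeral) auto
      also have "\<dots> = 2 powr (real 5)" by (subst powr_powr) simp
      also have "\<dots> = 32" by (subst powr_realpow) auto
      finally show ?thesis .
    qed
    finally have "ennreal (indicator (cball x 1) y * norm (x - y) powr (-5/2))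
        \<le> ennreal (32 ^ Suc k) * indicator (cball x (1 / 4 ^ k)) y"
      using True rk by (auto simp: r_def dist_norm intro!: ennreal_leI)
    also have "\<dots> = (\<Sum>i\<in>{k}. ennreal (32 ^ Suc i) * indicator (cball x (1 / 4 ^ i)) y)"
      by (simp only: sum.insert sum.empty finite.emptyI empty_iff not_False_eq_True add_0_right)
    also have "\<dots> \<le> (\<Sum>k. ennreal (32 ^ Suc k) * indicator (cball x (1 / 4 ^ k)) y)"
      by (intro sum_le_suminf) auto
    finally show ?thesis .
  qed auto
  have "(\<integral>\<^sup>+ y. ennreal (indicator (cball x 1) y * norm (x - y) powr (-5/2)) \<partial>lborel)
      \<le> (\<integral>\<^sup>+ y. (\<Sum>k. ennreal (32 ^ Suc k) * indicator (cball x (1 / 4 ^ k)) y) \<partial>lborel)"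
    by (intro nn_integral_mono pw)
  also have "\<dots> = (\<Sum>k. \<integral>\<^sup>+ y. ennreal (32 ^ Suc k) * indicator (cball x (1 / 4 ^ k)) y \<partial>lborel)"
    by (intro nn_integral_suminf) measurable
  also have "\<dots> = (\<Sum>k. ennreal (32 ^ Suc k) * emeasure lborel (cball x (1 / 4 ^ k)))"
    by (simp only: nn_integral_cmult_indicator cball sets_lborel)
  also have "\<dots> = (\<Sum>k. ennreal (32 * V * (1 / 2) ^ k))"
  proof (intro suminf_cong)
    fix k
    have "((4::real) ^ k) ^ 3 = (4 ^ 3) ^ k"
      unfolding power_mult[symmetric] by (simp add: mult.commute)
    hence "(32::real) ^ Suc k * (V * (1 / 4 ^ k) ^ 3) = 32 * V * (32 ^ k / 64 ^ k)"
      by (simp add: power_one_over)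
    also have "(32::real) ^ k / 64 ^ k = (1 / 2) ^ k"
      unfolding power_divide[symmetric] by simp
    finally have e: "(32::real) ^ Suc k * (V * (1 / 4 ^ k) ^ 3) = 32 * V * (1 / 2) ^ k" .
    have m: "emeasure lborel (cball x (1 / 4 ^ k)) = ennreal (V * (1 / 4 ^ k) ^ 3)"
      using emeasure_cball[of "1 / 4 ^ k" x] by (simp add: V_def)
    show "ennreal (32 ^ Suc k) * emeasure lborel (cball x (1 / 4 ^ k)) = ennreal (32 * V * (1 / 2) ^ k)"
      unfolding m e[symmetric] using V by (intro ennreal_mult[symmetric]) auto
  qed
  also have "\<dots> = ennreal (32 * V * (1 / (1 - 1 / 2)))"
    using V by (intro suminf_ennreal_eq sums_mult geometric_sums) auto
  finally show "(\<integral>\<^sup>+ y. ennreal (indicator (cball x 1) y * norm (x - y) powr (-5/2)) \<partial>lborel) \<le> ennreal (64 * V)"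
    by simp
qed

definition potential :: "(real^3 \<Rightarrow> real) \<Rightarrow> real^3 \<Rightarrow> real" where
  "potential f x = (LINT y|lborel. f y / norm (x - y))"

text \<open>
  The bound is stated with nonnegative integrals of absolute values, so that it yields the
  integrability of \<open>f y / norm (x - y)\<close> for every \<open>x\<close> and is inherited by dominated functions.
\<close>

definition bounded_potential :: "(real^3 \<Rightarrow> real) \<Rightarrow> bool" where
  "bounded_potential f \<longleftrightarrow> integrable lborel f \<and>
     (\<exists>K\<ge>0. \<forall>x. (\<integral>\<^sup>+ y. ennreal (\<bar>f y\<bar> / norm (x - y)) \<partial>lborel) \<le> ennreal K)"

text \<open>
  At distance \<open>r > 1\<close> the kernel is at most 1. At distance \<open>r \<le> 1\<close> one has
  \<open>f / r \<le> f\<^bsup>5/3\<^esup> + r\<^bsup>-5/2\<^esup>\<close> for \<open>f \<ge> 0\<close>: the second term dominates if \<open>f \<le> r\<^bsup>-3/2\<^esup>\<close>, the first one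
  otherwise. All resulting integrals are bounded independently of the centre \<open>x\<close>.
\<close>

lemma bounded_potentialI:
  assumes f: "integrable lborel f" and f53: "integrable lborel (\<lambda>x. \<bar>f x\<bar> powr (5/3))"
  shows "bounded_potential f"
proof -
  have [measurable]: "f \<in> borel_measurable borel" using f by auto
  obtain N :: real where N: "0 \<le> N"
    "\<And>x::real^3. (\<integral>\<^sup>+ y. ennreal (indicator (cball x 1) y * norm (x - y) powr (-5/2)) \<partial>lborel) \<le> ennreal N"
    using near_kernel_integral_bounded by blast
  define K where "K = (LINT y|lborel. \<bar>f y\<bar>) + (LINT y|lborel. \<bar>f y\<bar> powr (5/3)) + N"
  have pw: "\<bar>f y\<bar> / norm (x - y)
      \<le> \<bar>f y\<bar> + \<bar>f y\<bar> powr (5/3) + indicator (cball x 1) y * norm (x - y) powr (-5/2)" for x y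
  proof (cases "1 < norm (x - y) \<or> x = y \<or> f y = 0")
    case True
    thus ?thesis
    proof (elim disjE)
      assume "1 < norm (x - y)"
      hence "\<bar>f y\<bar> / norm (x - y) \<le> \<bar>f y\<bar> / 1" by (intro divide_left_mono) auto
      thus ?thesis by (auto simp: indicator_def intro: order_trans)
    qed auto
  next
    case False
    define r where "r = norm (x - y)"
    define g where "g = \<bar>f y\<bar>"
    have r: "0 < r" "r \<le> 1" and g: "0 < g" using False by (auto simp: r_def g_def)
    have "g / r \<le> g powr (5/3) + r powr (-5/2)"
    proof (cases "g \<le> r powr (-3/2)")
      case True
      have "g / r \<le> r powr (-3/2) / r" using True r by (intro divide_right_mono) auto
      also have "\<dots> = r powr (-5/2)"
        using r powr_diff[of r "-3/2" 1] by simp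
      finally show ?thesis by (simp add: add_increasing)
    next
      case False
      hence "(r powr (-3/2)) powr (2/3) \<le> g powr (2/3)" by (intro powr_mono2) auto
      moreover have "(r powr (-3/2)) powr (2/3) = 1 / r"
        using r by (subst powr_powr) (simp add: powr_minus_divide)
      ultimately have "1 / r \<le> g powr (2/3)" by simp
      hence "g * (1 / r) \<le> g * g powr (2/3)" using g by (intro mult_left_mono) auto
      also have "\<dots> = g powr (5/3)" using g by (simp add: powr_mult_base)
      finally show ?thesis by (simp add: add_increasing2)
    qed
    moreover have "y \<in> cball x 1" using r by (simp add: r_def dist_norm)
    ultimately show ?thesis by (simp add: r_def g_def add_increasing)
  qed
  have "(\<integral>\<^sup>+ y. ennreal (\<bar>f y\<bar> / norm (x - y)) \<partial>lborel) \<le> ennreal K" for x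
  proof -
    have [measurable]: "cball x 1 \<in> sets borel" by simp
    have "(\<integral>\<^sup>+ y. ennreal (\<bar>f y\<bar> / norm (x - y)) \<partial>lborel) \<le>
      (\<integral>\<^sup>+ y. (ennreal \<bar>f y\<bar> + ennreal (\<bar>f y\<bar> powr (5/3)))
          + ennreal (indicator (cball x 1) y * norm (x - y) powr (-5/2)) \<partial>lborel)"
      by (intro nn_integral_mono) (use pw in \<open>auto simp flip: ennreal_plus intro!: ennreal_leI\<close>)
    also have "\<dots> = (\<integral>\<^sup>+ y. ennreal \<bar>f y\<bar> \<partial>lborel) + (\<integral>\<^sup>+ y. ennreal (\<bar>f y\<bar> powr (5/3)) \<partial>lborel)
        + (\<integral>\<^sup>+ y. ennreal (indicator (cball x 1) y * norm (x - y) powr (-5/2)) \<partial>lborel)"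
      by (intro trans[OF nn_integral_add] arg_cong2[of _ _ _ _ "(+)"] nn_integral_add refl; measurable)
    also have "(\<integral>\<^sup>+ y. ennreal \<bar>f y\<bar> \<partial>lborel) = ennreal (LINT y|lborel. \<bar>f y\<bar>)"
      using f by (intro nn_integral_eq_integral) auto
    also have "(\<integral>\<^sup>+ y. ennreal (\<bar>f y\<bar> powr (5/3)) \<partial>lborel) = ennreal (LINT y|lborel. \<bar>f y\<bar> powr (5/3))"
      using f53 by (intro nn_integral_eq_integral) auto
    also have "ennreal (LINT y|lborel. \<bar>f y\<bar>) + ennreal (LINT y|lborel. \<bar>f y\<bar> powr (5/3))
        + (\<integral>\<^sup>+ y. ennreal (indicator (cball x 1) y * norm (x - y) powr (-5/2)) \<partial>lborel)
        \<le> ennreal (LINT y|lborel. \<bar>f y\<bar>) + ennreal (LINT y|lborel. \<bar>f y\<bar> powr (5/3)) + ennreal N"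
      by (intro add_left_mono N)
    also have "\<dots> = ennreal K"
      using N by (simp add: K_def flip: ennreal_plus)
    finally show ?thesis .
  qed
  moreover have "0 \<le> K" using N by (simp add: K_def)
  ultimately show ?thesis unfolding bounded_potential_def using f by auto
qed

lemma bounded_potential_dominated:
  assumes g: "bounded_potential g" and [measurable]: "f \<in> borel_measurable borel"
    and le: "\<And>x. \<bar>f x\<bar> \<le> C * \<bar>g x\<bar>" and C: "0 \<le> C"
  shows "bounded_potential f"
proof -
  have [measurable]: "g \<in> borel_measurable borel" using g by (auto simp: bounded_potential_def)
  obtain K where K: "0 \<le> K" "\<And>x. (\<integral>\<^sup>+ y. ennreal (\<bar>g y\<bar> / norm (x - y)) \<partial>lborel) \<le> ennreal K"
    using g by (auto simp: bounded_potential_def)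
  have "integrable lborel f"
    by (rule Bochner_Integration.integrable_bound[of _ "\<lambda>x. C * \<bar>g x\<bar>"])
       (use g le C in \<open>auto simp: bounded_potential_def\<close>)
  moreover have "(\<integral>\<^sup>+ y. ennreal (\<bar>f y\<bar> / norm (x - y)) \<partial>lborel) \<le> ennreal (C * K)" for x
  proof -
    have "(\<integral>\<^sup>+ y. ennreal (\<bar>f y\<bar> / norm (x - y)) \<partial>lborel) \<le>
        (\<integral>\<^sup>+ y. ennreal C * ennreal (\<bar>g y\<bar> / norm (x - y)) \<partial>lborel)"
      using le C by (intro nn_integral_mono)
        (auto simp flip: ennreal_mult intro!: ennreal_leI divide_right_mono)
    also have "\<dots> = ennreal C * (\<integral>\<^sup>+ y. ennreal (\<bar>g y\<bar> / norm (x - y)) \<partial>lborel)"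
      by (intro nn_integral_cmult) measurable
    also have "\<dots> \<le> ennreal C * ennreal K" by (intro mult_left_mono K) auto
    finally show ?thesis using C K by (simp add: ennreal_mult)
  qed
  ultimately show ?thesis unfolding bounded_potential_def using C K
    by (intro conjI exI[of _ "C * K"]) auto
qed

lemma bounded_potential_add:
  assumes f: "bounded_potential f" and g: "bounded_potential g"
  shows "bounded_potential (\<lambda>x. f x + g x)"
proof -
  have [measurable]: "f \<in> borel_measurable borel" "g \<in> borel_measurable borel"
    using f g by (auto simp: bounded_potential_def)
  obtain K where K: "0 \<le> K" "\<And>x. (\<integral>\<^sup>+ y. ennreal (\<bar>f y\<bar> / norm (x - y)) \<partial>lborel) \<le> ennreal K"
    using f by (auto simp: bounded_potential_def)
  obtain L where L: "0 \<le> L" "\<And>x. (\<integral>\<^sup>+ y. ennreal (\<bar>g y\<bar> / norm (x - y)) \<partial>lborel) \<le> ennreal L"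
    using g by (auto simp: bounded_potential_def)
  have "(\<integral>\<^sup>+ y. ennreal (\<bar>f y + g y\<bar> / norm (x - y)) \<partial>lborel) \<le> ennreal (K + L)" for x
  proof -
    have "(\<integral>\<^sup>+ y. ennreal (\<bar>f y + g y\<bar> / norm (x - y)) \<partial>lborel) \<le>
      (\<integral>\<^sup>+ y. ennreal (\<bar>f y\<bar> / norm (x - y)) + ennreal (\<bar>g y\<bar> / norm (x - y)) \<partial>lborel)"
      by (intro nn_integral_mono)
        (auto simp flip: ennreal_plus add_divide_distrib intro!: ennreal_leI divide_right_mono)
    also have "\<dots> = (\<integral>\<^sup>+ y. ennreal (\<bar>f y\<bar> / norm (x - y)) \<partial>lborel) +
        (\<integral>\<^sup>+ y. ennreal (\<bar>g y\<bar> / norm (x - y)) \<partial>lborel)"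
      by (intro nn_integral_add) measurable
    also have "\<dots> \<le> ennreal K + ennreal L" by (intro add_mono K L)
    finally show ?thesis using K L by simp
  qed
  thus ?thesis using f g K L unfolding bounded_potential_def
    by (intro conjI exI[of _ "K + L"]) auto
qed

lemma bounded_potential_measurable:
  "bounded_potential f \<Longrightarrow> f \<in> borel_measurable borel"
  by (auto simp: bounded_potential_def)

lemma bounded_potential_cmult:
  "bounded_potential f \<Longrightarrow> bounded_potential (\<lambda>x. c * f x)"
  by (rule bounded_potential_dominated[of f _ "\<bar>c\<bar>"])
     (auto simp: abs_mult dest: bounded_potential_measurable)

lemma bounded_potential_abs:
  "bounded_potential f \<Longrightarrow> bounded_potential (\<lambda>x. \<bar>f x\<bar>)"
  by (rule bounded_potential_dominated[of f _ 1]) (auto dest: bounded_potential_measurable)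

lemma bounded_potential_integrable:
  assumes f: "bounded_potential f"
  shows "integrable lborel (\<lambda>y. f y / norm (x - y))"
proof (rule integrableI_bounded)
  have [measurable]: "f \<in> borel_measurable borel" using f by (rule bounded_potential_measurable)
  show "(\<lambda>y. f y / norm (x - y)) \<in> borel_measurable lborel" by measurable
  obtain K where K: "0 \<le> K" "\<And>x. (\<integral>\<^sup>+ y. ennreal (\<bar>f y\<bar> / norm (x - y)) \<partial>lborel) \<le> ennreal K"
    using f by (auto simp: bounded_potential_def)
  show "(\<integral>\<^sup>+ y. ennreal (norm (f y / norm (x - y))) \<partial>lborel) < \<infinity>"
    using le_less_trans[OF K(2)[of x]] by (simp add: ennreal_less_top)
qed

lemma potential_measurable:
  assumes "bounded_potential f"
  shows "potential f \<in> borel_measurable borel"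
proof -
  have [measurable]: "f \<in> borel_measurable borel" using assms by (rule bounded_potential_measurable)
  have "(\<lambda>x. LINT y|lborel. f y / norm (x - y)) \<in> borel_measurable borel"
    by measurable
  thus ?thesis unfolding potential_def[abs_def] .
qed

lemma potential_bounded:
  assumes f: "bounded_potential f"
  obtains K where "0 \<le> K" "\<And>x. \<bar>potential f x\<bar> \<le> K"
proof -
  obtain K where K: "0 \<le> K" "\<And>x. (\<integral>\<^sup>+ y. ennreal (\<bar>f y\<bar> / norm (x - y)) \<partial>lborel) \<le> ennreal K"
    using f by (auto simp: bounded_potential_def)
  have "\<bar>potential f x\<bar> \<le> K" for x
  proof -
    have "ennreal (LINT y|lborel. \<bar>f y / norm (x - y)\<bar>) = (\<integral>\<^sup>+ y. ennreal (\<bar>f y\<bar> / norm (x - y)) \<partial>lborel)"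
      using integrable_abs[OF bounded_potential_integrable[OF f, of x]]
      by (subst nn_integral_eq_integral[symmetric]) auto
    also have "\<dots> \<le> ennreal K" by (rule K)
    finally have "(LINT y|lborel. \<bar>f y / norm (x - y)\<bar>) \<le> K"
      using K(1) by (simp only: ennreal_le_iff)
    moreover have "\<bar>potential f x\<bar> \<le> (LINT y|lborel. \<bar>f y / norm (x - y)\<bar>)"
      unfolding potential_def by (rule integral_abs_bound)
    ultimately show ?thesis by simp
  qed
  thus thesis using that K by blast
qed

lemma potential_add:
  assumes "bounded_potential f" "bounded_potential g"
  shows "potential (\<lambda>x. f x + g x) x = potential f x + potential g x"
  unfolding potential_def
  using bounded_potential_integrable[OF assms(1), of x] bounded_potential_integrable[OF assms(2), of x]
  by (simp add: add_divide_distrib)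

lemma potential_cmult: "potential (\<lambda>x. c * f x) x = c * potential f x"
  unfolding potential_def by (simp flip: times_divide_eq_right)

lemma potential_mono:
  assumes "bounded_potential f" "bounded_potential g" "\<And>x. f x \<le> g x"
  shows "potential f x \<le> potential g x"
  unfolding potential_def
  using bounded_potential_integrable[OF assms(1), of x] bounded_potential_integrable[OF assms(2), of x]
  by (intro integral_mono) (auto intro: divide_right_mono assms)

lemma potential_nonneg: "(\<And>x. 0 \<le> f x) \<Longrightarrow> 0 \<le> potential f x"
  unfolding potential_def by (intro integral_nonneg_AE) auto

lemma bounded_potential_times_integrable:
  fixes h :: "real^3 \<Rightarrow> 'a::{banach, second_countable_topology}"
  assumes g: "bounded_potential g" and h: "integrable lborel h"
  shows "integrable lborel (\<lambda>x. potential g x *\<^sub>R h x)"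
proof -
  note [measurable] = potential_measurable[OF g]
  obtain K where K: "0 \<le> K" "\<And>x. \<bar>potential g x\<bar> \<le> K" using potential_bounded[OF g] by blast
  show ?thesis
    by (rule Bochner_Integration.integrable_bound[of _ "\<lambda>x. K * norm (h x)"])
       (use h K in \<open>auto intro!: mult_right_mono\<close>)
qed

definition coulomb :: "(real^3 \<Rightarrow> real) \<Rightarrow> (real^3 \<Rightarrow> real) \<Rightarrow> real" where
  "coulomb f g = (LINT x|lborel. potential g x * f x)"

lemma coulomb_integrable:
  assumes "bounded_potential f" "bounded_potential g"
  shows "integrable lborel (\<lambda>x. potential g x * f x)"
  using bounded_potential_times_integrable[OF assms(2), of f] assms(1)
  by (auto simp: bounded_potential_def)

lemma coulomb_add_left:
  assumes "bounded_potential f" "bounded_potential g" "bounded_potential h"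
  shows "coulomb (\<lambda>x. f x + g x) h = coulomb f h + coulomb g h"
  unfolding coulomb_def using coulomb_integrable[OF assms(1,3)] coulomb_integrable[OF assms(2,3)]
  by (simp add: distrib_left)

lemma coulomb_cmult_left: "coulomb (\<lambda>x. c * f x) h = c * coulomb f h"
  unfolding coulomb_def by (simp add: mult.left_commute)

lemma coulomb_add_right:
  assumes "bounded_potential f" "bounded_potential g" "bounded_potential h"
  shows "coulomb f (\<lambda>x. g x + h x) = coulomb f g + coulomb f h"
  unfolding coulomb_def using coulomb_integrable[OF assms(1,2)] coulomb_integrable[OF assms(1,3)]
  by (simp add: potential_add[OF assms(2,3)] distrib_right)

lemma coulomb_cmult_right: "coulomb f (\<lambda>x. c * h x) = c * coulomb f h"
  unfolding coulomb_def by (simp add: potential_cmult mult.assoc)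

text \<open>
  Fubini's theorem applies because the absolute values have a bounded potential as well.
\<close>

lemma coulomb_commute:
  assumes f: "bounded_potential f" and g: "bounded_potential g"
  shows "coulomb f g = coulomb g f"
proof -
  have [measurable]: "f \<in> borel_measurable borel" "g \<in> borel_measurable borel"
    using assms by (auto dest: bounded_potential_measurable)
  define k where "k = (\<lambda>(x, y). f x * g y / norm (x - y))"
  have km: "k \<in> borel_measurable (lborel \<Otimes>\<^sub>M lborel)" unfolding k_def by measurable
  have int_k: "integrable (lborel \<Otimes>\<^sub>M lborel) k"
  proof (rule lborel_pair.Fubini_integrable[OF km])
    have "(\<lambda>x. LINT y|lborel. norm (k (x, y))) = (\<lambda>x. potential (\<lambda>y. \<bar>g y\<bar>) x * \<bar>f x\<bar>)"
      by (simp add: k_def fun_eq_iff potential_def abs_mult mult.commute flip: times_divide_eq_right)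
    thus "integrable lborel (\<lambda>x. LINT y|lborel. norm (k (x, y)))"
      using coulomb_integrable[OF bounded_potential_abs[OF f] bounded_potential_abs[OF g]] by simp
    show "AE x in lborel. integrable lborel (\<lambda>y. k (x, y))"
      using bounded_potential_integrable[OF g] by (simp add: k_def flip: times_divide_eq_right)
  qed
  have "coulomb f g = (LINT x|lborel. LINT y|lborel. k (x, y))"
    by (simp add: coulomb_def potential_def k_def mult.commute flip: times_divide_eq_right)
  also have "\<dots> = (LINT y|lborel. LINT x|lborel. k (x, y))"
    using lborel_pair.Fubini_integral[of "\<lambda>x y. k (x, y)"] int_k by simp
  also have "\<dots> = coulomb g f"
  proof -
    have "(LINT x|lborel. k (x, y)) = potential f y * g y" for y
    proof -
      have "(LINT x|lborel. k (x, y)) = (LINT x|lborel. g y * (f x / norm (y - x)))"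
        by (simp add: k_def norm_minus_commute mult.commute)
      also have "\<dots> = g y * potential f y"
        unfolding potential_def by (rule integral_mult_right_zero)
      finally show ?thesis by simp
    qed
    thus ?thesis by (simp add: coulomb_def)
  qed
  finally show ?thesis .
qed

lemma coulomb_mono:
  assumes "bounded_potential f" "bounded_potential f'" "bounded_potential g" "bounded_potential g'"
    and "\<And>x. 0 \<le> f x" "\<And>x. f x \<le> f' x" "\<And>x. 0 \<le> g x" "\<And>x. g x \<le> g' x"
  shows "coulomb f g \<le> coulomb f' g'"
proof -
  have "0 \<le> g' x" for x by (rule order_trans[OF assms(7) assms(8)])
  thus ?thesis
    unfolding coulomb_def
    by (intro integral_mono coulomb_integrable mult_mono potential_mono potential_nonneg) (simp_all add: assms)
qed

lemma abs_coulomb_le: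
  assumes "bounded_potential f" "bounded_potential g"
  shows "\<bar>coulomb f g\<bar> \<le> coulomb (\<lambda>x. \<bar>f x\<bar>) (\<lambda>x. \<bar>g x\<bar>)"
proof -
  have "\<bar>potential g x\<bar> \<le> potential (\<lambda>x. \<bar>g x\<bar>) x" for x
    unfolding potential_def by (rule order_trans[OF integral_abs_bound]) simp
  hence "\<bar>potential g x * f x\<bar> \<le> potential (\<lambda>x. \<bar>g x\<bar>) x * \<bar>f x\<bar>" for x
    by (simp add: abs_mult mult_right_mono)
  thus ?thesis unfolding coulomb_def
    by (intro order_trans[OF integral_abs_bound] integral_mono)
       (auto intro!: coulomb_integrable bounded_potential_abs assms)
qed

lemma coulomb_nonneg: "(\<And>x. 0 \<le> f x) \<Longrightarrow> (\<And>x. 0 \<le> g x) \<Longrightarrow> 0 \<le> coulomb f g"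
  unfolding coulomb_def by (intro integral_nonneg_AE) (auto intro!: mult_nonneg_nonneg potential_nonneg)

lemma potential_dilation:
  assumes [measurable]: "f \<in> borel_measurable borel" and t: "0 < t"
  shows "potential (\<lambda>y. t ^ 3 * f (t *\<^sub>R y)) x = t * potential f (t *\<^sub>R x)"
proof -
  have "potential (\<lambda>y. t ^ 3 * f (t *\<^sub>R y)) x =
      (LINT y|lborel. (\<lambda>z. t ^ 4 * (f z / norm (t *\<^sub>R x - z))) (0 + t *\<^sub>R y))"
    unfolding potential_def
  proof (intro Bochner_Integration.integral_cong refl)
    fix y
    have "norm (t *\<^sub>R x - t *\<^sub>R y) = t * norm (x - y)"
      using t by (simp flip: scaleR_diff_right)
    thus "t ^ 3 * f (t *\<^sub>R y) / norm (x - y) =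
        (\<lambda>z. t ^ 4 * (f z / norm (t *\<^sub>R x - z))) (0 + t *\<^sub>R y)"
      using t by (simp add: eval_nat_numeral)
  qed
  also have "\<dots> = (1 / \<bar>t\<bar> ^ DIM(real^3)) *\<^sub>R (LINT z|lborel. t ^ 4 * (f z / norm (t *\<^sub>R x - z)))"
    using t by (intro integral_lborel_affine) measurable
  also have "(LINT z|lborel. t ^ 4 * (f z / norm (t *\<^sub>R x - z))) = t ^ 4 * potential f (t *\<^sub>R x)"
    unfolding potential_def by (rule integral_mult_right_zero)
  also have "(1 / \<bar>t\<bar> ^ DIM(real^3)) *\<^sub>R \<dots> = t * potential f (t *\<^sub>R x)"
    using t by (simp add: eval_nat_numeral)
  finally show ?thesis .
qed

lemma coulomb_dilation:
  assumes f: "bounded_potential f" and g: "bounded_potential g" and t: "0 < t"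
  shows "coulomb (\<lambda>x. t ^ 3 * f (t *\<^sub>R x)) (\<lambda>x. t ^ 3 * g (t *\<^sub>R x)) = t * coulomb f g"
proof -
  note [measurable] = bounded_potential_measurable[OF f] bounded_potential_measurable[OF g]
    potential_measurable[OF g]
  have "coulomb (\<lambda>x. t ^ 3 * f (t *\<^sub>R x)) (\<lambda>x. t ^ 3 * g (t *\<^sub>R x)) =
     (LINT x|lborel. (\<lambda>z. t ^ 4 * (potential g z * f z)) (0 + t *\<^sub>R x))"
    unfolding coulomb_def potential_dilation[OF \<open>g \<in> borel_measurable borel\<close> t]
    by (intro Bochner_Integration.integral_cong) (auto simp: eval_nat_numeral)
  also have "\<dots> = (1 / \<bar>t\<bar> ^ DIM(real^3)) *\<^sub>R (LINT z|lborel. t ^ 4 * (potential g z * f z))"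
    using t by (intro integral_lborel_affine) measurable
  also have "\<dots> = t * coulomb f g"
    using t by (simp add: coulomb_def eval_nat_numeral)
  finally show ?thesis .
qed

section \<open>Smooth compactly supported functions\<close>

lemma partial_deriv_eqI: "(f has_derivative f') (at x) \<Longrightarrow> partial_deriv i f x = f' (axis i 1)"
  unfolding partial_deriv_def by (simp add: frechet_derivative_at[symmetric])

lemma C_k_Suc_D: "C_k (Suc k) f \<Longrightarrow> C_k k f"
proof (induction k arbitrary: f)
  case 0
  thus ?case
    by (auto intro!: continuous_at_imp_continuous_on differentiable_imp_continuous_within)
next
  case (Suc k)
  have "(\<forall>x. f differentiable at x) \<and> (\<forall>i. C_k (Suc k) (partial_deriv i f))"
    using Suc.prems by (rule C_k.simps(2)[THEN iffD1])
  thus ?case unfolding C_k.simps(2)[of k f] using Suc.IH by blast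
qed

lemma C_k_add: "C_k k f \<Longrightarrow> C_k k g \<Longrightarrow> C_k k (\<lambda>x. f x + g x)"
proof (induction k arbitrary: f g)
  case (Suc k)
  have "partial_deriv i (\<lambda>x. f x + g x) = (\<lambda>x. partial_deriv i f x + partial_deriv i g x)" for i
  proof
    fix x
    show "partial_deriv i (\<lambda>x. f x + g x) x = partial_deriv i f x + partial_deriv i g x"
      unfolding partial_deriv_def[of i f] partial_deriv_def[of i g] using Suc.prems
      by (intro partial_deriv_eqI has_derivative_add) (auto simp flip: frechet_derivative_works)
  qed
  thus ?case using Suc by auto
qed (auto intro: continuous_on_add)

lemma partial_deriv_mult:
  assumes "f differentiable at x" "g differentiable at x"
  shows "partial_deriv i (\<lambda>x. f x * g x) x = f x * partial_deriv i g x + partial_deriv i f x * g x"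
  unfolding partial_deriv_def[of i f] partial_deriv_def[of i g]
  by (intro partial_deriv_eqI has_derivative_mult frechet_derivative_works[THEN iffD1] assms)

lemma C_k_mult: "C_k k f \<Longrightarrow> C_k k g \<Longrightarrow> C_k k (\<lambda>x. f x * g x)"
proof (induction k arbitrary: f g)
  case (Suc k)
  have "partial_deriv i (\<lambda>x. f x * g x) = (\<lambda>x. f x * partial_deriv i g x + partial_deriv i f x * g x)" for i
    using Suc.prems by (simp add: fun_eq_iff partial_deriv_mult)
  moreover have "C_k k f" "C_k k g" using Suc.prems by (auto intro: C_k_Suc_D simp del: C_k.simps)
  ultimately show ?case using Suc.prems by (auto intro!: C_k_add Suc.IH)
qed (auto intro: continuous_on_mult)

lemma partial_deriv_bounded_linear:
  assumes "bounded_linear L" "f differentiable at x"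
  shows "partial_deriv i (\<lambda>x. L (f x)) x = L (partial_deriv i f x)"
  unfolding partial_deriv_def[of i f]
  by (intro partial_deriv_eqI bounded_linear.has_derivative[OF assms(1)]
      frechet_derivative_works[THEN iffD1] assms(2))

lemma C_k_bounded_linear: "bounded_linear L \<Longrightarrow> C_k k f \<Longrightarrow> C_k k (\<lambda>x. L (f x))"
proof (induction k arbitrary: f)
  case (Suc k)
  have "partial_deriv i (\<lambda>x. L (f x)) = (\<lambda>x. L (partial_deriv i f x))" for i
    using partial_deriv_bounded_linear Suc.prems by (auto simp: fun_eq_iff)
  moreover have "(\<lambda>x. L (f x)) differentiable at x" for x
    using Suc.prems bounded_linear.has_derivative[of L f] unfolding differentiable_def C_k.simps by blast
  ultimately show ?case using Suc by auto
qed (auto intro: bounded_linear.continuous_on)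

lemma has_derivative_affine:
  assumes "f differentiable at (a + t *\<^sub>R x)"
  shows "((\<lambda>x. f (a + t *\<^sub>R x)) has_derivative
     (\<lambda>v. frechet_derivative f (at (a + t *\<^sub>R x)) (t *\<^sub>R v))) (at x)"
proof (rule has_derivative_compose[of "\<lambda>x. a + t *\<^sub>R x" "\<lambda>v. t *\<^sub>R v" x UNIV f])
  have "((\<lambda>x. a + t *\<^sub>R x) has_derivative (\<lambda>v. 0 + t *\<^sub>R v)) (at x)"
    by (intro has_derivative_add has_derivative_const has_derivative_scaleR_right has_derivative_ident)
  thus "((\<lambda>x. a + t *\<^sub>R x) has_derivative (\<lambda>v. t *\<^sub>R v)) (at x)" by simp
  show "(f has_derivative frechet_derivative f (at (a + t *\<^sub>R x))) (at (a + t *\<^sub>R x))"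
    using assms by (simp flip: frechet_derivative_works)
qed

lemma partial_deriv_affine:
  assumes "f differentiable at (a + t *\<^sub>R x)"
  shows "partial_deriv i (\<lambda>x. f (a + t *\<^sub>R x)) x = of_real t * partial_deriv i f (a + t *\<^sub>R x)"
proof -
  have "partial_deriv i (\<lambda>x. f (a + t *\<^sub>R x)) x =
      frechet_derivative f (at (a + t *\<^sub>R x)) (t *\<^sub>R axis i 1)"
    by (rule partial_deriv_eqI[OF has_derivative_affine[OF assms]])
  also have "\<dots> = t *\<^sub>R partial_deriv i f (a + t *\<^sub>R x)"
    unfolding partial_deriv_def using assms
    by (intro linear_cmul) (simp add: linear_frechet_derivative)
  finally show ?thesis by (simp add: scaleR_conv_of_real)
qed

lemma C_k_affine: "C_k k f \<Longrightarrow> C_k k (\<lambda>x. f (a + t *\<^sub>R x))"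
proof (induction k arbitrary: f)
  case 0
  thus ?case by (auto intro!: continuous_on_compose2[of UNIV f] continuous_intros)
next
  case (Suc k)
  have "partial_deriv i (\<lambda>x. f (a + t *\<^sub>R x)) = (\<lambda>x. of_real t * partial_deriv i f (a + t *\<^sub>R x))" for i
    using partial_deriv_affine Suc.prems by (auto simp: fun_eq_iff)
  moreover have "C_k k (\<lambda>x. of_real t * partial_deriv i f (a + t *\<^sub>R x))" for i
    by (rule C_k_bounded_linear[OF bounded_linear_mult_right Suc.IH]) (use Suc.prems in simp)
  moreover have "(\<lambda>x. f (a + t *\<^sub>R x)) differentiable (at x)" for x
    unfolding differentiable_def by (rule exI, rule has_derivative_affine) (use Suc.prems in simp)
  ultimately show ?case by simp
qed

lemma C_k_const: "C_k k (\<lambda>x. c)"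
proof (induction k arbitrary: c)
  case (Suc k)
  have "partial_deriv i (\<lambda>x. c) = (\<lambda>x. 0)" for i
    using partial_deriv_eqI[OF has_derivative_const] by (auto simp: fun_eq_iff)
  thus ?case using Suc by auto
qed auto

lemma C_k_prod: "finite I \<Longrightarrow> (\<And>i. i \<in> I \<Longrightarrow> C_k k (f i)) \<Longrightarrow> C_k k (\<lambda>x. \<Prod>i\<in>I. f i x)"
  by (induction I rule: finite_induct) (auto intro: C_k_const C_k_mult)

text \<open>
  The functions \<open>t\<^bsup>-j\<^esup> exp(-1/t)\<close>, extended by 0, are flat at the origin, and their span is closed
  under differentiation. This makes an induction over the order of differentiability possible.
\<close>

definition flat_exp :: "nat \<Rightarrow> real \<Rightarrow> real" where
  "flat_exp j t = (if 0 < t then (1 / t) ^ j * exp (- (1 / t)) else 0)"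

lemma flat_exp_has_derivative:
  "(flat_exp j has_real_derivative (flat_exp (j + 2) t - real j * flat_exp (j + 1) t)) (at t)"
proof (cases t "0 :: real" rule: linorder_cases)
  case greater
  \<comment> \<open>Writing the power as an exponential avoids a case distinction on \<open>j\<close> in the derivative.\<close>
  have eq: "exp (- (1 / t') - real j * ln t') = flat_exp j t'" if "0 < t'" for t'
  proof -
    have "exp (real j * ln t') = t' ^ j" using that by (simp add: exp_of_nat_mult)
    thus ?thesis using that by (simp add: flat_exp_def exp_diff power_one_over)
  qed
  have "((\<lambda>t. exp (- (1 / t) - real j * ln t)) has_real_derivative
      (exp (- (1 / t) - real j * ln t) * (1 / t\<^sup>2 - real j * (1 / t)))) (at t)"
    using greater by (auto intro!: derivative_eq_intros simp: power2_eq_square)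
  also have "exp (- (1 / t) - real j * ln t) * (1 / t\<^sup>2 - real j * (1 / t)) =
      flat_exp (j + 2) t - real j * flat_exp (j + 1) t"
    unfolding eq[OF greater] using greater
    by (simp add: flat_exp_def power_add power2_eq_square algebra_simps)
  finally have "((\<lambda>t. exp (- (1 / t) - real j * ln t)) has_real_derivative
      (flat_exp (j + 2) t - real j * flat_exp (j + 1) t)) (at t)" .
  moreover have e: "\<forall>\<^sub>F t' in nhds t. exp (- (1 / t') - real j * ln t') = flat_exp j t'"
    using eventually_nhds_in_open[of "{0<..}" t] greater by (auto simp: eq elim!: eventually_mono)
  ultimately show ?thesis using DERIV_cong_ev[OF refl e refl] by (simp only:)
next
  case less
  have "((\<lambda>t. 0) has_real_derivative (flat_exp (j + 2) t - real j * flat_exp (j + 1) t)) (at t)"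
    using less by (auto simp: flat_exp_def)
  moreover have e: "\<forall>\<^sub>F t' in nhds t. 0 = flat_exp j t'"
    using eventually_nhds_in_open[of "{..<0}" t] less
    by (auto simp: flat_exp_def elim!: eventually_mono)
  ultimately show ?thesis using DERIV_cong_ev[OF refl e refl] by (simp only:)
next
  case equal
  have "((\<lambda>h::real. (flat_exp j (0 + h) - flat_exp j 0) / h) \<longlongrightarrow> 0) (at_right 0)"
  proof (rule Lim_transform_eventually)
    show "((\<lambda>h::real. (inverse h) ^ Suc j / exp (inverse h)) \<longlongrightarrow> 0) (at_right 0)"
      by (rule filterlim_compose[OF tendsto_power_div_exp_0 filterlim_inverse_at_top_right])
    show "\<forall>\<^sub>F h in at_right 0. inverse h ^ Suc j / exp (inverse h) = (flat_exp j (0 + h) - flat_exp j 0) / h"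
      unfolding eventually_at_right_field
      by (intro exI[of _ 1]) (auto simp: flat_exp_def exp_minus field_simps)
  qed
  moreover have "((\<lambda>h::real. (flat_exp j (0 + h) - flat_exp j 0) / h) \<longlongrightarrow> 0) (at_left 0)"
    by (rule Lim_transform_eventually[OF tendsto_const])
       (auto simp: flat_exp_def eventually_at_left_field intro!: exI[of _ "-1"])
  ultimately have "((\<lambda>h::real. (flat_exp j (0 + h) - flat_exp j 0) / h) \<longlongrightarrow> 0) (at 0)"
    by (simp add: filterlim_at_split)
  thus ?thesis using equal by (simp add: DERIV_def flat_exp_def)
qed

lemma C_k_flat_exp: "C_k k (\<lambda>x. complex_of_real (flat_exp j (\<alpha> * (x $ i) + \<beta>)))"
proof (induction k arbitrary: j)
  case 0
  have "continuous_on UNIV (flat_exp j)"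
    using flat_exp_has_derivative DERIV_isCont by (blast intro: continuous_at_imp_continuous_on)
  thus ?case by (auto intro!: continuous_intros continuous_on_compose2[of UNIV "flat_exp j"])
next
  case (Suc k)
  let ?f = "\<lambda>x. complex_of_real (flat_exp j (\<alpha> * (x $ i) + \<beta>))"
  let ?d = "\<lambda>t. flat_exp (j + 2) t - real j * flat_exp (j + 1) t"
  have der: "(?f has_derivative (\<lambda>v. of_real (?d (\<alpha> * (x $ i) + \<beta>) * (\<alpha> * (v $ i))))) (at x)" for x
  proof -
    have a: "((\<lambda>x. \<alpha> * (x $ i) + \<beta>) has_derivative (\<lambda>v. \<alpha> * (v $ i))) (at x)"
      by (auto intro!: derivative_eq_intros bounded_linear.has_derivative[OF bounded_linear_vec_nth])
    show ?thesis
      by (intro bounded_linear.has_derivative[OF bounded_linear_of_real]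
          has_derivative_compose[OF a])
        (use flat_exp_has_derivative[unfolded has_field_derivative_def] in blast)
  qed
  have pd: "partial_deriv i' ?f = (\<lambda>x. of_real (\<alpha> * (axis i' 1 $ i)) * of_real (flat_exp (j + 2) (\<alpha> * (x $ i) + \<beta>))
      + of_real (- real j * \<alpha> * (axis i' 1 $ i)) * of_real (flat_exp (j + 1) (\<alpha> * (x $ i) + \<beta>)))" for i'
    using partial_deriv_eqI[OF der] by (auto simp: fun_eq_iff algebra_simps)
  show ?case
    unfolding C_k.simps pd
    by (intro conjI allI C_k_add C_k_bounded_linear[OF bounded_linear_mult_right] Suc.IH)
       (use der in \<open>auto simp: differentiable_def\<close>)
qed

lemma test_functionsI:
  assumes "\<And>k. C_k k f" "\<And>x. x \<notin> cbox a b \<Longrightarrow> f x = 0"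
  shows "f \<in> test_functions"
proof -
  have "{x. f x \<noteq> 0} \<subseteq> cbox a b" using assms(2) by auto
  hence "closure {x. f x \<noteq> 0} \<subseteq> cbox a b" by (rule closure_minimal) (rule closed_cbox)
  hence "compact (closure {x. f x \<noteq> 0})"
    by (intro compact_closure[THEN iffD2] bounded_subset[OF bounded_cbox closure_subset[THEN order_trans]])
  thus ?thesis using assms(1) by (simp add: test_functions_def)
qed

lemma test_functions_support:
  assumes "f \<in> test_functions"
  obtains a b where "\<And>x. x \<notin> cbox a b \<Longrightarrow> f x = 0"
proof -
  have "bounded {x. f x \<noteq> 0}"
    using assms compact_imp_bounded bounded_subset closure_subset
    unfolding test_functions_def by blast
  then obtain a where "{x. f x \<noteq> 0} \<subseteq> cbox (-a) a" using bounded_subset_cbox_symmetric by blast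
  thus thesis using that[of "-a" a] by blast
qed

lemma test_functions_differentiable: "f \<in> test_functions \<Longrightarrow> f differentiable at x"
  unfolding test_functions_def by (auto dest: spec[of _ "Suc 0"])

lemma test_functions_continuous: "f \<in> test_functions \<Longrightarrow> continuous_on UNIV f"
  unfolding test_functions_def by (auto dest: spec[of _ 0])

lemma test_functions_measurable: "f \<in> test_functions \<Longrightarrow> f \<in> borel_measurable borel"
  by (intro borel_measurable_continuous_onI test_functions_continuous)

lemma test_functions_partial_deriv:
  assumes f: "f \<in> test_functions" shows "partial_deriv i f \<in> test_functions"
proof -
  obtain a b where s: "\<And>x. x \<notin> cbox a b \<Longrightarrow> f x = 0" using test_functions_support[OF f] by blast
  show ?thesis
  proof (rule test_functionsI)
    show "C_k k (partial_deriv i f)" for k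
      using f unfolding test_functions_def by (auto dest: spec[of _ "Suc k"])
    fix x assume x: "x \<notin> cbox a b"
    have "(f has_derivative (\<lambda>v. 0)) (at x)"
    proof (rule has_derivative_transform_within_open)
      show "((\<lambda>_. 0) has_derivative (\<lambda>v. 0)) (at x)" by simp
      show "open (- cbox a b)" by (simp add: closed_cbox open_Compl)
    qed (use x s in auto)
    from partial_deriv_eqI[OF this] show "partial_deriv i f x = 0" .
  qed
qed

lemma test_functions_mult:
  assumes "f \<in> test_functions" "g \<in> test_functions"
  shows "(\<lambda>x. f x * g x) \<in> test_functions"
proof -
  obtain a b where s: "\<And>x. x \<notin> cbox a b \<Longrightarrow> f x = 0" using test_functions_support[OF assms(1)] by blast
  show ?thesis
    by (rule test_functionsI[of _ a b]) (use assms s in \<open>auto simp: test_functions_def intro: C_k_mult\<close>)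
qed

lemma test_functions_bounded_linear:
  assumes "f \<in> test_functions" "bounded_linear L"
  shows "(\<lambda>x. L (f x)) \<in> test_functions"
proof -
  obtain a b where s: "\<And>x. x \<notin> cbox a b \<Longrightarrow> f x = 0" using test_functions_support[OF assms(1)] by blast
  show ?thesis
    by (rule test_functionsI[of _ a b])
      (use assms s in \<open>auto simp: test_functions_def linear_simps intro: C_k_bounded_linear\<close>)
qed

lemma test_functions_affine:
  assumes f: "f \<in> test_functions" and t: "t \<noteq> 0"
  shows "(\<lambda>x. f (a + t *\<^sub>R x)) \<in> test_functions"
proof -
  have "compact (closure {x. f x \<noteq> 0})" using f by (simp add: test_functions_def)
  hence b: "bounded {x. f x \<noteq> 0}" using compact_imp_bounded bounded_subset closure_subset by blast
  have eq: "{x. f (a + t *\<^sub>R x) \<noteq> 0} \<subseteq> (\<lambda>y. (1 / t) *\<^sub>R y + (- (1 / t) *\<^sub>R a)) ` {x. f x \<noteq> 0}"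
  proof
    fix x assume "x \<in> {x. f (a + t *\<^sub>R x) \<noteq> 0}"
    thus "x \<in> (\<lambda>y. (1 / t) *\<^sub>R y + (- (1 / t) *\<^sub>R a)) ` {x. f x \<noteq> 0}"
      using t by (intro image_eqI[of _ _ "a + t *\<^sub>R x"]) (auto simp: scaleR_add_right)
  qed
  have "bounded ((\<lambda>y. (1 / t) *\<^sub>R y + (- (1 / t) *\<^sub>R a)) ` {x. f x \<noteq> 0})"
  proof -
    have "bounded ((\<lambda>y. (- (1 / t) *\<^sub>R a) + y) ` ((\<lambda>y. (1 / t) *\<^sub>R y) ` {x. f x \<noteq> 0}))"
      by (intro bounded_translation bounded_scaling b)
    thus ?thesis by (simp add: image_image add.commute)
  qed
  from bounded_subset[OF this eq]
  have "bounded {x. f (a + t *\<^sub>R x) \<noteq> 0}" .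
  then obtain c where "{x. f (a + t *\<^sub>R x) \<noteq> 0} \<subseteq> cbox (-c) c" using bounded_subset_cbox_symmetric by blast
  thus ?thesis using f
    by (intro test_functionsI[of _ "-c" c]) (auto simp: test_functions_def intro: C_k_affine)
qed

lemma test_functions_bounded:
  assumes f: "f \<in> test_functions"
  obtains M where "0 \<le> M" "\<And>x. cmod (f x) \<le> M"
proof -
  obtain a b where s: "\<And>x. x \<notin> cbox a b \<Longrightarrow> f x = 0" using test_functions_support[OF f] by blast
  have "compact (f ` cbox a b)"
    by (intro compact_continuous_image compact_cbox
        continuous_on_subset[OF test_functions_continuous[OF f] subset_UNIV])
  hence "bounded (f ` cbox a b)" by (rule compact_imp_bounded)
  then obtain M where M: "0 < M" "\<And>y. y \<in> f ` cbox a b \<Longrightarrow> cmod y \<le> M"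
    unfolding bounded_pos by auto
  have "cmod (f x) \<le> M" for x
    using M s by (cases "x \<in> cbox a b") auto
  thus thesis using that[of M] M(1) by auto
qed

definition locally_integrable :: "(real^3 \<Rightarrow> complex) \<Rightarrow> bool" where
  "locally_integrable f \<longleftrightarrow> f \<in> borel_measurable borel \<and>
     (\<forall>a b. integrable lborel (\<lambda>x. indicator (cbox a b) x *\<^sub>R f x))"

lemma integrable_indicator_cbox: "integrable lborel (indicator (cbox a b) :: 'a::euclidean_space \<Rightarrow> real)"
  using emeasure_lborel_cbox_finite[of a b] by (intro integrable_real_indicator) (auto simp: top.not_eq_extremum)

lemma integrable_times_test:
  assumes u: "locally_integrable u" and f: "f \<in> test_functions"
  shows "integrable lborel (\<lambda>x. u x * f x)"
proof -
  obtain a b where s: "\<And>x. x \<notin> cbox a b \<Longrightarrow> f x = 0" using test_functions_support[OF f] by blast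
  obtain M where M: "0 \<le> M" "\<And>x. cmod (f x) \<le> M" using test_functions_bounded[OF f] by blast
  note [measurable] = test_functions_measurable[OF f]
  have [measurable]: "u \<in> borel_measurable borel" using u by (simp add: locally_integrable_def)
  show ?thesis
  proof (rule Bochner_Integration.integrable_bound)
    show "integrable lborel (\<lambda>x. M *\<^sub>R (indicator (cbox a b) x *\<^sub>R u x))"
      by (intro integrable_scaleR_right) (use u in \<open>simp add: locally_integrable_def\<close>)
    show "AE x in lborel. norm (u x * f x) \<le> norm (M *\<^sub>R (indicator (cbox a b) x *\<^sub>R u x))"
      using M s by (auto simp: norm_mult indicator_def mult.commute[of M] intro!: mult_left_mono)
  qed auto
qed

lemma L2_measurable: "u \<in> L2 \<Longrightarrow> u \<in> borel_measurable borel"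
  by (simp add: L2_def)

lemma L2_locally_integrable:
  assumes "u \<in> L2" shows "locally_integrable u"
  unfolding locally_integrable_def
proof (intro conjI allI)
  note [measurable] = L2_measurable[OF assms]
  show "u \<in> borel_measurable borel" by measurable
  fix a b :: "real^3"
  show "integrable lborel (\<lambda>x. indicator (cbox a b) x *\<^sub>R u x)"
  proof (rule Bochner_Integration.integrable_bound)
    show "integrable lborel (\<lambda>x. indicator (cbox a b) x + (norm (u x))\<^sup>2 :: real)"
      using assms by (intro Bochner_Integration.integrable_add integrable_indicator_cbox) (simp add: L2_def)
    have "cmod z \<le> 1 + (cmod z)\<^sup>2" for z
    proof -
      have "0 \<le> (cmod z - 1)\<^sup>2" by simp
      hence "2 * cmod z \<le> 1 + (cmod z)\<^sup>2" by (simp add: power2_diff)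
      thus ?thesis using norm_ge_zero[of z] by linarith
    qed
    thus "AE x in lborel. norm (indicator (cbox a b) x *\<^sub>R u x)
        \<le> norm (indicator (cbox a b) x + (norm (u x))\<^sup>2 :: real)"
      by (auto simp: indicator_def)
  qed measurable
qed

lemma locally_integrable_one: "locally_integrable (\<lambda>x. 1)"
  by (auto simp: locally_integrable_def scaleR_conv_of_real
      intro!: integrable_of_real integrable_indicator_cbox)

lemma test_functions_L2:
  assumes f: "f \<in> test_functions" shows "f \<in> L2"
proof -
  have "(\<lambda>x. cnj (f x)) \<in> test_functions"
    by (rule test_functions_bounded_linear[OF f bounded_linear_cnj])
  from test_functions_mult[OF f this] have "(\<lambda>x. f x * cnj (f x)) \<in> test_functions" .
  from integrable_times_test[OF locally_integrable_one this]
  have "integrable lborel (\<lambda>x. 1 * (f x * cnj (f x)))" .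
  hence "integrable lborel (\<lambda>x. Re (f x * cnj (f x)))" by (intro integrable_Re) auto
  moreover have "Re (f x * cnj (f x)) = (norm (f x))\<^sup>2" for x
    by (simp add: cmod_power2 flip: power2_eq_square)
  ultimately show ?thesis using test_functions_measurable[OF f] by (simp add: L2_def)
qed

section \<open>The fundamental lemma of the calculus of variations\<close>

lemma has_vector_derivative_iff_quotient:
  "(g has_vector_derivative D) (at x) \<longleftrightarrow> ((\<lambda>h. (1 / h) *\<^sub>R (g (x + h) - g x)) \<longlongrightarrow> D) (at 0)"
proof -
  have "(g has_vector_derivative D) (at x) \<longleftrightarrow>
      ((\<lambda>h. norm (g (x + h) - g x - h *\<^sub>R D) / norm h) \<longlongrightarrow> 0) (at 0)"
    by (simp add: has_vector_derivative_def has_derivative_at bounded_linear_scaleR_left)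
  also have "\<dots> \<longleftrightarrow> ((\<lambda>h. norm ((1 / h) *\<^sub>R (g (x + h) - g x) - D)) \<longlongrightarrow> 0) (at 0)"
  proof (rule tendsto_cong)
    have "norm (g (x + h) - g x - h *\<^sub>R D) / norm h = norm ((1 / h) *\<^sub>R (g (x + h) - g x) - D)"
      if "h \<noteq> 0" for h
    proof -
      have "(1 / h) *\<^sub>R (g (x + h) - g x) - D = (1 / h) *\<^sub>R (g (x + h) - g x - h *\<^sub>R D)"
        using that by (simp add: scaleR_diff_right)
      thus ?thesis by (simp only: norm_scaleR) simp
    qed
    thus "\<forall>\<^sub>F h in at 0. norm (g (x + h) - g x - h *\<^sub>R D) / norm h
        = norm ((1 / h) *\<^sub>R (g (x + h) - g x) - D)"
      by (auto simp: eventually_at intro!: exI[of _ 1])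
  qed
  also have "\<dots> \<longleftrightarrow> ((\<lambda>h. (1 / h) *\<^sub>R (g (x + h) - g x)) \<longlongrightarrow> D) (at 0)"
    by (simp only: tendsto_norm_zero_iff LIM_zero_iff)
  finally show ?thesis .
qed

lemma test_line_derivative:
  assumes f: "f \<in> test_functions"
  shows "((\<lambda>h. f (x + h *\<^sub>R axis i 1)) has_vector_derivative partial_deriv i f (x + h *\<^sub>R axis i 1)) (at h)"
proof -
  have d: "(f has_derivative frechet_derivative f (at (x + h *\<^sub>R axis i 1))) (at (x + h *\<^sub>R axis i 1))"
    by (rule frechet_derivative_works[THEN iffD1, OF test_functions_differentiable[OF f]])
  have a: "((\<lambda>h. x + h *\<^sub>R axis i 1) has_derivative (\<lambda>k. k *\<^sub>R axis i 1)) (at h)"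
    by (auto intro!: derivative_eq_intros)
  have "((\<lambda>h. f (x + h *\<^sub>R axis i 1)) has_derivative
      (\<lambda>k. frechet_derivative f (at (x + h *\<^sub>R axis i 1)) (k *\<^sub>R axis i 1))) (at h)"
    by (rule has_derivative_compose[OF a d])
  moreover have "frechet_derivative f (at (x + h *\<^sub>R axis i 1)) (k *\<^sub>R axis i 1)
      = k *\<^sub>R partial_deriv i f (x + h *\<^sub>R axis i 1)" for k
    unfolding partial_deriv_def using d by (intro linear_cmul) (rule has_derivative_linear)
  ultimately show ?thesis by (simp add: has_vector_derivative_def)
qed

text \<open>
  Dominated convergence of difference quotients: for steps of size at most 1 they are supported in a
  fixed box, and the mean value inequality bounds them there. With \<open>u = 1\<close> the integral does not
  depend on the translation, which gives integration by parts.
\<close>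

lemma integral_translate_has_derivative:
  assumes u: "locally_integrable u" and f: "f \<in> test_functions"
  shows "((\<lambda>h. LINT x|lborel. u x * f (x + h *\<^sub>R axis i 1)) has_vector_derivative
     (LINT x|lborel. u x * partial_deriv i f x)) (at 0)"
proof -
  define e where "e = (axis i 1 :: real^3)"
  define G where "G h = (LINT x|lborel. u x * f (x + h *\<^sub>R e))" for h
  note pf = test_functions_partial_deriv[OF f]
  note [measurable] = test_functions_measurable[OF f] test_functions_measurable[OF pf]
  have [measurable]: "u \<in> borel_measurable borel" using u by (simp add: locally_integrable_def)
  obtain a b where s: "\<And>x. x \<notin> cbox a b \<Longrightarrow> f x = 0" using test_functions_support[OF f] by blast
  obtain M where M: "0 \<le> M" "\<And>x. cmod (partial_deriv i f x) \<le> M"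
    using test_functions_bounded[OF pf] by blast
  define a' b' where "a' = a - (\<chi> j. 1)" and "b' = b + (\<chi> j. 1)"
  have shift: "x \<in> cbox a' b'" if "x + h *\<^sub>R e \<in> cbox a b" "\<bar>h\<bar> \<le> 1" for x h
    unfolding mem_box_cart
  proof
    fix j
    have "\<bar>h * e $ j\<bar> \<le> 1" using that(2) by (simp add: e_def axis_def)
    moreover have "a $ j \<le> x $ j + h * e $ j" "x $ j + h * e $ j \<le> b $ j"
      using that(1) by (auto simp: mem_box_cart)
    ultimately show "a' $ j \<le> x $ j \<and> x $ j \<le> b' $ j" by (simp add: a'_def b'_def abs_le_iff)
  qed
  have lip: "cmod (f (x + h *\<^sub>R e) - f x) \<le> M * \<bar>h\<bar>" for x h
  proof -
    have "norm (f (x + h *\<^sub>R axis i 1) - f (x + 0 *\<^sub>R axis i 1)) \<le> M * norm (h - 0)"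
    proof (rule differentiable_bound[of UNIV])
      show "((\<lambda>h. f (x + h *\<^sub>R axis i 1)) has_derivative
          (\<lambda>k. k *\<^sub>R partial_deriv i f (x + h *\<^sub>R axis i 1))) (at h within UNIV)" for h
        using test_line_derivative[OF f, of x i h] by (simp add: has_vector_derivative_def)
      show "onorm (\<lambda>k. k *\<^sub>R partial_deriv i f (x + h *\<^sub>R axis i 1)) \<le> M" for h
        by (rule onorm_le) (use M in \<open>auto simp: mult.commute[of M] intro!: mult_left_mono\<close>)
    qed auto
    thus ?thesis by (simp add: e_def)
  qed
  have int: "integrable lborel (\<lambda>x. u x * f (x + h *\<^sub>R e))" for h
    using integrable_times_test[OF u test_functions_affine[OF f, of 1 "h *\<^sub>R e"]]
    by (simp add: add.commute)
  have "((\<lambda>h. (1 / h) *\<^sub>R (G h - G 0)) \<longlongrightarrow> (LINT x|lborel. u x * partial_deriv i f x))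
      (at 0 within {-1<..<1})"
    \<comment> \<open>Restricting the step to the unit interval keeps all translates in the box from \<open>a'\<close> to \<open>b'\<close>.\<close>
    unfolding tendsto_at_iff_sequentially comp_def
  proof (intro allI impI)
    fix X :: "nat \<Rightarrow> real"
    assume X: "\<forall>n. X n \<in> {-1<..<1} - {0}" "X \<longlonglongrightarrow> 0"
    have "(\<lambda>n. LINT x|lborel. (1 / X n) *\<^sub>R (u x * f (x + X n *\<^sub>R e) - u x * f (x + 0 *\<^sub>R e)))
        \<longlonglongrightarrow> (LINT x|lborel. u x * partial_deriv i f x)"
    proof (rule integral_dominated_convergence)
      show "integrable lborel (\<lambda>x. M * norm (indicator (cbox a' b') x *\<^sub>R u x))"
        using u unfolding locally_integrable_def
        by (intro integrable_mult_right integrable_norm) auto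
      show "AE x in lborel. (\<lambda>n. (1 / X n) *\<^sub>R (u x * f (x + X n *\<^sub>R e) - u x * f (x + 0 *\<^sub>R e)))
          \<longlonglongrightarrow> u x * partial_deriv i f x"
      proof (rule AE_I2)
        fix x
        have "((\<lambda>h. (1 / h) *\<^sub>R (f (x + h *\<^sub>R e) - f x)) \<longlongrightarrow> partial_deriv i f x) (at 0)"
          using test_line_derivative[OF f, of x i 0]
          unfolding e_def has_vector_derivative_iff_quotient by simp
        moreover have "filterlim X (at 0) sequentially"
          using X by (intro filterlim_atI) auto
        ultimately have "(\<lambda>n. (1 / X n) *\<^sub>R (f (x + X n *\<^sub>R e) - f x)) \<longlonglongrightarrow> partial_deriv i f x"
          by (rule filterlim_compose)
        from tendsto_mult[OF tendsto_const[of "u x"] this]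
        show "(\<lambda>n. (1 / X n) *\<^sub>R (u x * f (x + X n *\<^sub>R e) - u x * f (x + 0 *\<^sub>R e)))
          \<longlonglongrightarrow> u x * partial_deriv i f x"
          by (simp flip: right_diff_distrib)
      qed
      fix n
      show "AE x in lborel. norm ((1 / X n) *\<^sub>R (u x * f (x + X n *\<^sub>R e) - u x * f (x + 0 *\<^sub>R e)))
          \<le> M * norm (indicator (cbox a' b') x *\<^sub>R u x)"
      proof (rule AE_I2)
        fix x
        have Xn: "\<bar>X n\<bar> \<le> 1" "X n \<noteq> 0" using X by (auto dest!: spec[of _ n])
        show "norm ((1 / X n) *\<^sub>R (u x * f (x + X n *\<^sub>R e) - u x * f (x + 0 *\<^sub>R e)))
          \<le> M * norm (indicator (cbox a' b') x *\<^sub>R u x)"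
        proof (cases "x \<in> cbox a' b'")
          case True
          have "cmod (f (x + X n *\<^sub>R e) - f x) / \<bar>X n\<bar> \<le> M"
            using lip[of x "X n"] Xn by (simp add: divide_le_eq)
          hence "cmod (u x) * (cmod (f (x + X n *\<^sub>R e) - f x) / \<bar>X n\<bar>) \<le> cmod (u x) * M"
            by (intro mult_left_mono) auto
          moreover have "u x * f (x + X n *\<^sub>R e) - u x * f (x + 0 *\<^sub>R e) = u x * (f (x + X n *\<^sub>R e) - f x)"
            by (simp add: right_diff_distrib)
          ultimately show ?thesis using True by (simp only: norm_scaleR norm_mult) (simp add: mult.commute)
        next
          case False
          hence "f (x + X n *\<^sub>R e) = 0" "f (x + 0 *\<^sub>R e) = 0"
            using shift[of x "X n"] shift[of x 0] Xn s by auto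
          thus ?thesis using M(1) by simp
        qed
      qed
    qed measurable
    moreover have "(LINT x|lborel. (1 / X n) *\<^sub>R (u x * f (x + X n *\<^sub>R e) - u x * f (x + 0 *\<^sub>R e)))
        = (1 / X n) *\<^sub>R (G (X n) - G 0)" for n
      unfolding G_def using int[of "X n"] int[of 0] by simp
    ultimately show "(\<lambda>n. (1 / X n) *\<^sub>R (G (X n) - G 0)) \<longlonglongrightarrow> (LINT x|lborel. u x * partial_deriv i f x)"
      by (simp only:)
  qed
  hence "((\<lambda>h. (1 / h) *\<^sub>R (G h - G 0)) \<longlongrightarrow> (LINT x|lborel. u x * partial_deriv i f x)) (at 0)"
    by (subst (asm) at_within_open) auto
  hence "(G has_vector_derivative (LINT x|lborel. u x * partial_deriv i f x)) (at 0)"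
    by (simp add: has_vector_derivative_iff_quotient)
  thus ?thesis unfolding G_def e_def .
qed

lemma integral_partial_deriv_test:
  assumes f: "f \<in> test_functions"
  shows "(LINT x|lborel. partial_deriv i f x) = 0"
proof -
  have "(LINT x|lborel. f (x + h *\<^sub>R axis i 1)) = (LINT x|lborel. f x)" for h
    using integral_lborel_affine[OF test_functions_measurable[OF f], of 1 "h *\<^sub>R axis i 1"]
    by (simp add: add.commute)
  hence "((\<lambda>h. LINT x|lborel. 1 * f (x + h *\<^sub>R axis i 1)) has_vector_derivative 0) (at 0)"
    by simp
  from vector_derivative_unique_at[OF this integral_translate_has_derivative[OF locally_integrable_one f]]
  show ?thesis by simp
qed

lemma test_functions_integration_by_parts:
  assumes f: "f \<in> test_functions" and g: "g \<in> test_functions"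
  shows "(LINT x|lborel. f x * partial_deriv i g x) = - (LINT x|lborel. partial_deriv i f x * g x)"
proof -
  have "(LINT x|lborel. f x * partial_deriv i g x + partial_deriv i f x * g x) = 0"
    using integral_partial_deriv_test[OF test_functions_mult[OF f g], of i]
    by (simp add: partial_deriv_mult test_functions_differentiable f g)
  moreover have "integrable lborel (\<lambda>x. f x * partial_deriv i g x)"
    by (intro integrable_times_test L2_locally_integrable test_functions_L2 test_functions_partial_deriv f g)
  moreover have "integrable lborel (\<lambda>x. partial_deriv i f x * g x)"
    by (intro integrable_times_test L2_locally_integrable test_functions_L2 test_functions_partial_deriv f g)
  ultimately show ?thesis by (simp add: eq_neg_iff_add_eq_0)
qed

text \<open>
  The positive and the negative part of \<open>h\<close> are densities of two measures that agree on boxes. Boxes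
  form an intersection-stable generator of the Borel sets, so the measures agree, hence so do their
  densities.
\<close>

lemma AE_zero_if_box_integrals_zero:
  fixes h :: "real^3 \<Rightarrow> real"
  assumes [measurable]: "h \<in> borel_measurable borel"
    and int: "\<And>a b. integrable lborel (\<lambda>x. indicator (box a b) x * h x)"
    and zero: "\<And>a b. (LINT x|lborel. indicator (box a b) x * h x) = 0"
  shows "AE x in lborel. h x = 0"
proof -
  let ?P = "density lborel (\<lambda>x. ennreal (h x))" and ?N = "density lborel (\<lambda>x. ennreal (- h x))"
  have em: "emeasure (density lborel (\<lambda>x. ennreal (g x))) (box a b) =
      ennreal (LINT x|lborel. max 0 (indicator (box a b) x * g x))"
    if [measurable]: "g \<in> borel_measurable borel" and "integrable lborel (\<lambda>x. indicator (box a b) x * g x)"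
    for g :: "real^3 \<Rightarrow> real" and a b
  proof -
    have "emeasure (density lborel (\<lambda>x. ennreal (g x))) (box a b) =
        (\<integral>\<^sup>+ x. ennreal (max 0 (indicator (box a b) x * g x)) \<partial>lborel)"
      by (subst emeasure_density)
        (auto intro!: nn_integral_cong simp: indicator_def max_def ennreal_neg)
    also have "\<dots> = ennreal (LINT x|lborel. max 0 (indicator (box a b) x * g x))"
      using that by (intro nn_integral_eq_integral) auto
    finally show ?thesis .
  qed
  have int': "integrable lborel (\<lambda>x. indicator (box a b) x * - h x)" for a b
    using int[of a b] by simp
  have eq: "emeasure ?P (box a b) = emeasure ?N (box a b)" for a b
  proof -
    have "(LINT x|lborel. max 0 (indicator (box a b) x * h x)) - (LINT x|lborel. max 0 (indicator (box a b) x * - h x))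
       = (LINT x|lborel. max 0 (indicator (box a b) x * h x) - max 0 (indicator (box a b) x * - h x))"
      using int[of a b] int'[of a b] by (intro Bochner_Integration.integral_diff[symmetric] integrable_max) auto
    also have "\<dots> = (LINT x|lborel. indicator (box a b) x * h x)"
      by (intro Bochner_Integration.integral_cong) auto
    finally show ?thesis
      using int[of a b] int'[of a b] zero[of a b] by (subst (1 2) em) auto
  qed
  have "?P = ?N"
  proof (rule measure_eqI_generator_eq[where \<Omega> = UNIV and E = "range (\<lambda>(a, b). box a b)"
        and A = "\<lambda>n. box (\<chi> i. - real n) (\<chi> i. real n)"])
    show "Int_stable (range (\<lambda>(a, b). box a b :: (real^3) set))"
      unfolding Int_stable_def by (auto simp: box_Int_box)
    show "sets ?P = sigma_sets UNIV (range (\<lambda>(a, b). box a b))"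
      by (simp add: borel_eq_box)
    show "sets ?N = sigma_sets UNIV (range (\<lambda>(a, b). box a b))"
      by (simp add: borel_eq_box)
    show "(\<Union>n. box (\<chi> i. - real n) (\<chi> i. real n :: real^3)) = UNIV"
    proof (intro set_eqI iffI UNIV_I UN_iff[THEN iffD2])
      fix x :: "real^3"
      obtain n where n: "norm x < real n" using reals_Archimedean2 by blast
      have "\<bar>x $ i\<bar> < real n" for i using component_le_norm_cart[of x i] n by linarith
      hence "- real n < x $ i \<and> x $ i < real n" for i by (metis abs_less_iff minus_less_iff)
      thus "\<exists>n\<in>UNIV. x \<in> box (\<chi> i. - real n) (\<chi> i. real n)" by (auto simp: mem_box_cart)
    qed
    show "emeasure ?P X = emeasure ?N X" if "X \<in> range (\<lambda>(a, b). box a b)" for X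
      using that eq by auto
    show "emeasure ?P (box (\<chi> i. - real n) (\<chi> i. real n)) \<noteq> \<infinity>" for n
      using int by (subst em) auto
  qed auto
  hence "AE x in lborel. ennreal (h x) = ennreal (- h x)"
    by (intro sigma_finite_measure.density_unique[OF sigma_finite_lborel]) auto
  thus ?thesis
  proof eventually_elim
    case (elim x)
    thus ?case by (cases "h x" "0 :: real" rule: linorder_cases) (auto simp: ennreal_neg)
  qed
qed

text \<open>
  Since \<open>exp(-1/(n d))\<close> tends to 1 for \<open>d > 0\<close> and vanishing factors stay 0, these smooth functions
  converge pointwise to the indicator of the open box.
\<close>

definition box_bump :: "real^3 \<Rightarrow> real^3 \<Rightarrow> nat \<Rightarrow> real^3 \<Rightarrow> real" where
  "box_bump a b n x = (\<Prod>i\<in>UNIV. flat_exp 0 (real (Suc n) * (x $ i - a $ i))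
     * flat_exp 0 (real (Suc n) * (b $ i - x $ i)))"

lemma flat_exp_0_range: "0 \<le> flat_exp 0 t" "flat_exp 0 t \<le> 1"
  by (auto simp: flat_exp_def)

lemma box_bump_bounds: "0 \<le> box_bump a b n x" "box_bump a b n x \<le> indicator (box a b) x"
proof -
  show "0 \<le> box_bump a b n x"
    unfolding box_bump_def by (intro prod_nonneg mult_nonneg_nonneg flat_exp_0_range ballI)
  show "box_bump a b n x \<le> indicator (box a b) x"
  proof (cases "x \<in> box a b")
    case True
    thus ?thesis unfolding box_bump_def
      by (auto intro!: prod_le_1 mult_le_one mult_nonneg_nonneg flat_exp_0_range)
  next
    case False
    then obtain i where "x $ i \<le> a $ i \<or> b $ i \<le> x $ i" by (auto simp: mem_box_cart not_less)
    hence "flat_exp 0 (real (Suc n) * (x $ i - a $ i))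
      * flat_exp 0 (real (Suc n) * (b $ i - x $ i)) = 0"
      by (auto simp: flat_exp_def zero_less_mult_iff)
    hence "box_bump a b n x = 0" unfolding box_bump_def by (intro prod_zero) auto
    thus ?thesis by simp
  qed
qed

lemma box_bump_test: "(\<lambda>x. complex_of_real (box_bump a b n x)) \<in> test_functions"
proof (rule test_functionsI[of _ a b])
  have "(\<lambda>x. complex_of_real (box_bump a b n x)) =
    (\<lambda>x. \<Prod>i\<in>UNIV. complex_of_real (flat_exp 0 (real (Suc n) * (x $ i) + (- real (Suc n) * (a $ i))))
     * complex_of_real (flat_exp 0 (- real (Suc n) * (x $ i) + real (Suc n) * (b $ i))))"
    unfolding box_bump_def of_real_prod of_real_mult by (simp add: algebra_simps)
  thus "C_k k (\<lambda>x. complex_of_real (box_bump a b n x))" for k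
    by (simp only:) (intro C_k_prod C_k_mult C_k_flat_exp finite)
  show "complex_of_real (box_bump a b n x) = 0" if "x \<notin> cbox a b" for x
  proof -
    have "x \<notin> box a b" using that box_subset_cbox by blast
    thus ?thesis using box_bump_bounds[of a b n x] by simp
  qed
qed

lemma flat_exp_scaled_tendsto: "0 < d \<Longrightarrow> (\<lambda>n. flat_exp 0 (real (Suc n) * d)) \<longlonglongrightarrow> 1"
proof -
  assume d: "0 < d"
  have "(\<lambda>n. exp (- ((1 / d) * inverse (real (Suc n))))) \<longlonglongrightarrow> exp (- ((1 / d) * 0))"
    by (intro tendsto_intros LIMSEQ_inverse_real_of_nat)
  moreover have "flat_exp 0 (real (Suc n) * d) = exp (- ((1 / d) * inverse (real (Suc n))))" for n
  proof -
    have "0 < real (Suc n) * d" using d by simp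
    thus ?thesis by (simp add: flat_exp_def divide_inverse del: of_nat_Suc)
  qed
  ultimately show ?thesis by simp
qed

lemma box_bump_tendsto: "(\<lambda>n. box_bump a b n x) \<longlonglongrightarrow> indicator (box a b) x"
proof (cases "x \<in> box a b")
  case True
  have "(\<lambda>n. \<Prod>i\<in>(UNIV :: 3 set). flat_exp 0 (real (Suc n) * (x $ i - a $ i))
      * flat_exp 0 (real (Suc n) * (b $ i - x $ i))) \<longlonglongrightarrow> (\<Prod>i\<in>(UNIV :: 3 set). 1 * 1)"
    using True by (intro tendsto_prod tendsto_mult flat_exp_scaled_tendsto) (auto simp: mem_box_cart)
  thus ?thesis using True by (simp only: box_bump_def) simp
next
  case False
  have "box_bump a b n x = 0" for n
    using box_bump_bounds[of a b n x] False by simp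
  thus ?thesis using False by simp
qed

text \<open>
  Dominated convergence along the bumps carries the hypothesis over to indicators of boxes.
\<close>

lemma fundamental_lemma:
  assumes u: "locally_integrable u"
    and zero: "\<And>f. f \<in> test_functions \<Longrightarrow> (LINT x|lborel. u x * f x) = 0"
  shows "AE x in lborel. u x = 0"
proof -
  have [measurable]: "u \<in> borel_measurable borel" using u by (simp add: locally_integrable_def)
  have int: "integrable lborel (\<lambda>x. indicator (box a b) x *\<^sub>R u x)" for a b
  proof (rule Bochner_Integration.integrable_bound)
    show "integrable lborel (\<lambda>x. indicator (cbox a b) x *\<^sub>R u x)"
      using u by (simp add: locally_integrable_def)
    show "AE x in lborel. norm (indicator (box a b) x *\<^sub>R u x) \<le> norm (indicator (cbox a b) x *\<^sub>R u x)"
      using box_subset_cbox[of a b] by (auto simp: indicator_def)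
  qed measurable
  have boxes: "(LINT x|lborel. indicator (box a b) x *\<^sub>R u x) = 0" for a b
  proof -
    have [measurable]: "(\<lambda>x. box_bump a b n x) \<in> borel_measurable borel" for n
      using borel_measurable_complex_iff test_functions_measurable[OF box_bump_test[of a b n]]
      by (simp add: borel_measurable_complex_iff)
    have "(\<lambda>n. LINT x|lborel. box_bump a b n x *\<^sub>R u x) \<longlonglongrightarrow> (LINT x|lborel. indicator (box a b) x *\<^sub>R u x)"
    proof (rule integral_dominated_convergence)
      show "integrable lborel (\<lambda>x. norm (indicator (box a b) x *\<^sub>R u x))"
        by (intro integrable_norm int)
      show "AE x in lborel. (\<lambda>n. box_bump a b n x *\<^sub>R u x) \<longlonglongrightarrow> indicator (box a b) x *\<^sub>R u x"
        by (intro AE_I2 tendsto_scaleR box_bump_tendsto tendsto_const)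
      show "AE x in lborel. norm (box_bump a b n x *\<^sub>R u x) \<le> norm (indicator (box a b) x *\<^sub>R u x)" for n
        using box_bump_bounds[of a b n] by (intro AE_I2) (auto intro!: mult_right_mono)
    qed measurable
    moreover have "(LINT x|lborel. box_bump a b n x *\<^sub>R u x) = 0" for n
      using zero[OF box_bump_test[of a b n]] by (simp add: scaleR_conv_of_real mult.commute)
    ultimately show ?thesis by (simp add: LIMSEQ_const_iff)
  qed
  have "AE x in lborel. Re (u x) = 0"
  proof (rule AE_zero_if_box_integrals_zero)
    show "integrable lborel (\<lambda>x. indicator (box a b) x * Re (u x))" for a b
      using integrable_Re[OF int[of a b]] by simp
    show "(LINT x|lborel. indicator (box a b) x * Re (u x)) = 0" for a b
      using integral_Re[OF int[of a b]] boxes[of a b] by simp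
  qed measurable
  moreover have "AE x in lborel. Im (u x) = 0"
  proof (rule AE_zero_if_box_integrals_zero)
    show "integrable lborel (\<lambda>x. indicator (box a b) x * Im (u x))" for a b
      using integrable_Im[OF int[of a b]] by simp
    show "(LINT x|lborel. indicator (box a b) x * Im (u x)) = 0" for a b
      using integral_Im[OF int[of a b]] boxes[of a b] by simp
  qed measurable
  ultimately show ?thesis by eventually_elim (simp add: complex_eq_iff)
qed

section \<open>Weak gradients\<close>

lemma two_mult_le_weighted_squares:
  fixes a b \<eta> :: real
  assumes \<eta>: "0 < \<eta>"
  shows "2 * (a * b) \<le> \<eta> * a\<^sup>2 + (1 / \<eta>) * b\<^sup>2"
proof -
  have "2 * (\<eta> * a) * b \<le> (\<eta> * a)\<^sup>2 + b\<^sup>2" by (rule sum_squares_bound)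
  hence "\<eta> * (2 * (a * b)) \<le> \<eta> * (\<eta> * a\<^sup>2 + (1 / \<eta>) * b\<^sup>2)"
    using \<eta> by (simp add: power_mult_distrib distrib_left power2_eq_square mult_ac)
  thus ?thesis using \<eta> by (simp only: mult_le_cancel_left_pos)
qed

lemma L2_norm_times_integrable:
  fixes u :: "real^3 \<Rightarrow> 'a::euclidean_space" and v :: "real^3 \<Rightarrow> 'b::euclidean_space"
  assumes u: "u \<in> L2" and v: "v \<in> L2"
  shows "integrable lborel (\<lambda>x. norm (u x) * norm (v x))"
proof -
  have [measurable]: "u \<in> borel_measurable borel" "v \<in> borel_measurable borel"
    using u v by (auto simp: L2_def)
  show ?thesis
  proof (rule Bochner_Integration.integrable_bound)
    show "integrable lborel (\<lambda>x. (norm (u x))\<^sup>2 + (norm (v x))\<^sup>2)"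
      using u v by (auto simp: L2_def)
    have "norm a * norm b \<le> (norm a)\<^sup>2 + (norm b)\<^sup>2" for a :: 'a and b :: 'b
    proof -
      have "2 * (norm a * norm b) \<le> (norm a)\<^sup>2 + (norm b)\<^sup>2"
        using sum_squares_bound[of "norm a" "norm b"] by simp
      moreover have "0 \<le> norm a * norm b" by simp
      ultimately show ?thesis by linarith
    qed
    thus "AE x in lborel. norm (norm (u x) * norm (v x)) \<le> norm ((norm (u x))\<^sup>2 + (norm (v x))\<^sup>2)"
      by simp
  qed measurable
qed

lemma L2_times_integrable:
  fixes u v :: "real^3 \<Rightarrow> complex"
  assumes u: "u \<in> L2" and v: "v \<in> L2"
  shows "integrable lborel (\<lambda>x. u x * v x)"
  by (rule Bochner_Integration.integrable_bound[OF L2_norm_times_integrable[OF u v]])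
     (use u v in \<open>auto simp: L2_def norm_mult\<close>)

lemma L2_inner_integrable:
  fixes u v :: "real^3 \<Rightarrow> 'a::euclidean_space"
  assumes u: "u \<in> L2" and v: "v \<in> L2"
  shows "integrable lborel (\<lambda>x. u x \<bullet> v x)"
  by (rule Bochner_Integration.integrable_bound[OF L2_norm_times_integrable[OF u v]])
     (use u v in \<open>auto simp: L2_def Cauchy_Schwarz_ineq2\<close>)

lemma L2_bounded_linear:
  assumes u: "u \<in> L2" and L: "bounded_linear L"
  shows "(\<lambda>x. L (u x)) \<in> L2"
proof -
  obtain K where K: "\<And>z. norm (L z) \<le> norm z * K" using bounded_linear.bounded[OF L] by blast
  have um[measurable]: "u \<in> borel_measurable borel" using u by (auto simp: L2_def)
  have m: "(\<lambda>x. L (u x)) \<in> borel_measurable borel"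
    by (rule measurable_compose[OF um borel_measurable_continuous_onI])
       (rule linear_continuous_on[OF L])
  have "integrable lborel (\<lambda>x. (norm (L (u x)))\<^sup>2)"
  proof (rule Bochner_Integration.integrable_bound)
    show "integrable lborel (\<lambda>x. K\<^sup>2 * (norm (u x))\<^sup>2)" using u by (auto simp: L2_def)
    show "AE x in lborel. norm ((norm (L (u x)))\<^sup>2) \<le> norm (K\<^sup>2 * (norm (u x))\<^sup>2)"
    proof (rule AE_I2)
      fix x
      have "(norm (L (u x)))\<^sup>2 \<le> (norm (u x) * K)\<^sup>2" by (intro power_mono K) auto
      thus "norm ((norm (L (u x)))\<^sup>2) \<le> norm (K\<^sup>2 * (norm (u x))\<^sup>2)"
        by (simp add: power_mult_distrib mult.commute)
    qed
  qed (use m in measurable)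
  thus ?thesis using m by (simp add: L2_def)
qed

lemma L2_add:
  fixes u v :: "real^3 \<Rightarrow> 'a::euclidean_space"
  assumes u: "u \<in> L2" and v: "v \<in> L2"
  shows "(\<lambda>x. u x + v x) \<in> L2"
proof -
  have eq: "(norm (u x + v x))\<^sup>2 = (norm (u x))\<^sup>2 + 2 * (u x \<bullet> v x) + (norm (v x))\<^sup>2" for x
    by (simp add: power2_norm_eq_inner inner_add_left inner_add_right inner_commute)
  have "integrable lborel (\<lambda>x. (norm (u x + v x))\<^sup>2)"
    unfolding eq using u v L2_inner_integrable[OF u v] by (auto simp: L2_def)
  thus ?thesis using u v by (auto simp: L2_def)
qed

lemma L2_vec_nth: "g \<in> L2 \<Longrightarrow> (\<lambda>x. g x $ i) \<in> L2"
  using L2_bounded_linear[OF _ bounded_linear_vec_nth] .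

lemma L2_dilation:
  assumes u: "u \<in> L2" and t: "t \<noteq> 0"
  shows "(\<lambda>x. u (t *\<^sub>R x)) \<in> L2"
proof -
  have [measurable]: "u \<in> borel_measurable borel" using u by (auto simp: L2_def)
  have "integrable lborel (\<lambda>x. (\<lambda>y. (norm (u y))\<^sup>2) (0 + t *\<^sub>R x))"
    using u t by (subst integrable_lborel_affine_iff) (auto simp: L2_def)
  thus ?thesis by (simp add: L2_def)
qed

text \<open>
  The support of the translated test function leaves every bounded region, so the part of the mass of
  \<open>u\<close> that it meets tends to 0. The weighted inequality between \<open>2 a b\<close> and \<open>a\<^sup>2 + b\<^sup>2\<close> takes the
  place of the Cauchy-Schwarz inequality.
\<close>

lemma L2_translates_integral_tendsto_0:
  fixes u f :: "real^3 \<Rightarrow> complex"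
  assumes u: "u \<in> L2" and f: "f \<in> test_functions"
  shows "(\<lambda>n. LINT x|lborel. u x * f (x + real n *\<^sub>R axis i 1)) \<longlonglongrightarrow> 0"
proof -
  define e where "e = (axis i 1 :: real^3)"
  define G where "G n = (LINT x|lborel. u x * f (x + real n *\<^sub>R e))" for n
  obtain a b where s: "\<And>x. x \<notin> cbox a b \<Longrightarrow> f x = 0" using test_functions_support[OF f] by blast
  have [measurable]: "u \<in> borel_measurable borel" using u by (simp add: L2_def)
  define I where "I n = (LINT x|lborel. indicator (cbox a b) (x + real n *\<^sub>R e) * (cmod (u x))\<^sup>2)" for n
  define T where "T = (LINT x|lborel. (cmod (f x))\<^sup>2)"
  have T: "0 \<le> T" by (simp add: T_def)
  have indm: "(\<lambda>x. indicator (cbox a b) (x + real n *\<^sub>R e) :: real) \<in> borel_measurable borel" for n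
    by (intro borel_measurable_indicator' ) measurable
  note [measurable] = indm
  have Iint: "integrable lborel (\<lambda>x. indicator (cbox a b) (x + real n *\<^sub>R e) * (cmod (u x))\<^sup>2)" for n
    by (rule Bochner_Integration.integrable_bound[of _ "\<lambda>x. (cmod (u x))\<^sup>2"])
       (use u in \<open>auto simp: L2_def indicator_def\<close>)
  have "I \<longlonglongrightarrow> (LINT x|(lborel :: (real^3) measure). (0::real))"
    unfolding I_def
  proof (rule integral_dominated_convergence)
    show "integrable lborel (\<lambda>x. (cmod (u x))\<^sup>2)" using u by (simp add: L2_def)
    show "AE x in lborel. (\<lambda>n. indicator (cbox a b) (x + real n *\<^sub>R e) * (cmod (u x))\<^sup>2) \<longlonglongrightarrow> (0::real)"
    proof (rule AE_I2)
      fix x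
      obtain N where N: "b $ i - x $ i < real N" using reals_Archimedean2 by blast
      have "x + real n *\<^sub>R e \<notin> cbox a b" if "N \<le> n" for n
      proof -
        have "b $ i < x $ i + real n" using N that by linarith
        hence "b $ i < (x + real n *\<^sub>R e) $ i" by (simp add: e_def)
        thus ?thesis by (auto simp: mem_box_cart not_le)
      qed
      hence "\<forall>\<^sub>F n in sequentially. indicator (cbox a b) (x + real n *\<^sub>R e) * (cmod (u x))\<^sup>2 = (0::real)"
        unfolding eventually_sequentially by (intro exI[of _ N]) auto
      thus "(\<lambda>n. indicator (cbox a b) (x + real n *\<^sub>R e) * (cmod (u x))\<^sup>2) \<longlonglongrightarrow> (0::real)"
        by (rule tendsto_eventually)
    qed
    show "AE x in lborel. norm (indicator (cbox a b) (x + real n *\<^sub>R e) * (cmod (u x))\<^sup>2) \<le> (cmod (u x))\<^sup>2" for n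
      by (auto simp: indicator_def)
  qed measurable
  hence I0: "I \<longlonglongrightarrow> 0" by simp
  have GI: "cmod (G n) \<le> (1 / d) * I n + d * T" if d: "0 < d" for d n
  proof -
    let ?f = "\<lambda>x. f (real n *\<^sub>R e + 1 *\<^sub>R x)"
    have fL: "?f \<in> L2" by (intro test_functions_L2 test_functions_affine f) auto
    have pw: "cmod (u x * f (x + real n *\<^sub>R e))
        \<le> (1 / d) * (indicator (cbox a b) (x + real n *\<^sub>R e) * (cmod (u x))\<^sup>2) + d * (cmod (?f x))\<^sup>2" for x
    proof (cases "x + real n *\<^sub>R e \<in> cbox a b")
      case True
      define p q where "p = cmod (u x)" and "q = cmod (f (x + real n *\<^sub>R e))"
      have "2 * (q * p) \<le> d * q\<^sup>2 + (1 / d) * p\<^sup>2"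
        by (rule two_mult_le_weighted_squares[OF d])
      moreover have "0 \<le> q * p" by (simp add: p_def q_def)
      ultimately have "p * q \<le> (1 / d) * p\<^sup>2 + d * q\<^sup>2"
        unfolding mult.commute[of q p] by linarith
      thus ?thesis using True by (simp add: norm_mult p_def q_def add.commute)
    qed (use s d in \<open>auto simp: norm_mult\<close>)
    have "cmod (G n) \<le> (LINT x|lborel. cmod (u x * f (x + real n *\<^sub>R e)))"
      unfolding G_def by (rule integral_norm_bound)
    also have "\<dots> \<le> (LINT x|lborel. (1 / d) * (indicator (cbox a b) (x + real n *\<^sub>R e) * (cmod (u x))\<^sup>2)
        + d * (cmod (?f x))\<^sup>2)"
      using L2_times_integrable[OF u fL] Iint[of n] fL
      by (intro integral_mono pw) (auto simp: L2_def add.commute)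
    also have "\<dots> = (1 / d) * I n + d * (LINT x|lborel. (cmod (?f x))\<^sup>2)"
      using Iint[of n] fL by (simp add: I_def L2_def)
    also have "(LINT x|lborel. (cmod (?f x))\<^sup>2) = T"
      using integral_lborel_affine[of "\<lambda>y. (cmod (f y))\<^sup>2" 1 "real n *\<^sub>R e"] test_functions_measurable[OF f]
      by (simp add: T_def)
    finally show ?thesis .
  qed
  have "G \<longlonglongrightarrow> 0"
    unfolding tendsto_iff dist_norm
  proof (intro allI impI)
    fix r :: real assume r: "0 < r"
    define d where "d = r / (2 * (T + 1))"
    have d: "0 < d" using r T by (simp add: d_def)
    have dT: "d * T \<le> r / 2"
    proof -
      have "d * T \<le> d * (T + 1)" using d by simp
      also have "\<dots> = r / 2"
      proof -
        have "r / (2 * S) * S = r / 2" if "0 < S" for S using that by simp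
        from this[of "T + 1"] show ?thesis unfolding d_def using T by simp
      qed
      finally show ?thesis .
    qed
    have "(\<lambda>n. (1 / d) * I n) \<longlonglongrightarrow> (1 / d) * 0" by (intro tendsto_intros I0)
    hence "\<forall>\<^sub>F n in sequentially. (1 / d) * I n < r / 2" using r by (intro order_tendstoD(2)) auto
    thus "\<forall>\<^sub>F n in sequentially. norm (G n - 0) < r"
    proof eventually_elim
      case (elim n)
      have "cmod (G n) < r" using GI[OF d, of n] dT elim by linarith
      thus ?case by simp
    qed
  qed
  thus ?thesis by (simp add: G_def[abs_def] e_def)
qed

text \<open>
  If the weak gradient vanishes, then the pairing of \<open>u\<close> with a translate of \<open>f\<close> does not depend on
  the translation, whereas it tends to 0 when \<open>f\<close> is moved to infinity.
\<close>

lemma gradient_zero_imp_zero: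
  assumes u: "u \<in> L2" and zero: "\<And>f i. f \<in> test_functions \<Longrightarrow> (LINT x|lborel. u x * partial_deriv i f x) = 0"
  shows "AE x in lborel. u x = 0"
proof (rule fundamental_lemma[OF L2_locally_integrable[OF u]])
  fix f assume f: "f \<in> test_functions"
  define i where "i = (1 :: 3)"
  define G where "G h = (LINT x|lborel. u x * f (x + h *\<^sub>R axis i 1))" for h
  have "(G has_vector_derivative 0) (at h)" for h
  proof -
    have g: "(\<lambda>x. f (h *\<^sub>R axis i 1 + 1 *\<^sub>R x)) \<in> test_functions" by (intro test_functions_affine f) auto
    have "((\<lambda>k. LINT x|lborel. u x * f (h *\<^sub>R axis i 1 + 1 *\<^sub>R (x + k *\<^sub>R axis i 1))) has_vector_derivative 0) (at 0)"
      using integral_translate_has_derivative[OF L2_locally_integrable[OF u] g, of i] zero[OF g, of i] by simp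
    also have "(\<lambda>k. LINT x|lborel. u x * f (h *\<^sub>R axis i 1 + 1 *\<^sub>R (x + k *\<^sub>R axis i 1))) = (\<lambda>k. G (h + k))"
      unfolding G_def by (simp add: scaleR_add_left add_ac)
    finally show ?thesis by (simp add: has_vector_derivative_iff_quotient)
  qed
  hence "\<exists>c. \<forall>h\<in>UNIV. G h = c"
    by (intro has_derivative_zero_constant) (auto simp: has_vector_derivative_def)
  then obtain c where c: "\<And>h. G h = c" by auto
  have "(\<lambda>n. G (real n)) \<longlonglongrightarrow> 0" unfolding G_def by (rule L2_translates_integral_tendsto_0[OF u f])
  hence "c = 0" by (simp add: c LIMSEQ_const_iff)
  thus "(LINT x|lborel. u x * f x) = 0" using c[of 0] by (simp add: G_def)
qed

lemma has_weak_gradientD: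
  assumes "has_weak_gradient u g"
  shows "u \<in> L2" "g \<in> L2"
    "f \<in> test_functions \<Longrightarrow> (LINT x|lborel. u x * partial_deriv i f x) = - (LINT x|lborel. g x $ i * f x)"
  using assms by (auto simp: has_weak_gradient_def)

lemma weak_gradient_unique:
  assumes "has_weak_gradient u g" "has_weak_gradient u h"
  shows "AE x in lborel. g x = h x"
proof -
  have "AE x in lborel. g x $ i = h x $ i" for i
  proof -
    have gL: "(\<lambda>x. g x $ i) \<in> L2" and hL: "(\<lambda>x. h x $ i) \<in> L2"
      using assms by (auto intro: L2_vec_nth dest: has_weak_gradientD)
    have hL': "(\<lambda>x. - h x $ i) \<in> L2" using hL by (simp add: L2_def)
    have "AE x in lborel. g x $ i + - h x $ i = 0"
    proof (rule fundamental_lemma[OF L2_locally_integrable[OF L2_add[OF gL hL']]])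
      fix f assume f: "f \<in> test_functions"
      have "(LINT x|lborel. g x $ i * f x) = (LINT x|lborel. h x $ i * f x)"
        using has_weak_gradientD(3)[OF assms(1) f, of i] has_weak_gradientD(3)[OF assms(2) f, of i] by simp
      thus "(LINT x|lborel. (g x $ i + - h x $ i) * f x) = 0"
        using L2_times_integrable[OF gL test_functions_L2[OF f]] L2_times_integrable[OF hL test_functions_L2[OF f]]
        by (simp add: left_diff_distrib)
    qed
    thus ?thesis by eventually_elim simp
  qed
  hence "AE x in lborel. \<forall>i. g x $ i = h x $ i" by (simp add: AE_all_countable)
  thus ?thesis by eventually_elim (simp add: vec_eq_iff)
qed

lemma weak_gradient_works: "u \<in> H1 \<Longrightarrow> has_weak_gradient u (weak_gradient u)"
  using someI_ex[of "has_weak_gradient u"] by (simp add: H1_def weak_gradient_def)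

lemma A_fun_eq:
  assumes g: "has_weak_gradient u g"
  shows "A_fun u = (LINT x|lborel. (norm (g x))\<^sup>2)"
proof -
  have w: "has_weak_gradient u (weak_gradient u)" using g by (intro weak_gradient_works) (auto simp: H1_def)
  have "AE x in lborel. (norm (weak_gradient u x))\<^sup>2 = (norm (g x))\<^sup>2"
    using weak_gradient_unique[OF w g] by eventually_elim simp
  thus ?thesis unfolding A_fun_def
    using has_weak_gradientD(2)[OF w] has_weak_gradientD(2)[OF g]
    by (intro integral_cong_AE) (auto simp: L2_def)
qed

lemma has_weak_gradient_add:
  assumes "has_weak_gradient u g" "has_weak_gradient v h"
  shows "has_weak_gradient (\<lambda>x. u x + v x) (\<lambda>x. g x + h x)"
  unfolding has_weak_gradient_def
proof (intro conjI ballI allI)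
  note u = has_weak_gradientD[OF assms(1)] and v = has_weak_gradientD[OF assms(2)]
  show "(\<lambda>x. u x + v x) \<in> L2" "(\<lambda>x. g x + h x) \<in> L2" using u v by (auto intro: L2_add)
  fix f i assume f: "f \<in> test_functions"
  note pf = test_functions_L2[OF test_functions_partial_deriv[OF f]]
  show "(LINT x|lborel. (u x + v x) * partial_deriv i f x) = - (LINT x|lborel. (g x + h x) $ i * f x)"
    using L2_times_integrable[OF u(1) pf] L2_times_integrable[OF v(1) pf]
      L2_times_integrable[OF L2_vec_nth[OF u(2)] test_functions_L2[OF f]]
      L2_times_integrable[OF L2_vec_nth[OF v(2)] test_functions_L2[OF f]]
      u(3)[OF f, of i] v(3)[OF f, of i]
    by (simp add: distrib_right)
qed

lemma bounded_linear_vector_scalar_mult: "bounded_linear (vector_scalar_mult c :: complex^3 \<Rightarrow> complex^3)"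
  by (intro linear_conv_bounded_linear[THEN iffD1] linearI)
     (auto simp: vector_scalar_mult_def vec_eq_iff distrib_left scaleR_conv_of_real)

lemma norm_vector_scalar_mult: "norm (vector_scalar_mult c (v :: complex^3)) = cmod c * norm v"
  by (simp add: norm_vec_def vector_scalar_mult_def norm_mult L2_set_right_distrib)

lemma has_weak_gradient_cmult:
  assumes "has_weak_gradient u g"
  shows "has_weak_gradient (\<lambda>x. c * u x) (\<lambda>x. vector_scalar_mult c (g x))"
  unfolding has_weak_gradient_def
proof (intro conjI ballI allI)
  note u = has_weak_gradientD[OF assms]
  show "(\<lambda>x. c * u x) \<in> L2" by (rule L2_bounded_linear[OF u(1) bounded_linear_mult_right])
  show "(\<lambda>x. vector_scalar_mult c (g x)) \<in> L2" by (rule L2_bounded_linear[OF u(2) bounded_linear_vector_scalar_mult])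
  fix f i assume f: "f \<in> test_functions"
  show "(LINT x|lborel. (c * u x) * partial_deriv i f x) = - (LINT x|lborel. vector_scalar_mult c (g x) $ i * f x)"
    using u(3)[OF f, of i] by (simp add: vector_scalar_mult_def mult.assoc)
qed

lemma has_weak_gradient_dilation:
  assumes "has_weak_gradient u g" and t: "0 < t"
  shows "has_weak_gradient (\<lambda>x. u (t *\<^sub>R x)) (\<lambda>x. t *\<^sub>R g (t *\<^sub>R x))"
  unfolding has_weak_gradient_def
proof (intro conjI ballI allI)
  note u = has_weak_gradientD[OF assms(1)]
  have [measurable]: "u \<in> borel_measurable borel" "g \<in> borel_measurable borel"
    using u by (auto simp: L2_def)
  show "(\<lambda>x. u (t *\<^sub>R x)) \<in> L2" using u t by (intro L2_dilation) auto
  show "(\<lambda>x. t *\<^sub>R g (t *\<^sub>R x)) \<in> L2"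
    by (rule L2_bounded_linear[OF L2_dilation bounded_linear_scaleR_right]) (use u t in auto)
  fix f i assume f: "f \<in> test_functions"
  define h where "h = (\<lambda>x. f (0 + (1 / t) *\<^sub>R x))"
  have h: "h \<in> test_functions" unfolding h_def using t by (intro test_functions_affine f) auto
  have ph: "partial_deriv i f x = of_real t * partial_deriv i h (t *\<^sub>R x)" for x
    using partial_deriv_affine[OF test_functions_differentiable[OF f], where a = 0 and t = "1 / t" and x = "t *\<^sub>R x" and i = i] t
    by (simp add: h_def)
  have [measurable]: "h \<in> borel_measurable borel" "partial_deriv i h \<in> borel_measurable borel"
    by (intro test_functions_measurable h test_functions_partial_deriv)+
  have [measurable]: "(\<lambda>x. g x $ i) \<in> borel_measurable borel"
    by (rule L2_measurable[OF L2_vec_nth[OF u(2)]])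
  have "(LINT x|lborel. u (t *\<^sub>R x) * partial_deriv i f x) =
      (LINT x|lborel. (\<lambda>y. of_real t * (u y * partial_deriv i h y)) (0 + t *\<^sub>R x))"
    by (simp add: ph mult.left_commute)
  also have "\<dots> = (1 / \<bar>t\<bar> ^ DIM(real^3)) *\<^sub>R (LINT y|lborel. of_real t * (u y * partial_deriv i h y))"
    using t by (intro integral_lborel_affine) auto
  also have "(LINT y|lborel. of_real t * (u y * partial_deriv i h y)) =
      (LINT y|lborel. - (of_real t * (g y $ i * h y)))"
    using u(3)[OF h, of i] by simp
  also have "(1 / \<bar>t\<bar> ^ DIM(real^3)) *\<^sub>R \<dots> = (LINT x|lborel. (\<lambda>y. - (of_real t * (g y $ i * h y))) (0 + t *\<^sub>R x))"
    using t by (intro integral_lborel_affine[symmetric]) auto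
  also have "\<dots> = - (LINT x|lborel. (t *\<^sub>R g (t *\<^sub>R x)) $ i * f x)"
    using t by (simp add: h_def scaleR_conv_of_real[where 'a = complex] mult.assoc)
  finally show "(LINT x|lborel. u (t *\<^sub>R x) * partial_deriv i f x) = - (LINT x|lborel. (t *\<^sub>R g (t *\<^sub>R x)) $ i * f x)" .
qed

lemma has_weak_gradient_test:
  assumes f: "f \<in> test_functions"
  shows "has_weak_gradient f (\<lambda>x. \<chi> i. partial_deriv i f x)"
  unfolding has_weak_gradient_def
proof (intro conjI ballI allI)
  show "f \<in> L2" by (rule test_functions_L2[OF f])
  have pL: "partial_deriv i f \<in> L2" for i by (intro test_functions_L2 test_functions_partial_deriv f)
  have "continuous_on UNIV (\<lambda>x. \<chi> i. partial_deriv i f x)"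
    by (intro continuous_on_vec_lambda test_functions_continuous test_functions_partial_deriv f)
  hence "(\<lambda>x. \<chi> i. partial_deriv i f x) \<in> borel_measurable borel"
    by (rule borel_measurable_continuous_onI)
  moreover have "(norm (\<chi> i. partial_deriv i f x))\<^sup>2 = (\<Sum>i\<in>UNIV. (cmod (partial_deriv i f x))\<^sup>2)" for x
    by (simp add: norm_vec_def L2_set_def sum_nonneg)
  ultimately show "(\<lambda>x. \<chi> i. partial_deriv i f x) \<in> L2"
    using pL by (auto simp: L2_def)
  fix h i assume h: "h \<in> test_functions"
  show "(LINT x|lborel. f x * partial_deriv i h x) = - (LINT x|lborel. (\<chi> i. partial_deriv i f x) $ i * h x)"
    using test_functions_integration_by_parts[OF f h, of i] by simp
qed

text \<open>
  This excludes the trivial branch of the equation \<open>Q = 0\<close>.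
\<close>

lemma A_fun_zero_imp_zero:
  assumes u: "u \<in> H1" and A: "A_fun u = 0"
  shows "AE x in lborel. u x = 0"
proof -
  note g = weak_gradient_works[OF u]
  note gL = has_weak_gradientD(2)[OF g]
  have "AE x in lborel. (norm (weak_gradient u x))\<^sup>2 = 0"
    using A gL unfolding A_fun_def L2_def
    by (subst (asm) integral_nonneg_eq_0_iff_AE) auto
  hence g0: "AE x in lborel. weak_gradient u x = 0" by eventually_elim simp
  show ?thesis
  proof (rule gradient_zero_imp_zero[OF has_weak_gradientD(1)[OF g]])
    fix f i assume f: "f \<in> test_functions"
    have "(LINT x|lborel. weak_gradient u x $ i * f x) = (LINT x|(lborel :: (real^3) measure). 0)"
      using g0 gL test_functions_measurable[OF f] L2_measurable[OF L2_vec_nth[OF gL]]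
      by (intro integral_cong_AE) (auto elim!: eventually_mono)
    thus "(LINT x|lborel. u x * partial_deriv i f x) = 0"
      using has_weak_gradientD(3)[OF g f, of i] by simp
  qed
qed

section \<open>Behaviour of the functionals under dilation\<close>

definition mass :: "(real^3 \<Rightarrow> complex) \<Rightarrow> real" where
  "mass u = (LINT x|lborel. (cmod (u x))\<^sup>2)"

definition power_integral :: "real \<Rightarrow> (real^3 \<Rightarrow> complex) \<Rightarrow> real" where
  "power_integral p u = (LINT x|lborel. cmod (u x) powr p)"

definition density_of :: "(real^3 \<Rightarrow> complex) \<Rightarrow> real^3 \<Rightarrow> real" where
  "density_of u x = (cmod (u x))\<^sup>2"

text \<open>
  The competitors used below are sums of dilates of the minimizer and of test functions; this space
  contains all of them, and for \<open>p > 10/3\<close> no integral in the functionals takes its default value on it.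
\<close>

definition energy_space :: "real \<Rightarrow> (real^3 \<Rightarrow> complex) set" where
  "energy_space p = {u \<in> H1. integrable lborel (\<lambda>x. cmod (u x) powr p)}"

lemma Lnorm_2_square: "(Lnorm 2 u)\<^sup>2 = mass u"
proof -
  have "cmod z powr 2 = (cmod z)\<^sup>2" for z by (cases "z = 0") auto
  hence "Lnorm 2 u = mass u powr (1 / 2)" by (simp add: Lnorm_def mass_def)
  moreover have "0 \<le> mass u" by (simp add: mass_def)
  ultimately show ?thesis by (simp add: powr_half_sqrt)
qed

lemma Lnorm_powr: "0 < p \<Longrightarrow> Lnorm p u powr p = power_integral p u"
proof -
  assume p: "0 < p"
  have "0 \<le> power_integral p u" by (simp add: power_integral_def)
  thus ?thesis using p by (simp add: Lnorm_def power_integral_def powr_powr)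
qed

lemma energy_spaceD:
  assumes "u \<in> energy_space p"
  shows "u \<in> H1" "u \<in> L2" "integrable lborel (\<lambda>x. cmod (u x) powr p)"
    "u \<in> borel_measurable borel" "has_weak_gradient u (weak_gradient u)" "weak_gradient u \<in> L2"
proof -
  show H: "u \<in> H1" "integrable lborel (\<lambda>x. cmod (u x) powr p)"
    using assms by (auto simp: energy_space_def)
  show w: "has_weak_gradient u (weak_gradient u)" by (rule weak_gradient_works[OF H(1)])
  show "u \<in> L2" "weak_gradient u \<in> L2" using w by (auto dest: has_weak_gradientD)
  thus "u \<in> borel_measurable borel" by (simp add: L2_def)
qed

lemma powr_add_le:
  fixes a b p :: real
  assumes "0 \<le> a" "0 \<le> b" "0 \<le> p"
  shows "(a + b) powr p \<le> 2 powr p * (a powr p + b powr p)"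
proof -
  have "(a + b) powr p \<le> (2 * max a b) powr p" using assms by (intro powr_mono2) auto
  also have "\<dots> = 2 powr p * max a b powr p" using assms by (simp add: powr_mult)
  also have "max a b powr p \<le> a powr p + b powr p" by (simp add: max_def)
  finally show ?thesis by simp
qed

lemma energy_space_add:
  assumes p: "0 \<le> p" and u: "u \<in> energy_space p" and v: "v \<in> energy_space p"
  shows "(\<lambda>x. u x + v x) \<in> energy_space p"
proof -
  note [measurable] = energy_spaceD(4)[OF u] energy_spaceD(4)[OF v]
  have "(\<lambda>x. u x + v x) \<in> H1"
    using has_weak_gradient_add[OF energy_spaceD(5)[OF u] energy_spaceD(5)[OF v]] by (auto simp: H1_def)
  moreover have "integrable lborel (\<lambda>x. cmod (u x + v x) powr p)"
  proof (rule Bochner_Integration.integrable_bound)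
    show "integrable lborel (\<lambda>x. 2 powr p * (cmod (u x) powr p + cmod (v x) powr p))"
      using energy_spaceD(3)[OF u] energy_spaceD(3)[OF v] by auto
    show "AE x in lborel. norm (cmod (u x + v x) powr p) \<le> norm (2 powr p * (cmod (u x) powr p + cmod (v x) powr p))"
    proof (rule AE_I2)
      fix x
      have "cmod (u x + v x) powr p \<le> (cmod (u x) + cmod (v x)) powr p"
        using p by (intro powr_mono2 norm_triangle_ineq) auto
      also have "\<dots> \<le> 2 powr p * (cmod (u x) powr p + cmod (v x) powr p)"
        using p by (intro powr_add_le) auto
      finally show "norm (cmod (u x + v x) powr p) \<le> norm (2 powr p * (cmod (u x) powr p + cmod (v x) powr p))"
        by simp
    qed
  qed measurable
  ultimately show ?thesis by (simp add: energy_space_def)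
qed

lemma energy_space_cmult:
  assumes u: "u \<in> energy_space p"
  shows "(\<lambda>x. c * u x) \<in> energy_space p"
proof -
  have "(\<lambda>x. c * u x) \<in> H1"
    using has_weak_gradient_cmult[OF energy_spaceD(5)[OF u]] by (auto simp: H1_def)
  thus ?thesis using energy_spaceD(3)[OF u] by (simp add: energy_space_def norm_mult powr_mult)
qed

lemma A_fun_cmult:
  assumes u: "u \<in> energy_space p"
  shows "A_fun (\<lambda>x. c * u x) = (cmod c)\<^sup>2 * A_fun u"
  unfolding A_fun_eq[OF has_weak_gradient_cmult[OF energy_spaceD(5)[OF u]]]
  by (simp add: norm_vector_scalar_mult power_mult_distrib A_fun_def)

lemma power_integral_cmult: "power_integral p (\<lambda>x. c * u x) = cmod c powr p * power_integral p u"
  by (simp add: power_integral_def norm_mult powr_mult)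

lemma mass_cmult: "mass (\<lambda>x. c * u x) = (cmod c)\<^sup>2 * mass u"
  by (simp add: mass_def norm_mult power_mult_distrib)

lemma energy_space_test:
  assumes f: "f \<in> test_functions" and p: "2 < p"
  shows "f \<in> energy_space p"
proof -
  have "f \<in> H1" using has_weak_gradient_test[OF f] by (auto simp: H1_def)
  obtain M where M: "0 \<le> M" "\<And>x. cmod (f x) \<le> M" using test_functions_bounded[OF f] by blast
  note [measurable] = test_functions_measurable[OF f]
  have "integrable lborel (\<lambda>x. cmod (f x) powr p)"
  proof (rule Bochner_Integration.integrable_bound)
    show "integrable lborel (\<lambda>x. M powr (p - 2) * (cmod (f x))\<^sup>2)"
      using test_functions_L2[OF f] by (auto simp: L2_def)
    show "AE x in lborel. norm (cmod (f x) powr p) \<le> norm (M powr (p - 2) * (cmod (f x))\<^sup>2)"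
    proof (rule AE_I2)
      fix x
      have "cmod (f x) powr p = cmod (f x) powr (p - 2) * (cmod (f x))\<^sup>2"
        by (cases "f x = 0") (simp_all flip: powr_add powr_numeral)
      also have "\<dots> \<le> M powr (p - 2) * (cmod (f x))\<^sup>2"
        using M p by (intro mult_right_mono powr_mono2) auto
      finally show "norm (cmod (f x) powr p) \<le> norm (M powr (p - 2) * (cmod (f x))\<^sup>2)" by simp
    qed
  qed measurable
  with \<open>f \<in> H1\<close> show ?thesis by (simp add: energy_space_def)
qed

definition dilate :: "real \<Rightarrow> (real^3 \<Rightarrow> complex) \<Rightarrow> real^3 \<Rightarrow> complex" where
  "dilate t u x = of_real (t powr (3/2)) * u (t *\<^sub>R x)"

lemma integrable_dilation:
  fixes f :: "real^3 \<Rightarrow> real"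
  assumes "f \<in> borel_measurable borel" "0 < t" "integrable lborel f"
  shows "integrable lborel (\<lambda>x. f (t *\<^sub>R x))"
  using integrable_lborel_affine_iff[of f t 0] assms by simp

lemma integral_dilation:
  fixes f :: "real^3 \<Rightarrow> real"
  assumes "f \<in> borel_measurable borel" "0 < t"
  shows "(LINT x|lborel. f (t *\<^sub>R x)) = (LINT x|lborel. f x) / t ^ 3"
  using integral_lborel_affine[of f t 0] assms by simp

lemma dilate_weak_gradient:
  assumes "has_weak_gradient u g" "0 < t"
  shows "has_weak_gradient (dilate t u) (\<lambda>x. vector_scalar_mult (of_real (t powr (3/2))) (t *\<^sub>R g (t *\<^sub>R x)))"
  unfolding dilate_def[abs_def] by (intro has_weak_gradient_cmult has_weak_gradient_dilation assms)

lemma dilate_energy_space: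
  assumes u: "u \<in> energy_space p" and t: "0 < t"
  shows "dilate t u \<in> energy_space p"
proof -
  note [measurable] = energy_spaceD(4)[OF u]
  have "dilate t u \<in> H1"
    using dilate_weak_gradient[OF energy_spaceD(5)[OF u] t] by (auto simp: H1_def)
  moreover have "integrable lborel (\<lambda>x. cmod (u (t *\<^sub>R x)) powr p)"
    by (rule integrable_dilation[of "\<lambda>x. cmod (u x) powr p"]) (use t energy_spaceD(3)[OF u] in auto)
  ultimately show ?thesis by (simp add: energy_space_def dilate_def norm_mult powr_mult)
qed

lemma powr_three_halves_square: "0 < (t::real) \<Longrightarrow> (t powr (3/2))\<^sup>2 = t ^ 3"
  by (simp add: powr_powr flip: powr_numeral)

lemma A_fun_dilate:
  assumes u: "u \<in> energy_space p" and t: "0 < t"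
  shows "A_fun (dilate t u) = t\<^sup>2 * A_fun u"
proof -
  have [measurable]: "weak_gradient u \<in> borel_measurable borel" using energy_spaceD(6)[OF u] by (simp add: L2_def)
  have "A_fun (dilate t u) = (LINT x|lborel. t ^ 5 * (norm (weak_gradient u (t *\<^sub>R x)))\<^sup>2)"
    unfolding A_fun_eq[OF dilate_weak_gradient[OF energy_spaceD(5)[OF u] t]]
    using t by (simp add: norm_vector_scalar_mult power_mult_distrib powr_three_halves_square mult.assoc[symmetric]
        flip: power_add)
  also have "\<dots> = t ^ 5 * (A_fun u / t ^ 3)"
    using integral_dilation[of "\<lambda>x. (norm (weak_gradient u x))\<^sup>2" t] t by (simp add: A_fun_def)
  also have "\<dots> = t\<^sup>2 * A_fun u"
    using t by (simp add: eval_nat_numeral)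
  finally show ?thesis .
qed

lemma density_of_dilate: "0 < t \<Longrightarrow> density_of (dilate t u) = (\<lambda>x. t ^ 3 * density_of u (t *\<^sub>R x))"
  by (simp add: density_of_def dilate_def norm_mult power_mult_distrib powr_three_halves_square fun_eq_iff)

lemma mass_dilate:
  assumes u: "u \<in> energy_space p" and t: "0 < t"
  shows "mass (dilate t u) = mass u"
proof -
  note [measurable] = energy_spaceD(4)[OF u]
  have "mass (dilate t u) = (LINT x|lborel. t ^ 3 * (cmod (u (t *\<^sub>R x)))\<^sup>2)"
    using t by (simp add: mass_def dilate_def norm_mult power_mult_distrib powr_three_halves_square)
  also have "\<dots> = mass u"
    using integral_dilation[of "\<lambda>x. (cmod (u x))\<^sup>2" t] t by (simp add: mass_def)
  finally show ?thesis .
qed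

lemma power_integral_dilate:
  assumes u: "u \<in> energy_space p" and t: "0 < t"
  shows "power_integral p (dilate t u) = t powr (3 * (p - 2) / 2) * power_integral p u"
proof -
  note [measurable] = energy_spaceD(4)[OF u]
  have "power_integral p (dilate t u) = (LINT x|lborel. t powr (3 / 2 * p) * cmod (u (t *\<^sub>R x)) powr p)"
    using t by (simp add: power_integral_def dilate_def norm_mult powr_mult powr_powr)
  also have "\<dots> = t powr (3 / 2 * p) * (power_integral p u / t ^ 3)"
    using integral_dilation[of "\<lambda>x. cmod (u x) powr p" t] t by (simp add: power_integral_def)
  also have "\<dots> = t powr (3 / 2 * p - 3) * power_integral p u"
    using t by (simp add: powr_diff)
  also have "3 / 2 * p - 3 = 3 * (p - 2) / 2" by (simp add: field_simps)
  finally show ?thesis .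
qed

text \<open>
  The exponent \<open>10/3\<close> lies between 2 and \<open>p\<close>, so \<open>|u|\<^bsup>10/3\<^esup>\<close> is at most \<open>|u|\<^sup>2 + |u|\<^sup>p\<close>.
\<close>

lemma density_of_bounded_potential:
  assumes u: "u \<in> energy_space p" and p: "10/3 < p"
  shows "bounded_potential (density_of u)"
proof (rule bounded_potentialI)
  note [measurable] = energy_spaceD(4)[OF u]
  have [measurable]: "density_of u \<in> borel_measurable borel" unfolding density_of_def[abs_def] by measurable
  show int: "integrable lborel (density_of u)"
    using energy_spaceD(2)[OF u] by (simp add: L2_def density_of_def[abs_def])
  show "integrable lborel (\<lambda>x. \<bar>density_of u x\<bar> powr (5/3))"
  proof (rule Bochner_Integration.integrable_bound)
    show "integrable lborel (\<lambda>x. density_of u x + cmod (u x) powr p)"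
      using int energy_spaceD(3)[OF u] by auto
    show "AE x in lborel. norm (\<bar>density_of u x\<bar> powr (5/3)) \<le> norm (density_of u x + cmod (u x) powr p)"
    proof (rule AE_I2)
      fix x
      define r where "r = cmod (u x)"
      have r: "0 \<le> r" by (simp add: r_def)
      have "(r\<^sup>2) powr (5/3) = r powr (10/3)"
        using r by (cases "r = 0") (simp_all add: powr_powr flip: powr_numeral)
      also have "\<dots> \<le> r\<^sup>2 + r powr p"
      proof (cases "r \<le> 1")
        case True
        have "r powr (10/3) \<le> r powr 2" using r True by (intro powr_mono') auto
        thus ?thesis using r by (cases "r = 0") (auto simp: add_increasing2)
      next
        case False
        hence "r powr (10/3) \<le> r powr p" using p by (intro powr_mono) auto
        thus ?thesis by (simp add: add_increasing)
      qed
      finally show "norm (\<bar>density_of u x\<bar> powr (5/3)) \<le> norm (density_of u x + cmod (u x) powr p)"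
        by (simp add: density_of_def r_def)
    qed
  qed measurable
qed

lemma hartree_eq_potential: "hartree u = potential (density_of u)"
  by (simp add: fun_eq_iff hartree_def potential_def density_of_def)

lemma B_fun_eq_coulomb: "B_fun u = coulomb (density_of u) (density_of u)"
proof -
  have "(LINT y|lborel. (cmod (u x))\<^sup>2 * (cmod (u y))\<^sup>2 / norm (x - y)) = potential (density_of u) x * density_of u x" for x
  proof -
    have "(LINT y|lborel. (cmod (u x))\<^sup>2 * (cmod (u y))\<^sup>2 / norm (x - y)) =
        (LINT y|lborel. density_of u x * (density_of u y / norm (x - y)))"
      by (simp add: density_of_def)
    also have "\<dots> = density_of u x * potential (density_of u) x"
      unfolding potential_def by (rule integral_mult_right_zero)
    finally show ?thesis by simp
  qed
  thus ?thesis by (simp add: B_fun_def coulomb_def)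
qed

lemma B_fun_nonneg: "0 \<le> B_fun u"
  unfolding B_fun_eq_coulomb by (intro coulomb_nonneg) (simp_all add: density_of_def)

lemma A_fun_nonneg: "0 \<le> A_fun u" by (simp add: A_fun_def)

lemma power_integral_nonneg: "0 \<le> power_integral p u" by (simp add: power_integral_def)

lemma B_fun_dilate:
  assumes u: "u \<in> energy_space p" and p: "10/3 < p" and t: "0 < t"
  shows "B_fun (dilate t u) = t * B_fun u"
  unfolding B_fun_eq_coulomb density_of_dilate[OF t]
  by (intro coulomb_dilation density_of_bounded_potential[OF u p] t)

lemma F_fun_eq: "0 < p \<Longrightarrow> F_fun p u = 1/2 * A_fun u + 1/4 * B_fun u - 1/p * power_integral p u"
  by (simp add: F_fun_def Lnorm_powr)

lemma F_fun_dilate: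
  assumes u: "u \<in> energy_space p" and p: "10/3 < p" and t: "0 < t"
  shows "F_fun p (dilate t u) = fibre_energy p (A_fun u) (B_fun u) (power_integral p u) t"
  using p unfolding fibre_energy_def
  by (simp add: F_fun_eq A_fun_dilate[OF u t] B_fun_dilate[OF u p t] power_integral_dilate[OF u t])

lemma Q_fun_dilate:
  assumes u: "u \<in> energy_space p" and p: "10/3 < p" and t: "0 < t"
  shows "Q_fun p (dilate t u) = fibre_virial p (A_fun u) (B_fun u) (power_integral p u) t"
  using p unfolding fibre_virial_def Q_fun_def
  by (simp add: Lnorm_powr A_fun_dilate[OF u t] B_fun_dilate[OF u p t] power_integral_dilate[OF u t])

section \<open>Continuity and directional derivatives of the functionals\<close>

lemma mass_add:
  assumes u: "u \<in> L2" and v: "v \<in> L2"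
  shows "mass (\<lambda>x. u x + of_real s * v x) = mass u + 2 * s * (LINT x|lborel. u x \<bullet> v x) + s\<^sup>2 * mass v"
proof -
  have eq: "(cmod (u x + of_real s * v x))\<^sup>2 = (cmod (u x))\<^sup>2 + 2 * s * (u x \<bullet> v x) + s\<^sup>2 * (cmod (v x))\<^sup>2" for x
    unfolding scaleR_conv_of_real[symmetric]
    by (simp add: power2_norm_eq_inner inner_add_left inner_add_right inner_commute power2_eq_square[of s])
  have "integrable lborel (\<lambda>x. (cmod (u x))\<^sup>2)" "integrable lborel (\<lambda>x. (cmod (v x))\<^sup>2)"
    using u v by (auto simp: L2_def)
  thus ?thesis unfolding mass_def eq using L2_inner_integrable[OF u v] by simp
qed

definition gradient_product :: "(real^3 \<Rightarrow> complex) \<Rightarrow> (real^3 \<Rightarrow> complex) \<Rightarrow> real" where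
  "gradient_product u v = (LINT x|lborel. weak_gradient u x \<bullet> weak_gradient v x)"

lemma A_fun_add:
  assumes u: "u \<in> energy_space p" and v: "v \<in> energy_space p"
  shows "A_fun (\<lambda>x. u x + of_real s * v x) = A_fun u + 2 * s * gradient_product u v + s\<^sup>2 * A_fun v"
proof -
  let ?g = "weak_gradient u" and ?h = "weak_gradient v"
  have c: "vector_scalar_mult (of_real s) z = s *\<^sub>R z" for z :: "complex^3"
    by (simp add: vector_scalar_mult_def vec_eq_iff scaleR_conv_of_real[where 'a = complex])
  have eq: "(norm (?g x + vector_scalar_mult (of_real s) (?h x)))\<^sup>2 =
      (norm (?g x))\<^sup>2 + 2 * s * (?g x \<bullet> ?h x) + s\<^sup>2 * (norm (?h x))\<^sup>2" for x
    unfolding c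
    by (simp add: power2_norm_eq_inner inner_add_left inner_add_right inner_commute power2_eq_square[of s])
  have "integrable lborel (\<lambda>x. (norm (?g x))\<^sup>2)" "integrable lborel (\<lambda>x. (norm (?h x))\<^sup>2)"
    using energy_spaceD(6)[OF u] energy_spaceD(6)[OF v] by (auto simp: L2_def)
  thus ?thesis
    unfolding A_fun_eq[OF has_weak_gradient_add[OF energy_spaceD(5)[OF u]
        has_weak_gradient_cmult[OF energy_spaceD(5)[OF v]]]] eq
    using L2_inner_integrable[OF energy_spaceD(6)[OF u] energy_spaceD(6)[OF v]]
    by (simp add: A_fun_def gradient_product_def)
qed

text \<open>
  Half of the first order change of the density of \<open>u\<close> in direction \<open>v\<close>.
\<close>

definition cross_density :: "(real^3 \<Rightarrow> complex) \<Rightarrow> (real^3 \<Rightarrow> complex) \<Rightarrow> real^3 \<Rightarrow> real" where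
  "cross_density u v x = u x \<bullet> v x"

lemma cross_density_bounded_potential:
  assumes u: "u \<in> energy_space p" and v: "v \<in> energy_space p" and p: "10/3 < p"
  shows "bounded_potential (cross_density u v)"
proof (rule bounded_potential_dominated)
  note [measurable] = energy_spaceD(4)[OF u] energy_spaceD(4)[OF v]
  show "bounded_potential (\<lambda>x. density_of u x + density_of v x)"
    by (intro bounded_potential_add density_of_bounded_potential[OF _ p] u v)
  show "cross_density u v \<in> borel_measurable borel"
    unfolding cross_density_def[abs_def] by measurable
  show "\<bar>cross_density u v x\<bar> \<le> 1 * \<bar>density_of u x + density_of v x\<bar>" for x
  proof -
    have "\<bar>u x \<bullet> v x\<bar> \<le> cmod (u x) * cmod (v x)" by (rule Cauchy_Schwarz_ineq2)
    moreover have "2 * (cmod (u x) * cmod (v x)) \<le> (cmod (u x))\<^sup>2 + (cmod (v x))\<^sup>2"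
      using sum_squares_bound[of "cmod (u x)" "cmod (v x)"] by simp
    moreover have "0 \<le> cmod (u x) * cmod (v x)" by simp
    moreover have "1 * \<bar>density_of u x + density_of v x\<bar> = (cmod (u x))\<^sup>2 + (cmod (v x))\<^sup>2"
      by (simp add: density_of_def)
    ultimately show ?thesis unfolding cross_density_def by linarith
  qed
qed simp

lemma density_of_add:
  "density_of (\<lambda>x. u x + of_real s * v x) =
     (\<lambda>x. density_of u x + (2 * s * cross_density u v x + s\<^sup>2 * density_of v x))"
  unfolding density_of_def cross_density_def scaleR_conv_of_real[symmetric]
  by (simp add: fun_eq_iff power2_norm_eq_inner inner_add_left inner_add_right inner_commute power2_eq_square[of s])

lemma B_fun_add:
  assumes u: "u \<in> energy_space p" and v: "v \<in> energy_space p" and p: "10/3 < p"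
  shows "B_fun (\<lambda>x. u x + of_real s * v x) = B_fun u + 4 * s * coulomb (cross_density u v) (density_of u)
     + s\<^sup>2 * (4 * coulomb (cross_density u v) (cross_density u v) + 2 * coulomb (density_of u) (density_of v))
     + 4 * s ^ 3 * coulomb (cross_density u v) (density_of v) + s ^ 4 * B_fun v"
proof -
  note bu = density_of_bounded_potential[OF u p] and bv = density_of_bounded_potential[OF v p]
    and bm = cross_density_bounded_potential[OF u v p]
  note b = bu bv bm bounded_potential_add bounded_potential_cmult
  have c: "coulomb (density_of u) (cross_density u v) = coulomb (cross_density u v) (density_of u)"
    "coulomb (density_of v) (cross_density u v) = coulomb (cross_density u v) (density_of v)"
    "coulomb (density_of v) (density_of u) = coulomb (density_of u) (density_of v)"
    by (intro coulomb_commute bu bv bm)+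
  show ?thesis
    unfolding B_fun_eq_coulomb density_of_add
    by (simp add: coulomb_add_left coulomb_add_right coulomb_cmult_left coulomb_cmult_right b c
        algebra_simps eval_nat_numeral)
qed

lemma powr_diff_le:
  fixes x y p :: real
  assumes "1 \<le> p" "0 \<le> y" "y \<le> x"
  shows "x powr p - y powr p \<le> p * x powr (p - 1) * (x - y)"
proof (cases "y = 0")
  case True
  thus ?thesis using assms mult_right_mono[of 1 p "x powr p"]
    by (cases "x = 0") (auto simp: powr_diff field_simps)
next
  case False
  hence pos: "0 < y" "0 < x" using assms by auto
  have "p * (y / x - 1) \<le> (y / x) powr p - 1"
    using assms pos by (intro powr_tangent_bound) auto
  hence "x powr p * (p * (y / x - 1)) \<le> x powr p * ((y / x) powr p - 1)"
    by (intro mult_left_mono) auto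
  also have "\<dots> = y powr p - x powr p"
    using pos by (simp add: powr_divide field_simps)
  also have "x powr p * (p * (y / x - 1)) = p * x powr (p - 1) * (y - x)"
    using pos by (simp add: powr_diff field_simps)
  finally show ?thesis by (simp add: algebra_simps)
qed

lemma norm_powr_diff_le:
  fixes a b :: "'a::real_normed_vector"
  assumes p: "1 \<le> p"
  shows "\<bar>norm (a + b) powr p - norm a powr p\<bar> \<le> p * (norm a + norm b) powr (p - 1) * norm b"
proof -
  define x y where "x = max (norm (a + b)) (norm a)" and "y = min (norm (a + b)) (norm a)"
  have "\<bar>norm (a + b) powr p - norm a powr p\<bar> = x powr p - y powr p"
    using powr_mono2[of p "norm (a + b)" "norm a"] powr_mono2[of p "norm a" "norm (a + b)"] p
    by (cases "norm (a + b) \<le> norm a") (auto simp: x_def y_def)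
  also have "\<dots> \<le> p * x powr (p - 1) * (x - y)"
    using p by (intro powr_diff_le) (auto simp: x_def y_def)
  also have "\<dots> \<le> p * (norm a + norm b) powr (p - 1) * norm b"
  proof (intro mult_mono powr_mono2)
    show "x \<le> norm a + norm b" using norm_triangle_ineq[of a b] by (simp add: x_def)
    show "x - y \<le> norm b"
      using norm_triangle_ineq2[of "a + b" a] norm_triangle_ineq2[of a "a + b"]
      by (auto simp: x_def y_def max_def min_def norm_minus_commute)
  qed (use p in \<open>auto simp: x_def y_def le_max_iff_disj\<close>)
  finally show ?thesis .
qed

text \<open>
  Away from \<open>a = 0\<close> the function is a power of a positive quadratic polynomial. At \<open>a = 0\<close> the
  difference quotient is of order \<open>s n powr (p - 1)\<close>.
\<close>

lemma norm_powr_directional_derivative: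
  fixes a b :: "'a::real_inner" and s :: "nat \<Rightarrow> real"
  assumes p: "2 < p" and s: "\<And>n. 0 < s n" "s \<longlonglongrightarrow> 0"
  shows "(\<lambda>n. (norm (a + s n *\<^sub>R b) powr p - norm a powr p) / s n) \<longlonglongrightarrow> p * norm a powr (p - 2) * (a \<bullet> b)"
proof (cases "a = 0")
  case True
  have "(norm (a + s n *\<^sub>R b) powr p - norm a powr p) / s n = s n powr (p - 1) * norm b powr p" for n
    using True s(1)[of n] p by (simp add: powr_mult powr_diff)
  moreover have "(\<lambda>n. s n powr (p - 1) * norm b powr p) \<longlonglongrightarrow> 0 * norm b powr p"
    using s p by (intro tendsto_mult tendsto_const tendsto_zero_powrI[of _ _ _ "p - 1"])
      (auto intro: less_imp_le always_eventually)
  ultimately show ?thesis using True by simp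
next
  case False
  define q where "q r = a \<bullet> a + 2 * r * (a \<bullet> b) + r\<^sup>2 * (b \<bullet> b)" for r
  have nq: "norm (a + r *\<^sub>R b) powr p = q r powr (p / 2)" for r
  proof -
    have "q r = (norm (a + r *\<^sub>R b))\<^sup>2"
      by (simp add: q_def power2_norm_eq_inner inner_add_left inner_add_right inner_commute power2_eq_square[of r])
    moreover have "(z\<^sup>2) powr (p / 2) = z powr p" if "0 \<le> z" for z :: real
      using that by (cases "z = 0") (simp_all add: powr_powr flip: powr_numeral)
    ultimately show ?thesis by simp
  qed
  have q0: "0 < q 0" using False by (simp add: q_def)
  have dq: "(q has_real_derivative 2 * (a \<bullet> b)) (at 0)"
    unfolding q_def[abs_def] by (auto intro!: derivative_eq_intros)
  have "((\<lambda>r. q r powr (p / 2)) has_real_derivative (p / 2) * q 0 powr (p / 2 - 1) * (2 * (a \<bullet> b))) (at 0)"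
    using DERIV_fun_powr[OF dq q0, of "p / 2"] by simp
  moreover have "(p / 2) * q 0 powr (p / 2 - 1) * (2 * (a \<bullet> b)) = p * norm a powr (p - 2) * (a \<bullet> b)"
  proof -
    have "q 0 = norm a powr 2" using False by (simp add: q_def power2_norm_eq_inner[symmetric])
    moreover have "2 * (p / 2 - 1) = p - 2" by (simp add: algebra_simps)
    ultimately have "q 0 powr (p / 2 - 1) = norm a powr (p - 2)"
      by (simp only: powr_powr)
    thus ?thesis by simp
  qed
  ultimately have "((\<lambda>h. (q (0 + h) powr (p / 2) - q 0 powr (p / 2)) / h) \<longlongrightarrow> p * norm a powr (p - 2) * (a \<bullet> b)) (at 0)"
    by (simp only: DERIV_def)
  moreover have "filterlim s (at 0) sequentially"
    using s by (intro filterlim_atI) (auto intro!: always_eventually simp: less_imp_neq[symmetric])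
  ultimately have "(\<lambda>n. (q (0 + s n) powr (p / 2) - q 0 powr (p / 2)) / s n) \<longlonglongrightarrow> p * norm a powr (p - 2) * (a \<bullet> b)"
    by (rule filterlim_compose)
  thus ?thesis using nq[of 0] by (simp add: nq)
qed

lemma powr_le_powr_split:
  fixes x y p :: real
  assumes "1 \<le> p" "0 \<le> x" "0 \<le> y"
  shows "(x + y) powr (p - 1) * y \<le> 2 powr p * (x powr p + y powr p)"
proof -
  have "(x + y) powr (p - 1) * y \<le> (x + y) powr (p - 1) * (x + y)"
    using assms by (intro mult_left_mono) auto
  also have "\<dots> = (x + y) powr p"
    using assms by (cases "x + y = 0") (auto simp: powr_diff)
  also have "\<dots> \<le> 2 powr p * (x powr p + y powr p)"
    using assms by (intro powr_add_le) auto
  finally show ?thesis .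
qed

text \<open>
  Dominated convergence, the difference quotients being bounded by a multiple of \<open>|u|\<^sup>p + |v|\<^sup>p\<close>.
\<close>

lemma power_integral_directional_derivative:
  fixes s :: "nat \<Rightarrow> real"
  assumes u: "u \<in> energy_space p" and v: "v \<in> energy_space p" and p: "2 < p"
    and s: "\<And>n. 0 < s n" "\<And>n. s n \<le> 1" "s \<longlonglongrightarrow> 0"
  shows "(\<lambda>n. (power_integral p (\<lambda>x. u x + of_real (s n) * v x) - power_integral p u) / s n)
     \<longlonglongrightarrow> p * (LINT x|lborel. cmod (u x) powr (p - 2) * (u x \<bullet> v x))"
proof -
  note [measurable] = energy_spaceD(4)[OF u] energy_spaceD(4)[OF v]
  define q where "q n x = (cmod (u x + of_real (s n) * v x) powr p - cmod (u x) powr p) / s n" for n x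
  define w where "w x = p * 2 powr p * (cmod (u x) powr p + cmod (v x) powr p)" for x
  have "(\<lambda>n. LINT x|lborel. q n x) \<longlonglongrightarrow> (LINT x|lborel. p * (cmod (u x) powr (p - 2) * (u x \<bullet> v x)))"
  proof (rule integral_dominated_convergence)
    show "integrable lborel w"
      unfolding w_def using energy_spaceD(3)[OF u] energy_spaceD(3)[OF v] by auto
    show "AE x in lborel. (\<lambda>n. q n x) \<longlonglongrightarrow> p * (cmod (u x) powr (p - 2) * (u x \<bullet> v x))"
    proof (rule AE_I2)
      fix x
      show "(\<lambda>n. q n x) \<longlonglongrightarrow> p * (cmod (u x) powr (p - 2) * (u x \<bullet> v x))"
        using norm_powr_directional_derivative[OF p s(1) s(3), of "u x" "v x"]
        by (simp add: q_def scaleR_conv_of_real mult.assoc)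
    qed
    fix n
    show "AE x in lborel. norm (q n x) \<le> w x"
    proof (rule AE_I2)
      fix x
      have "\<bar>cmod (u x + of_real (s n) * v x) powr p - cmod (u x) powr p\<bar>
          \<le> p * (cmod (u x) + cmod (of_real (s n) * v x)) powr (p - 1) * cmod (of_real (s n) * v x)"
        using p by (intro norm_powr_diff_le) auto
      also have "\<dots> \<le> p * (cmod (u x) + cmod (v x)) powr (p - 1) * (s n * cmod (v x))"
        using p s(1,2)[of n] mult_right_mono[of "s n" 1 "cmod (v x)"]
        by (intro mult_mono powr_mono2) (auto simp: norm_mult)
      finally have "\<bar>cmod (u x + of_real (s n) * v x) powr p - cmod (u x) powr p\<bar> / s n
          \<le> p * (cmod (u x) + cmod (v x)) powr (p - 1) * (s n * cmod (v x)) / s n"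
        using s(1)[of n] by (intro divide_right_mono) auto
      also have "\<dots> = p * ((cmod (u x) + cmod (v x)) powr (p - 1) * cmod (v x))"
        using s(1)[of n] by simp
      also have "\<dots> \<le> p * (2 powr p * (cmod (u x) powr p + cmod (v x) powr p))"
        using p by (intro mult_left_mono powr_le_powr_split) auto
      finally show "norm (q n x) \<le> w x"
        using s(1)[of n] by (simp add: q_def w_def mult.assoc)
    qed
  qed (auto simp: q_def)
  moreover have "(LINT x|lborel. q n x) =
      (power_integral p (\<lambda>x. u x + of_real (s n) * v x) - power_integral p u) / s n" for n
  proof -
    have "(\<lambda>x. u x + of_real (s n) * v x) \<in> energy_space p"
      using p by (intro energy_space_add u energy_space_cmult v) auto
    from energy_spaceD(3)[OF this] show ?thesis
      using energy_spaceD(3)[OF u] by (simp add: q_def power_integral_def)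
  qed
  ultimately show ?thesis by simp
qed

text \<open>
  Each of the three functionals is continuous at \<open>w\<close> along perturbations \<open>v n\<close> with vanishing
  functionals. The cross terms are split with a weight \<open>\<eta>\<close> into a small multiple of the functional
  of \<open>w\<close> and a large multiple of that of \<open>v n\<close>; this lemma lets \<open>n\<close> tend to infinity and then \<open>\<eta>\<close>
  to 0.
\<close>

lemma tendsto_if_quasi_bound:
  fixes X Y :: "nat \<Rightarrow> real" and K :: "real \<Rightarrow> real"
  assumes bound: "\<And>n \<eta>. 0 < \<eta> \<Longrightarrow> \<eta> \<le> 1 \<Longrightarrow> \<bar>X n - x\<bar> \<le> \<eta> * C + K \<eta> * Y n"
    and C: "0 \<le> C" and Y: "Y \<longlonglongrightarrow> 0"
  shows "X \<longlonglongrightarrow> x"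
  unfolding tendsto_iff dist_real_def
proof (intro allI impI)
  fix e :: real assume e: "0 < e"
  define \<eta> where "\<eta> = min 1 (e / (2 * (C + 1)))"
  have \<eta>: "0 < \<eta>" "\<eta> \<le> 1" using e C by (auto simp: \<eta>_def)
  have "\<eta> * C \<le> e / (2 * (C + 1)) * (C + 1)"
    using e C by (intro mult_mono) (auto simp: \<eta>_def)
  also have "\<dots> = e / 2"
  proof -
    have "e / (2 * S) * S = e / 2" if "0 < S" for S using that by simp
    from this[of "C + 1"] show ?thesis using C by simp
  qed
  finally have 1: "\<eta> * C \<le> e / 2" .
  have "(\<lambda>n. K \<eta> * Y n) \<longlonglongrightarrow> K \<eta> * 0" by (intro tendsto_intros Y)
  hence "\<forall>\<^sub>F n in sequentially. K \<eta> * Y n < e / 2" using e by (intro order_tendstoD(2)) auto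
  thus "\<forall>\<^sub>F n in sequentially. \<bar>X n - x\<bar> < e"
  proof eventually_elim
    case (elim n)
    thus ?case using bound[OF \<eta>, of n] 1 by linarith
  qed
qed

lemma power_integral_tendsto:
  fixes v :: "nat \<Rightarrow> real^3 \<Rightarrow> complex"
  assumes w: "w \<in> energy_space p" and v: "\<And>n. v n \<in> energy_space p" and p: "2 < p"
    and lim: "(\<lambda>n. power_integral p (v n)) \<longlonglongrightarrow> 0"
  shows "(\<lambda>n. power_integral p (\<lambda>x. w x + v n x)) \<longlonglongrightarrow> power_integral p w"
proof (rule tendsto_if_quasi_bound[OF _ _ lim])
  show "0 \<le> p * 2 powr (p - 1) * power_integral p w"
    using p power_integral_nonneg by (auto intro!: mult_nonneg_nonneg)
  fix n and \<eta> :: real assume \<eta>: "0 < \<eta>" "\<eta> \<le> 1"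
  define K where "K = p * (1 / \<eta> + 1) powr (p - 1)"
  have pw: "\<bar>cmod (a + b) powr p - cmod a powr p\<bar> \<le> \<eta> * (p * 2 powr (p - 1) * cmod a powr p) + K * cmod b powr p" for a b
  proof -
    have "\<bar>cmod (a + b) powr p - cmod a powr p\<bar> \<le> p * (cmod a + cmod b) powr (p - 1) * cmod b"
      using p by (intro norm_powr_diff_le) auto
    also have "\<dots> \<le> \<eta> * (p * 2 powr (p - 1) * cmod a powr p) + K * cmod b powr p"
    proof (cases "cmod b \<le> \<eta> * cmod a")
      case True
      have "cmod b \<le> cmod a" using True \<eta> mult_right_mono[of \<eta> 1 "cmod a"] by simp
      hence "p * (cmod a + cmod b) powr (p - 1) * cmod b \<le> p * (2 * cmod a) powr (p - 1) * (\<eta> * cmod a)"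
        using p True by (intro mult_mono powr_mono2) auto
      also have "\<dots> = \<eta> * (p * 2 powr (p - 1) * (cmod a powr (p - 1) * cmod a))"
        by (simp add: powr_mult)
      also have "cmod a powr (p - 1) * cmod a = cmod a powr p"
        by (cases "a = 0") (auto simp: powr_diff)
      finally show ?thesis using p by (simp add: K_def add_increasing2)
    next
      case False
      hence "cmod a \<le> 1 / \<eta> * cmod b" using \<eta> by (simp add: field_simps)
      hence "cmod a + cmod b \<le> (1 / \<eta> + 1) * cmod b" by (simp add: distrib_right)
      hence "p * (cmod a + cmod b) powr (p - 1) * cmod b \<le> p * ((1 / \<eta> + 1) * cmod b) powr (p - 1) * cmod b"
        using p by (intro mult_mono powr_mono2) auto
      also have "\<dots> = K * (cmod b powr (p - 1) * cmod b)"
        using \<eta> by (simp add: K_def powr_mult)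
      also have "cmod b powr (p - 1) * cmod b = cmod b powr p"
        by (cases "b = 0") (auto simp: powr_diff)
      finally show ?thesis using p \<eta> by (simp add: add_increasing)
    qed
    finally show ?thesis .
  qed
  have wv: "(\<lambda>x. w x + v n x) \<in> energy_space p" using p by (intro energy_space_add w v) auto
  note ints = energy_spaceD(3)[OF w] energy_spaceD(3)[OF v[of n]] energy_spaceD(3)[OF wv]
  have "\<bar>power_integral p (\<lambda>x. w x + v n x) - power_integral p w\<bar> =
      \<bar>LINT x|lborel. cmod (w x + v n x) powr p - cmod (w x) powr p\<bar>"
    using ints by (simp add: power_integral_def)
  also have "\<dots> \<le> (LINT x|lborel. \<bar>cmod (w x + v n x) powr p - cmod (w x) powr p\<bar>)"
    by (rule integral_abs_bound)
  also have "\<dots> \<le> (LINT x|lborel. \<eta> * (p * 2 powr (p - 1) * cmod (w x) powr p) + K * cmod (v n x) powr p)"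
    using ints by (intro integral_mono pw) auto
  also have "\<dots> = \<eta> * (p * 2 powr (p - 1) * power_integral p w) + K * power_integral p (v n)"
    using ints by (simp add: power_integral_def)
  finally show "\<bar>power_integral p (\<lambda>x. w x + v n x) - power_integral p w\<bar>
      \<le> \<eta> * (p * 2 powr (p - 1) * power_integral p w) + p * (1 / \<eta> + 1) powr (p - 1) * power_integral p (v n)"
    by (simp only: K_def)
qed

lemma A_fun_tendsto:
  fixes v :: "nat \<Rightarrow> real^3 \<Rightarrow> complex"
  assumes w: "w \<in> energy_space p" and v: "\<And>n. v n \<in> energy_space p"
    and lim: "(\<lambda>n. A_fun (v n)) \<longlonglongrightarrow> 0"
  shows "(\<lambda>n. A_fun (\<lambda>x. w x + v n x)) \<longlonglongrightarrow> A_fun w"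
proof (rule tendsto_if_quasi_bound[OF _ _ lim])
  show "0 \<le> A_fun w" by (rule A_fun_nonneg)
  fix n and \<eta> :: real assume \<eta>: "0 < \<eta>" "\<eta> \<le> 1"
  let ?g = "weak_gradient w" and ?h = "weak_gradient (v n)"
  have gL: "?g \<in> L2" and hL: "?h \<in> L2" using energy_spaceD(6) w v by blast+
  have pw: "\<bar>2 * (?g x \<bullet> ?h x)\<bar> \<le> \<eta> * (norm (?g x))\<^sup>2 + (1 / \<eta>) * (norm (?h x))\<^sup>2" for x
  proof -
    define a b where "a = norm (?g x)" and "b = norm (?h x)"
    have "2 * (a * b) \<le> \<eta> * a\<^sup>2 + (1 / \<eta>) * b\<^sup>2"
      by (rule two_mult_le_weighted_squares[OF \<eta>(1)])
    thus ?thesis using Cauchy_Schwarz_ineq2[of "?g x" "?h x"] by (simp add: a_def b_def abs_mult)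
  qed
  have "\<bar>2 * gradient_product w (v n)\<bar> = \<bar>LINT x|lborel. 2 * (?g x \<bullet> ?h x)\<bar>"
    by (simp add: gradient_product_def)
  also have "\<dots> \<le> (LINT x|lborel. \<bar>2 * (?g x \<bullet> ?h x)\<bar>)" by (rule integral_abs_bound)
  also have "\<dots> \<le> (LINT x|lborel. \<eta> * (norm (?g x))\<^sup>2 + (1 / \<eta>) * (norm (?h x))\<^sup>2)"
    using L2_inner_integrable[OF gL hL] gL hL by (intro integral_mono pw) (auto simp: L2_def)
  also have "\<dots> = \<eta> * A_fun w + (1 / \<eta>) * A_fun (v n)"
    using gL hL by (simp add: A_fun_def L2_def)
  finally have "\<bar>2 * gradient_product w (v n)\<bar> \<le> \<eta> * A_fun w + (1 / \<eta>) * A_fun (v n)" .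
  moreover have "A_fun (\<lambda>x. w x + v n x) = A_fun w + 2 * gradient_product w (v n) + A_fun (v n)"
    using A_fun_add[OF w v[of n], of 1] by simp
  ultimately show "\<bar>A_fun (\<lambda>x. w x + v n x) - A_fun w\<bar> \<le> \<eta> * A_fun w + (1 / \<eta> + 1) * A_fun (v n)"
    using A_fun_nonneg[of "v n"] by (simp add: distrib_right)
qed

text \<open>
  The change \<open>m\<close> of the density is at most \<open>M = \<eta> f + (1 + 1/\<eta>) q\<close> in absolute value, where \<open>f\<close> and
  \<open>q\<close> are the densities of \<open>w\<close> and \<open>v n\<close>. Monotonicity of the Coulomb form for nonnegative
  densities then bounds the change of the energy.
\<close>

lemma B_fun_tendsto:
  fixes v :: "nat \<Rightarrow> real^3 \<Rightarrow> complex"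
  assumes w: "w \<in> energy_space p" and v: "\<And>n. v n \<in> energy_space p" and p: "10/3 < p"
    and lim: "(\<lambda>n. coulomb (density_of w) (density_of (v n)) + B_fun (v n)) \<longlonglongrightarrow> 0"
  shows "(\<lambda>n. B_fun (\<lambda>x. w x + v n x)) \<longlonglongrightarrow> B_fun w"
proof (rule tendsto_if_quasi_bound[OF _ _ lim])
  show "0 \<le> 3 * B_fun w" using B_fun_nonneg by simp
  fix n and \<eta> :: real assume \<eta>: "0 < \<eta>" "\<eta> \<le> 1"
  define K where "K = 1 + 1 / \<eta>"
  have K: "0 \<le> K" using \<eta> by (simp add: K_def)
  define f where "f = density_of w"
  define q where "q = density_of (v n)"
  define m where "m x = 2 * cross_density w (v n) x + q x" for x
  define M where "M x = \<eta> * f x + K * q x" for x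
  have fq: "0 \<le> f x" "0 \<le> q x" for x by (auto simp: f_def q_def density_of_def)
  have bf: "bounded_potential f" and bq: "bounded_potential q"
    unfolding f_def q_def by (intro density_of_bounded_potential[OF _ p] w v)+
  have bm: "bounded_potential m" unfolding m_def
    by (intro bounded_potential_add bounded_potential_cmult cross_density_bounded_potential[OF w v p] bq)
  have bM: "bounded_potential M" unfolding M_def
    by (intro bounded_potential_add bounded_potential_cmult bf bq)
  note bma = bounded_potential_abs[OF bm]
  have mM: "\<bar>m x\<bar> \<le> M x" for x
  proof -
    define a b where "a = cmod (w x)" and "b = cmod (v n x)"
    have 1: "2 * (a * b) \<le> \<eta> * a\<^sup>2 + (1 / \<eta>) * b\<^sup>2"
      by (rule two_mult_le_weighted_squares[OF \<eta>(1)])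
    have 2: "\<bar>cross_density w (v n) x\<bar> \<le> a * b"
      unfolding cross_density_def a_def b_def by (rule Cauchy_Schwarz_ineq2)
    have "\<bar>m x\<bar> \<le> 2 * \<bar>cross_density w (v n) x\<bar> + \<bar>q x\<bar>"
      unfolding m_def by (rule order_trans[OF abs_triangle_ineq]) simp
    also have "\<bar>q x\<bar> = b\<^sup>2" by (simp add: q_def b_def density_of_def)
    finally have "\<bar>m x\<bar> \<le> 2 * (a * b) + b\<^sup>2" using 2 by linarith
    also have "\<dots> \<le> \<eta> * a\<^sup>2 + (1 / \<eta>) * b\<^sup>2 + b\<^sup>2" using 1 by simp
    also have "\<dots> = M x" by (simp add: M_def K_def f_def q_def a_def b_def density_of_def distrib_right)
    finally show ?thesis .
  qed
  have dens: "density_of (\<lambda>x. w x + v n x) = (\<lambda>x. f x + m x)"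
    using density_of_add[of w 1 "v n"] by (simp add: f_def m_def q_def)
  have "B_fun (\<lambda>x. w x + v n x) = coulomb f f + 2 * coulomb f m + coulomb m m"
    unfolding B_fun_eq_coulomb dens
    using coulomb_commute[OF bf bm]
    by (simp add: coulomb_add_left coulomb_add_right bf bm bounded_potential_add)
  hence "\<bar>B_fun (\<lambda>x. w x + v n x) - B_fun w\<bar> \<le> 2 * \<bar>coulomb f m\<bar> + \<bar>coulomb m m\<bar>"
    unfolding B_fun_eq_coulomb[of w] f_def[symmetric] by linarith
  also have "\<bar>coulomb f m\<bar> \<le> coulomb f M"
  proof -
    have "\<bar>coulomb f m\<bar> \<le> coulomb (\<lambda>x. \<bar>f x\<bar>) (\<lambda>x. \<bar>m x\<bar>)" by (rule abs_coulomb_le[OF bf bm])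
    also have "\<dots> \<le> coulomb f M"
      by (rule coulomb_mono) (use bf bma bM fq mM bounded_potential_abs[OF bf] in auto)
    finally show ?thesis .
  qed
  also have "\<bar>coulomb m m\<bar> \<le> coulomb M M"
  proof -
    have "\<bar>coulomb m m\<bar> \<le> coulomb (\<lambda>x. \<bar>m x\<bar>) (\<lambda>x. \<bar>m x\<bar>)" by (rule abs_coulomb_le[OF bm bm])
    also have "\<dots> \<le> coulomb M M"
      by (rule coulomb_mono) (use bma bM mM in auto)
    finally show ?thesis .
  qed
  also have "2 * coulomb f M + coulomb M M =
      (2 * \<eta> + \<eta>\<^sup>2) * coulomb f f + (2 * K + 2 * \<eta> * K) * coulomb f q + K\<^sup>2 * coulomb q q"
    unfolding M_def using coulomb_commute[OF bf bq]
    by (simp add: coulomb_add_left coulomb_add_right coulomb_cmult_left coulomb_cmult_right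
        bf bq bounded_potential_add bounded_potential_cmult algebra_simps power2_eq_square)
  also have "\<dots> \<le> (\<eta> * 3) * coulomb f f + (4 * K + K\<^sup>2) * coulomb f q + (4 * K + K\<^sup>2) * coulomb q q"
  proof -
    have le: "\<eta> * \<eta> \<le> 1 * \<eta>" "\<eta> * K \<le> 1 * K" using \<eta> K by (intro mult_right_mono; simp)+
    have "2 * \<eta> + \<eta>\<^sup>2 \<le> \<eta> * 3" using le by (simp add: power2_eq_square)
    moreover have "2 * K + 2 * \<eta> * K \<le> 4 * K + K\<^sup>2"
      using le mult.assoc[of 2 \<eta> K] zero_le_power2[of K] by linarith
    moreover have "K\<^sup>2 \<le> 4 * K + K\<^sup>2" using K by simp
    moreover have "0 \<le> coulomb f f" "0 \<le> coulomb f q" "0 \<le> coulomb q q"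
      by (intro coulomb_nonneg fq)+
    ultimately show ?thesis by (meson add_mono mult_right_mono)
  qed
  finally show "\<bar>B_fun (\<lambda>x. w x + v n x) - B_fun w\<bar> \<le> \<eta> * (3 * B_fun w) +
     (4 * (1 + 1 / \<eta>) + (1 + 1 / \<eta>)\<^sup>2) * (coulomb (density_of w) (density_of (v n)) + B_fun (v n))"
    unfolding K_def f_def q_def B_fun_eq_coulomb[symmetric] by (simp add: distrib_left mult.assoc)
qed

section \<open>Comparison with the minimizer\<close>

text \<open>
  Eliminating the power term from \<open>F\<close> by means of \<open>Q = 0\<close> leaves nonnegative multiples of \<open>A\<close> and
  \<open>B\<close>.
\<close>

lemma F_fun_nonneg_on_V_set:
  assumes p: "10/3 < p" and v: "v \<in> V_set p c"
  shows "0 \<le> F_fun p v"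
proof -
  define L where "L = Lnorm p v powr p"
  have "Q_fun p v = 0" using v by (simp add: V_set_def)
  hence "3 * (p - 2) / (2 * p) * L = A_fun v + 1/4 * B_fun v" by (simp add: Q_fun_def L_def)
  hence "1 / p * L = 2 / (3 * (p - 2)) * (A_fun v + 1/4 * B_fun v)"
    using p by (simp add: field_simps)
  also have "\<dots> \<le> 1 / 2 * (A_fun v + 1/4 * B_fun v)"
    using p A_fun_nonneg[of v] B_fun_nonneg[of v]
    by (intro mult_right_mono) (auto simp: field_simps)
  finally show ?thesis
    unfolding F_fun_def L_def[symmetric] using B_fun_nonneg[of v] by simp
qed

lemma minimizer_le:
  assumes p: "10/3 < p" and u: "u \<in> M_set p c" and v: "v \<in> V_set p c"
  shows "F_fun p u \<le> F_fun p v"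
proof -
  have "bdd_below (F_fun p ` V_set p c)"
    using F_fun_nonneg_on_V_set[OF p] by (intro bdd_belowI[of _ 0]) auto
  hence "(INF v\<in>V_set p c. F_fun p v) \<le> F_fun p v" using v by (intro cINF_lower)
  thus ?thesis using u by (simp add: M_set_def)
qed

text \<open>
  If \<open>|u|\<^sup>p\<close> were not integrable, its integral would take the default value 0. But a vanishing power
  term turns \<open>Q = 0\<close> into \<open>A + B/4 = 0\<close>, which contradicts the positive mass.
\<close>

lemma V_set_energy_space:
  assumes p: "10/3 < p" and c: "0 < c" and u: "u \<in> V_set p c"
  shows "u \<in> energy_space p" "mass u = c" "0 < A_fun u" "0 < power_integral p u"
    "fibre_virial p (A_fun u) (B_fun u) (power_integral p u) 1 = 0"
proof -
  have H: "u \<in> H1" using u by (simp add: V_set_def S_set_def)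
  show m: "mass u = c" using u by (simp add: V_set_def S_set_def Lnorm_2_square)
  have "A_fun u \<noteq> 0"
  proof
    assume "A_fun u = 0"
    hence "AE x in lborel. u x = 0" by (rule A_fun_zero_imp_zero[OF H])
    hence "AE x in lborel. (cmod (u x))\<^sup>2 = 0" by eventually_elim simp
    hence "mass u = 0" unfolding mass_def by (rule integral_eq_zero_AE)
    thus False using m c by simp
  qed
  thus A: "0 < A_fun u" using A_fun_nonneg[of u] by simp
  show virial: "fibre_virial p (A_fun u) (B_fun u) (power_integral p u) 1 = 0"
    using u p by (simp add: V_set_def Q_fun_def fibre_virial_def Lnorm_powr)
  have "power_integral p u \<noteq> 0"
    using virial A B_fun_nonneg[of u] by (auto simp: fibre_virial_def)
  thus "0 < power_integral p u" using power_integral_nonneg[of p u] by simp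
  have "integrable lborel (\<lambda>x. cmod (u x) powr p)"
    using \<open>power_integral p u \<noteq> 0\<close> not_integrable_integral_eq unfolding power_integral_def by blast
  thus "u \<in> energy_space p" using H by (simp add: energy_space_def)
qed

lemma above_level_same_mass:
  assumes p: "10/3 < p" and u: "u \<in> M_set p c" and w: "w \<in> energy_space p" and m: "mass w = c"
  shows "above_level p (F_fun p u) (A_fun w) (B_fun w) (power_integral p w)"
  unfolding above_level_def
proof (intro allI impI)
  fix t :: real assume t: "0 < t" "fibre_virial p (A_fun w) (B_fun w) (power_integral p w) t = 0"
  have "dilate t w \<in> H1" using energy_spaceD(1)[OF dilate_energy_space[OF w t(1)]] .
  hence "dilate t w \<in> V_set p c"
    using t m by (simp add: V_set_def S_set_def Lnorm_2_square mass_dilate[OF w] Q_fun_dilate[OF w p])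
  from minimizer_le[OF p u this]
  show "F_fun p u \<le> fibre_energy p (A_fun w) (B_fun w) (power_integral p w) t"
    by (simp add: F_fun_dilate[OF w p t(1)])
qed

lemma inner_complex_eq: "a \<bullet> b = Re (a * cnj b)" for a b :: complex
  by (simp add: inner_complex_def)

lemma unimodular_orthogonal:
  fixes z :: complex
  obtains \<theta> where "cmod \<theta> = 1" "Re (cnj \<theta> * z) = 0"
proof (cases "z = 0")
  case True
  thus ?thesis using that[of 1] by simp
next
  case False
  show ?thesis
  proof (rule that[of "\<i> * sgn z"])
    show "cmod (\<i> * sgn z) = 1" using False by (simp add: norm_mult norm_sgn)
    have "cnj (sgn z) * z = of_real (cmod z)"
      using False by (simp add: sgn_eq complex_cnj_divide mult.commute complex_norm_square[symmetric] power2_eq_square)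
    hence "cnj (\<i> * sgn z) * z = - \<i> * of_real (cmod z)" by (simp add: mult.assoc)
    thus "Re (cnj (\<i> * sgn z) * z) = 0" by simp
  qed
qed

text \<open>
  A rotation of the phase makes \<open>v\<close> orthogonal to \<open>w\<close> for the real inner product, so that masses add
  up exactly. Neither the mass nor any of the functionals sees the phase.
\<close>

lemma spread_rotation:
  assumes w: "w \<in> L2" and v: "v \<in> L2"
  obtains \<theta> where "cmod \<theta> = 1" "(LINT x|lborel. w x \<bullet> (\<theta> * v x)) = 0"
proof -
  have cv: "(\<lambda>x. cnj (v x)) \<in> L2" by (rule L2_bounded_linear[OF v bounded_linear_cnj])
  obtain \<theta> where \<theta>: "cmod \<theta> = 1" "Re (cnj \<theta> * (LINT x|lborel. w x * cnj (v x))) = 0"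
    by (rule unimodular_orthogonal)
  have "(LINT x|lborel. w x \<bullet> (\<theta> * v x)) = (LINT x|lborel. Re (cnj \<theta> * (w x * cnj (v x))))"
    by (simp add: inner_complex_eq mult.left_commute)
  also have "\<dots> = Re (LINT x|lborel. cnj \<theta> * (w x * cnj (v x)))"
    by (intro integral_Re integrable_mult_right L2_times_integrable[OF w cv])
  also have "\<dots> = 0" using \<theta>(2) by simp
  finally show thesis using that \<theta>(1) by blast
qed

text \<open>
  The missing mass \<open>c - mass w\<close> is supplied by \<open>\<kappa> \<theta>\<close> times the dilate of \<open>u\<close> by \<open>t n\<close>, with \<open>t n\<close>
  tending to 0. Its functionals carry the factors \<open>t\<^sup>2\<close>, \<open>t\<close> and a positive power of \<open>t\<close>, and its
  potential is \<open>t\<close> times a rescaled bounded function, so the interaction with \<open>w\<close> vanishes too.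
\<close>

lemma above_level_smaller_mass:
  assumes p: "10/3 < p" and c: "0 < c" and u: "u \<in> M_set p c"
    and w: "w \<in> energy_space p" and m: "mass w \<le> c" and pos: "0 < A_fun w" "0 < power_integral p w"
  shows "above_level p (F_fun p u) (A_fun w) (B_fun w) (power_integral p w)"
proof -
  have uV: "u \<in> V_set p c" using u by (simp add: M_set_def)
  note U = V_set_energy_space[OF p c uV]
  define \<kappa> where "\<kappa> = sqrt ((c - mass w) / c)"
  have \<kappa>: "0 \<le> \<kappa>" "\<kappa>\<^sup>2 * c = c - mass w" using m c by (auto simp: \<kappa>_def)
  define t where "t n = inverse (real (Suc n))" for n
  have t: "0 < t n" for n by (simp add: t_def)
  have t0: "t \<longlonglongrightarrow> 0" unfolding t_def[abs_def] by (rule LIMSEQ_inverse_real_of_nat)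
  note D = dilate_energy_space[OF U(1) t]
  have "\<forall>n. \<exists>\<theta>. cmod \<theta> = 1 \<and> (LINT x|lborel. w x \<bullet> (\<theta> * dilate (t n) u x)) = 0"
  proof
    fix n show "\<exists>\<theta>. cmod \<theta> = 1 \<and> (LINT x|lborel. w x \<bullet> (\<theta> * dilate (t n) u x)) = 0"
      by (rule spread_rotation[OF energy_spaceD(2)[OF w] energy_spaceD(2)[OF D[of n]]]) blast
  qed
  then obtain \<theta> where \<theta>: "\<And>n. cmod (\<theta> n) = 1" "\<And>n. (LINT x|lborel. w x \<bullet> (\<theta> n * dilate (t n) u x)) = 0"
    by metis
  define v where "v n x = (of_real \<kappa> * \<theta> n) * dilate (t n) u x" for n x
  have vX: "v n \<in> energy_space p" for n unfolding v_def by (rule energy_space_cmult[OF D])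
  have nk: "cmod (of_real \<kappa> * \<theta> n) = \<kappa>" for n using \<theta>(1)[of n] \<kappa> by (simp add: norm_mult)
  have mass_wv: "mass (\<lambda>x. w x + v n x) = c" for n
  proof -
    have "mass (\<lambda>x. w x + of_real \<kappa> * (\<theta> n * dilate (t n) u x)) = mass w + \<kappa>\<^sup>2 * mass (\<lambda>x. \<theta> n * dilate (t n) u x)"
      using mass_add[OF energy_spaceD(2)[OF w] energy_spaceD(2)[OF energy_space_cmult[OF D[of n], of "\<theta> n"]], of \<kappa>]
        \<theta>(2)[of n] by simp
    also have "mass (\<lambda>x. \<theta> n * dilate (t n) u x) = c"
      by (simp add: mass_cmult \<theta> mass_dilate[OF U(1) t] U(2))
    finally show ?thesis using \<kappa> by (simp add: v_def mult.assoc)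
  qed
  have dens_v: "density_of (v n) = (\<lambda>x. \<kappa>\<^sup>2 * density_of (dilate (t n) u) x)" for n
    by (simp add: fun_eq_iff density_of_def v_def norm_mult power_mult_distrib \<theta>)
  have Av: "(\<lambda>n. A_fun (v n)) \<longlonglongrightarrow> 0"
  proof -
    have "A_fun (v n) = \<kappa>\<^sup>2 * ((t n)\<^sup>2 * A_fun u)" for n
      unfolding v_def by (simp only: A_fun_cmult[OF D] nk A_fun_dilate[OF U(1) t])
    moreover have "(\<lambda>n. \<kappa>\<^sup>2 * ((t n)\<^sup>2 * A_fun u)) \<longlonglongrightarrow> \<kappa>\<^sup>2 * (0\<^sup>2 * A_fun u)"
      by (intro tendsto_intros t0)
    ultimately show ?thesis by simp
  qed
  have Cv: "(\<lambda>n. power_integral p (v n)) \<longlonglongrightarrow> 0"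
  proof -
    have "power_integral p (v n) = \<kappa> powr p * (t n powr (3 * (p - 2) / 2) * power_integral p u)" for n
      unfolding v_def by (simp only: power_integral_cmult nk power_integral_dilate[OF U(1) t])
    moreover have "(\<lambda>n. \<kappa> powr p * (t n powr (3 * (p - 2) / 2) * power_integral p u)) \<longlonglongrightarrow> \<kappa> powr p * (0 * power_integral p u)"
      using p t by (intro tendsto_mult tendsto_const tendsto_zero_powrI[OF t0 tendsto_const])
        (auto intro!: always_eventually less_imp_le)
    ultimately show ?thesis by simp
  qed
  have bu: "bounded_potential (density_of u)" by (rule density_of_bounded_potential[OF U(1) p])
  obtain K where K: "0 \<le> K" "\<And>x. \<bar>potential (density_of u) x\<bar> \<le> K" using potential_bounded[OF bu] by blast
  have bw: "bounded_potential (density_of w)" by (rule density_of_bounded_potential[OF w p])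
  have Bv: "(\<lambda>n. coulomb (density_of w) (density_of (v n)) + B_fun (v n)) \<longlonglongrightarrow> 0"
  proof -
    have bnd: "\<bar>coulomb (density_of w) (density_of (v n))\<bar> \<le> t n * (\<kappa>\<^sup>2 * (K * mass w))" for n
    proof -
      have pot: "potential (density_of (v n)) x = \<kappa>\<^sup>2 * (t n * potential (density_of u) (t n *\<^sub>R x))" for x
        unfolding dens_v density_of_dilate[OF t]
        by (subst potential_cmult) (simp only: potential_dilation[OF bounded_potential_measurable[OF bu] t])
      have le: "\<bar>potential (density_of (v n)) x * density_of w x\<bar> \<le> t n * \<kappa>\<^sup>2 * K * density_of w x" for x
      proof -
        have "\<bar>potential (density_of (v n)) x\<bar> \<le> t n * \<kappa>\<^sup>2 * K"
          unfolding pot using K(2)[of "t n *\<^sub>R x"] t[of n]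
          by (simp add: abs_mult mult.left_commute mult_left_mono mult.assoc)
        thus ?thesis by (simp add: abs_mult density_of_def mult_right_mono)
      qed
      have bvn: "bounded_potential (density_of (v n))" by (rule density_of_bounded_potential[OF vX p])
      have "\<bar>coulomb (density_of w) (density_of (v n))\<bar> \<le> (LINT x|lborel. t n * \<kappa>\<^sup>2 * K * density_of w x)"
        unfolding coulomb_def
        by (rule order_trans[OF integral_abs_bound], rule integral_mono)
          (use le bw coulomb_integrable[OF bw bvn] in \<open>auto simp: bounded_potential_def\<close>)
      also have "\<dots> = t n * (\<kappa>\<^sup>2 * (K * mass w))"
        by (simp add: mass_def density_of_def mult.assoc)
      finally show ?thesis .
    qed
    have "(\<lambda>n. t n * (\<kappa>\<^sup>2 * (K * mass w))) \<longlonglongrightarrow> 0 * (\<kappa>\<^sup>2 * (K * mass w))"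
      by (intro tendsto_intros t0)
    hence lim: "(\<lambda>n. t n * (\<kappa>\<^sup>2 * (K * mass w))) \<longlonglongrightarrow> 0" by (simp only: mult_zero_left)
    have 1: "(\<lambda>n. coulomb (density_of w) (density_of (v n))) \<longlonglongrightarrow> 0"
      by (rule Lim_null_comparison[OF always_eventually lim]) (use bnd in simp)
    have "B_fun (v n) = \<kappa>\<^sup>2 * (\<kappa>\<^sup>2 * (t n * B_fun u))" for n
    proof -
      have "B_fun (v n) = \<kappa>\<^sup>2 * (\<kappa>\<^sup>2 * B_fun (dilate (t n) u))"
        by (simp add: B_fun_eq_coulomb dens_v coulomb_cmult_left coulomb_cmult_right)
      thus ?thesis by (simp only: B_fun_dilate[OF U(1) p t])
    qed
    moreover have "(\<lambda>n. \<kappa>\<^sup>2 * (\<kappa>\<^sup>2 * (t n * B_fun u))) \<longlonglongrightarrow> \<kappa>\<^sup>2 * (\<kappa>\<^sup>2 * (0 * B_fun u))"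
      by (intro tendsto_intros t0)
    ultimately have "(\<lambda>n. B_fun (v n)) \<longlonglongrightarrow> 0" by simp
    from tendsto_add[OF 1 this] show ?thesis by simp
  qed
  show ?thesis
  proof (rule above_level_limit[OF p pos])
    show "(\<lambda>n. A_fun (\<lambda>x. w x + v n x)) \<longlonglongrightarrow> A_fun w" by (rule A_fun_tendsto[OF w vX Av])
    show "(\<lambda>n. B_fun (\<lambda>x. w x + v n x)) \<longlonglongrightarrow> B_fun w" by (rule B_fun_tendsto[OF w vX p Bv])
    show "(\<lambda>n. power_integral p (\<lambda>x. w x + v n x)) \<longlonglongrightarrow> power_integral p w"
      by (rule power_integral_tendsto[OF w vX _ Cv]) (use p in auto)
    show "\<forall>\<^sub>F n in sequentially. above_level p (F_fun p u) (A_fun (\<lambda>x. w x + v n x))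
        (B_fun (\<lambda>x. w x + v n x)) (power_integral p (\<lambda>x. w x + v n x))"
      using p by (intro always_eventually allI above_level_same_mass[OF p u] mass_wv energy_space_add w vX) auto
  qed (rule B_fun_nonneg)
qed

text \<open>
  The derivative of \<open>F\<close> at \<open>u\<close> in the direction \<open>v\<close>, \<open>\<complex>\<close> being regarded as a real inner product space.
\<close>

definition energy_derivative :: "real \<Rightarrow> (real^3 \<Rightarrow> complex) \<Rightarrow> (real^3 \<Rightarrow> complex) \<Rightarrow> real" where
  "energy_derivative p u v = gradient_product u v + coulomb (cross_density u v) (density_of u)
     - (LINT x|lborel. cmod (u x) powr (p - 2) * (u x \<bullet> v x))"

text \<open>
  To first order the mass of \<open>u + s v\<close> decreases, so for small \<open>s > 0\<close> the comparison with functions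
  of smaller mass applies, and the envelope principle turns it into a statement on the derivative.
\<close>

lemma energy_derivative_nonneg:
  assumes p: "10/3 < p" and c: "0 < c" and u: "u \<in> M_set p c"
    and v: "v \<in> energy_space p" and neg: "(LINT x|lborel. u x \<bullet> v x) < 0"
  shows "0 \<le> energy_derivative p u v"
proof -
  have uV: "u \<in> V_set p c" using u by (simp add: M_set_def)
  note U = V_set_energy_space[OF p c uV]
  define s where "s n = inverse (real (Suc n))" for n
  have s: "0 < s n" "s n \<le> 1" for n by (auto simp: s_def field_simps)
  have s0: "s \<longlonglongrightarrow> 0" unfolding s_def[abs_def] by (rule LIMSEQ_inverse_real_of_nat)
  define w where "w n x = u x + of_real (s n) * v x" for n x
  have wX: "w n \<in> energy_space p" for n
    unfolding w_def using p by (intro energy_space_add energy_space_cmult U v) auto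
  have dA: "(\<lambda>n. (A_fun (w n) - A_fun u) / s n) \<longlonglongrightarrow> 2 * gradient_product u v"
  proof -
    have "(A_fun (w n) - A_fun u) / s n = 2 * gradient_product u v + s n * A_fun v" for n
      using s(1)[of n] unfolding w_def A_fun_add[OF U(1) v] by (simp add: field_simps power2_eq_square)
    moreover have "(\<lambda>n. 2 * gradient_product u v + s n * A_fun v) \<longlonglongrightarrow> 2 * gradient_product u v + 0 * A_fun v"
      by (intro tendsto_intros s0)
    ultimately show ?thesis by simp
  qed
  have dB: "(\<lambda>n. (B_fun (w n) - B_fun u) / s n) \<longlonglongrightarrow> 4 * coulomb (cross_density u v) (density_of u)"
  proof -
    define b1 b2 b3 where "b1 = coulomb (cross_density u v) (density_of u)"
      and "b2 = 4 * coulomb (cross_density u v) (cross_density u v) + 2 * coulomb (density_of u) (density_of v)"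
      and "b3 = coulomb (cross_density u v) (density_of v)"
    have "(B_fun (w n) - B_fun u) / s n = 4 * b1 + s n * b2 + 4 * (s n)\<^sup>2 * b3 + s n ^ 3 * B_fun v" for n
      using s(1)[of n] unfolding w_def B_fun_add[OF U(1) v p] b1_def[symmetric] b2_def[symmetric] b3_def[symmetric]
      by (simp add: field_simps eval_nat_numeral)
    moreover have "(\<lambda>n. 4 * b1 + s n * b2 + 4 * (s n)\<^sup>2 * b3 + s n ^ 3 * B_fun v)
        \<longlonglongrightarrow> 4 * b1 + 0 * b2 + 4 * 0\<^sup>2 * b3 + 0 ^ 3 * B_fun v"
      by (intro tendsto_intros s0)
    ultimately show ?thesis by (simp add: b1_def)
  qed
  have dC: "(\<lambda>n. (power_integral p (w n) - power_integral p u) / s n)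
      \<longlonglongrightarrow> p * (LINT x|lborel. cmod (u x) powr (p - 2) * (u x \<bullet> v x))"
    unfolding w_def by (rule power_integral_directional_derivative[OF U(1) v _ s s0]) (use p in simp)
  note lim = tendsto_if_difference_quotient[OF _ s(1) s0]
  have above: "\<forall>\<^sub>F n in sequentially. above_level p (F_fun p u) (A_fun (w n)) (B_fun (w n)) (power_integral p (w n))"
  proof -
    have "(\<lambda>n. 2 * (LINT x|lborel. u x \<bullet> v x) + s n * mass v) \<longlonglongrightarrow> 2 * (LINT x|lborel. u x \<bullet> v x) + 0 * mass v"
      by (intro tendsto_intros s0)
    hence "\<forall>\<^sub>F n in sequentially. 2 * (LINT x|lborel. u x \<bullet> v x) + s n * mass v < 0"
      by (rule order_tendstoD(2)) (use neg in simp)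
    moreover have "\<forall>\<^sub>F n in sequentially. 0 < A_fun (w n)" "\<forall>\<^sub>F n in sequentially. 0 < power_integral p (w n)"
      using order_tendstoD(1)[OF lim[OF dA] U(3)] order_tendstoD(1)[OF lim[OF dC] U(4)] by auto
    ultimately show ?thesis
    proof eventually_elim
      case (elim n)
      have "mass (w n) = c + s n * (2 * (LINT x|lborel. u x \<bullet> v x) + s n * mass v)"
        unfolding w_def mass_add[OF energy_spaceD(2)[OF U(1)] energy_spaceD(2)[OF v]]
        using U(2) by (simp add: algebra_simps power2_eq_square)
      also have "\<dots> \<le> c" using elim(1) s(1)[of n] by (simp add: mult_le_0_iff)
      finally show ?case by (intro above_level_smaller_mass[OF p c u wX] elim)
    qed
  qed
  have "F_fun p u = fibre_energy p (A_fun u) (B_fun u) (power_integral p u) 1"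
    using p by (simp add: F_fun_eq fibre_energy_def)
  with above have "0 \<le> 2 * gradient_product u v / 2 + 4 * coulomb (cross_density u v) (density_of u) / 4
      - p * (LINT x|lborel. cmod (u x) powr (p - 2) * (u x \<bullet> v x)) / p"
    by (intro above_level_directional_derivative[OF p U(3,4) B_fun_nonneg s(1) s0 dA dB dC U(5)]) simp
  thus ?thesis using p by (simp add: energy_derivative_def)
qed

lemma gradient_product_eq:
  assumes u: "u \<in> energy_space p" and h: "has_weak_gradient v h"
  shows "gradient_product u v = (LINT x|lborel. weak_gradient u x \<bullet> h x)"
proof -
  have w: "has_weak_gradient v (weak_gradient v)" using h by (intro weak_gradient_works) (auto simp: H1_def)
  have "AE x in lborel. weak_gradient u x \<bullet> weak_gradient v x = weak_gradient u x \<bullet> h x"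
    using weak_gradient_unique[OF w h] by eventually_elim simp
  thus ?thesis unfolding gradient_product_def
    using energy_spaceD(6)[OF u] has_weak_gradientD(2)[OF w] has_weak_gradientD(2)[OF h]
    by (intro integral_cong_AE) (auto simp: L2_def)
qed

lemma power_term_integrable:
  fixes F :: "real^3 \<Rightarrow> 'a::euclidean_space"
  assumes p: "2 < p" and u: "u \<in> energy_space p" and v: "v \<in> energy_space p"
    and [measurable]: "F \<in> borel_measurable borel"
    and le: "\<And>x. norm (F x) \<le> cmod (u x) powr (p - 2) * (cmod (u x) * cmod (v x))"
  shows "integrable lborel F"
proof (rule Bochner_Integration.integrable_bound)
  show "integrable lborel (\<lambda>x. 2 powr p * (cmod (u x) powr p + cmod (v x) powr p))"
    using energy_spaceD(3)[OF u] energy_spaceD(3)[OF v] by auto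
  show "AE x in lborel. norm (F x) \<le> norm (2 powr p * (cmod (u x) powr p + cmod (v x) powr p))"
  proof (rule AE_I2)
    fix x
    have "norm (F x) \<le> cmod (u x) powr (p - 2) * (cmod (u x) * cmod (v x))" by (rule le)
    also have "\<dots> = cmod (u x) powr (p - 1) * cmod (v x)"
      by (cases "u x = 0") (auto simp: powr_diff power2_eq_square)
    also have "\<dots> \<le> (cmod (u x) + cmod (v x)) powr (p - 1) * cmod (v x)"
      using p by (intro mult_right_mono powr_mono2) auto
    also have "\<dots> \<le> 2 powr p * (cmod (u x) powr p + cmod (v x) powr p)"
      using p by (intro powr_le_powr_split) auto
    finally show "norm (F x) \<le> norm (2 powr p * (cmod (u x) powr p + cmod (v x) powr p))" by simp
  qed
qed measurable

lemma energy_derivative_linear: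
  assumes p: "10/3 < p" and u: "u \<in> energy_space p" and v: "v \<in> energy_space p" and w: "w \<in> energy_space p"
  shows "energy_derivative p u (\<lambda>x. v x + of_real r * w x) = energy_derivative p u v + r * energy_derivative p u w"
proof -
  note [measurable] = energy_spaceD(4)[OF u] energy_spaceD(4)[OF v] energy_spaceD(4)[OF w]
  have c: "vector_scalar_mult (of_real r) z = r *\<^sub>R z" for z :: "complex^3"
    by (simp add: vector_scalar_mult_def vec_eq_iff scaleR_conv_of_real[where 'a = complex])
  have 1: "gradient_product u (\<lambda>x. v x + of_real r * w x) = gradient_product u v + r * gradient_product u w"
    unfolding gradient_product_eq[OF u has_weak_gradient_add[OF energy_spaceD(5)[OF v]
        has_weak_gradient_cmult[OF energy_spaceD(5)[OF w]]]] c
    using L2_inner_integrable[OF energy_spaceD(6)[OF u] energy_spaceD(6)[OF v]]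
      L2_inner_integrable[OF energy_spaceD(6)[OF u] energy_spaceD(6)[OF w]]
    by (simp add: gradient_product_def inner_add_right)
  have "cross_density u (\<lambda>x. v x + of_real r * w x) = (\<lambda>x. cross_density u v x + r * cross_density u w x)"
    unfolding cross_density_def scaleR_conv_of_real[symmetric] by (simp add: inner_add_right)
  hence 2: "coulomb (cross_density u (\<lambda>x. v x + of_real r * w x)) (density_of u) =
      coulomb (cross_density u v) (density_of u) + r * coulomb (cross_density u w) (density_of u)"
    by (simp add: coulomb_add_left coulomb_cmult_left bounded_potential_cmult
        cross_density_bounded_potential[OF u _ p] v w density_of_bounded_potential[OF u p])
  have i: "integrable lborel (\<lambda>x. cmod (u x) powr (p - 2) * (u x \<bullet> z x))" if z: "z \<in> energy_space p" for z
  proof (rule power_term_integrable[OF _ u z])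
    have [measurable]: "z \<in> borel_measurable borel" by (rule energy_spaceD(4)[OF z])
    show "(\<lambda>x. cmod (u x) powr (p - 2) * (u x \<bullet> z x)) \<in> borel_measurable borel" by measurable
    show "norm (cmod (u x) powr (p - 2) * (u x \<bullet> z x)) \<le> cmod (u x) powr (p - 2) * (cmod (u x) * cmod (z x))" for x
      using Cauchy_Schwarz_ineq2[of "u x" "z x"] by (simp add: abs_mult mult_left_mono)
  qed (use p in simp)
  have "cmod (u x) powr (p - 2) * (u x \<bullet> (v x + of_real r * w x)) =
      cmod (u x) powr (p - 2) * (u x \<bullet> v x) + r * (cmod (u x) powr (p - 2) * (u x \<bullet> w x))" for x
    unfolding scaleR_conv_of_real[symmetric] by (simp add: inner_add_right distrib_left)
  hence 3: "(LINT x|lborel. cmod (u x) powr (p - 2) * (u x \<bullet> (v x + of_real r * w x))) =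
      (LINT x|lborel. cmod (u x) powr (p - 2) * (u x \<bullet> v x)) + r * (LINT x|lborel. cmod (u x) powr (p - 2) * (u x \<bullet> w x))"
    using i[OF v] i[OF w] by simp
  show ?thesis unfolding energy_derivative_def 1 2 3 by (simp add: algebra_simps)
qed

lemma pairing_linear:
  assumes u: "u \<in> L2" and v: "v \<in> L2" and w: "w \<in> L2"
  shows "(LINT x|lborel. u x \<bullet> (v x + of_real r * w x)) = (LINT x|lborel. u x \<bullet> v x) + r * (LINT x|lborel. u x \<bullet> w x)"
  unfolding scaleR_conv_of_real[symmetric]
  using L2_inner_integrable[OF u v] L2_inner_integrable[OF u w] by (simp add: inner_add_right)

text \<open>
  A linear functional that is nonnegative on the open half space \<open>(u, v) < 0\<close> is a nonpositive
  multiple of \<open>(u, \<cdot>)\<close>.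
\<close>

lemma minimizer_has_multiplier:
  assumes p: "10/3 < p" and c: "0 < c" and u: "u \<in> M_set p c"
  obtains l where "l \<le> 0" "\<And>v. v \<in> energy_space p \<Longrightarrow> energy_derivative p u v = l * (LINT x|lborel. u x \<bullet> v x)"
proof -
  have uV: "u \<in> V_set p c" using u by (simp add: M_set_def)
  note U = V_set_energy_space[OF p c uV]
  note uL = energy_spaceD(2)[OF U(1)]
  define d where "d = energy_derivative p u u"
  have uu: "(LINT x|lborel. u x \<bullet> u x) = c" using U(2) by (simp add: mass_def power2_norm_eq_inner)
  have zero: "(\<lambda>x. 0) \<in> energy_space p" using energy_space_cmult[OF U(1), of 0] by simp
  have lin: "energy_derivative p u (\<lambda>x. of_real r * v x) = r * energy_derivative p u v"
    "(LINT x|lborel. u x \<bullet> (of_real r * v x)) = r * (LINT x|lborel. u x \<bullet> v x)" if v: "v \<in> energy_space p" for r v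
  proof -
    have "energy_derivative p u (\<lambda>x. 0) = 0"
      using energy_derivative_linear[OF p U(1) zero zero, of 1] by simp
    thus "energy_derivative p u (\<lambda>x. of_real r * v x) = r * energy_derivative p u v"
      using energy_derivative_linear[OF p U(1) zero v, of r] by simp
    show "(LINT x|lborel. u x \<bullet> (of_real r * v x)) = r * (LINT x|lborel. u x \<bullet> v x)"
      using pairing_linear[OF uL energy_spaceD(2)[OF zero] energy_spaceD(2)[OF v], of r] by simp
  qed
  have "0 \<le> energy_derivative p u (\<lambda>x. of_real (-1) * u x)"
    by (intro energy_derivative_nonneg[OF p c u] energy_space_cmult U(1)) (use lin(2)[OF U(1), of "-1"] uu c in simp)
  hence d: "d \<le> 0" using lin(1)[OF U(1), of "-1"] by (simp add: d_def)
  have ge: "d / c * (LINT x|lborel. u x \<bullet> v x) \<le> energy_derivative p u v" if v: "v \<in> energy_space p" for v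
  proof -
    define I where "I = (LINT x|lborel. u x \<bullet> v x)"
    have ev: "(I / c + inverse (real (Suc n))) * d \<le> energy_derivative p u v" for n
    proof -
      \<comment> \<open>A coefficient slightly larger than \<open>I / c\<close> moves \<open>v - \<alpha> u\<close> into the open half space.\<close>
      define \<alpha> where "\<alpha> = I / c + inverse (real (Suc n))"
      have "I - \<alpha> * c < 0" using c by (simp add: \<alpha>_def distrib_right)
      hence "(LINT x|lborel. u x \<bullet> (v x + of_real (- \<alpha>) * u x)) < 0"
        using pairing_linear[OF uL energy_spaceD(2)[OF v] uL, of "- \<alpha>"] uu by (simp add: I_def)
      hence "0 \<le> energy_derivative p u (\<lambda>x. v x + of_real (- \<alpha>) * u x)"
        using p by (intro energy_derivative_nonneg[OF p c u] energy_space_add energy_space_cmult v U(1)) auto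
      thus ?thesis
        using energy_derivative_linear[OF p U(1) v U(1), of "- \<alpha>"]
        unfolding d_def[symmetric] \<alpha>_def[symmetric] by simp
    qed
    have "(\<lambda>n. (I / c + inverse (real (Suc n))) * d) \<longlonglongrightarrow> (I / c + 0) * d"
      by (intro tendsto_intros LIMSEQ_inverse_real_of_nat)
    hence "(I / c + 0) * d \<le> energy_derivative p u v"
      by (rule LIMSEQ_le_const2) (use ev in blast)
    thus ?thesis by (simp add: I_def mult.commute)
  qed
  show thesis
  proof (rule that[of "d / c"])
    show "d / c \<le> 0" using d c by (simp add: divide_le_0_iff)
    fix v assume v: "v \<in> energy_space p"
    have "d / c * (LINT x|lborel. u x \<bullet> (of_real (-1) * v x)) \<le> energy_derivative p u (\<lambda>x. of_real (-1) * v x)"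
      by (rule ge[OF energy_space_cmult[OF v]])
    thus "energy_derivative p u v = d / c * (LINT x|lborel. u x \<bullet> v x)"
      using ge[OF v] unfolding lin[OF v] by simp
  qed
qed

section \<open>The Euler-Lagrange equation\<close>

lemma partial_deriv_cnj:
  assumes "f \<in> test_functions"
  shows "partial_deriv i (\<lambda>x. cnj (f x)) x = cnj (partial_deriv i f x)"
  by (rule partial_deriv_bounded_linear[OF bounded_linear_cnj test_functions_differentiable[OF assms]])

lemma partial_deriv_cmult:
  assumes "f \<in> test_functions"
  shows "partial_deriv i (\<lambda>x. c * f x) x = c * partial_deriv i f x"
  by (rule partial_deriv_bounded_linear[OF bounded_linear_mult_right test_functions_differentiable[OF assms]])

text \<open>
  The real inner product of \<open>u\<close> with the conjugate of \<open>f\<close> is the real part of \<open>u f\<close>. Conjugated test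
  functions therefore give the real part of the weak equation, and \<open>\<i> f\<close> in place of \<open>f\<close> gives the
  imaginary part.
\<close>

lemma Euler_Lagrange:
  assumes p: "10/3 < p" and u: "u \<in> energy_space p"
    and mult: "\<And>v. v \<in> energy_space p \<Longrightarrow> energy_derivative p u v = l * (LINT x|lborel. u x \<bullet> v x)"
  shows "weak_solution p u l"
proof -
  have bu: "bounded_potential (density_of u)" by (rule density_of_bounded_potential[OF u p])
  note [measurable] = energy_spaceD(4)[OF u]
  note uL = energy_spaceD(2)[OF u]
  have gL: "(\<lambda>x. weak_gradient u x $ i) \<in> L2" for i by (rule L2_vec_nth[OF energy_spaceD(6)[OF u]])
  have int1: "integrable lborel (\<lambda>x. weak_gradient u x $ i * partial_deriv i f x)"
    if "f \<in> test_functions" for f i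
    by (intro L2_times_integrable gL test_functions_L2 test_functions_partial_deriv that)
  have int2: "integrable lborel (\<lambda>x. u x * f x)" if "f \<in> test_functions" for f
    by (intro L2_times_integrable uL test_functions_L2 that)
  have int3: "integrable lborel (\<lambda>x. of_real (hartree u x) * u x * f x)" if "f \<in> test_functions" for f
    using bounded_potential_times_integrable[OF bu int2[OF that]]
    by (simp add: hartree_eq_potential scaleR_conv_of_real mult.assoc)
  have int4: "integrable lborel (\<lambda>x. of_real (cmod (u x) powr (p - 2)) * u x * f x)" if f: "f \<in> test_functions" for f
  proof (rule power_term_integrable[OF _ u energy_space_test[OF f]])
    note [measurable] = test_functions_measurable[OF f]
    show "(\<lambda>x. of_real (cmod (u x) powr (p - 2)) * u x * f x) \<in> borel_measurable borel" by measurable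
  qed (use p in \<open>auto simp: norm_mult mult.assoc\<close>)
  define Z where "Z f = (LINT x|lborel. (\<Sum>i\<in>UNIV. weak_gradient u x $ i * partial_deriv i f x))
        - of_real l * (LINT x|lborel. u x * f x)
        + (LINT x|lborel. of_real (hartree u x) * u x * f x)
        - (LINT x|lborel. of_real (cmod (u x) powr (p - 2)) * u x * f x)" for f
  have Re_Z: "Re (Z f) = 0" if f: "f \<in> test_functions" for f
  proof -
    let ?v = "\<lambda>x. cnj (f x)"
    have v: "?v \<in> test_functions" by (rule test_functions_bounded_linear[OF f bounded_linear_cnj])
    have vX: "?v \<in> energy_space p" by (rule energy_space_test[OF v]) (use p in simp)
    have "Re (LINT x|lborel. (\<Sum>i\<in>UNIV. weak_gradient u x $ i * partial_deriv i f x)) =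
        (LINT x|lborel. Re (\<Sum>i\<in>UNIV. weak_gradient u x $ i * partial_deriv i f x))"
      by (intro integral_Re[symmetric] Bochner_Integration.integrable_sum int1 f)
    also have "\<dots> = gradient_product u ?v"
      unfolding gradient_product_eq[OF u has_weak_gradient_test[OF v]]
      by (simp add: inner_vec_def inner_complex_eq partial_deriv_cnj[OF f])
    finally have 1: "Re (LINT x|lborel. (\<Sum>i\<in>UNIV. weak_gradient u x $ i * partial_deriv i f x)) = gradient_product u ?v" .
    have 2: "Re (LINT x|lborel. u x * f x) = (LINT x|lborel. u x \<bullet> ?v x)"
      by (subst integral_Re[symmetric, OF int2[OF f]]) (simp add: inner_complex_eq)
    have 3: "Re (LINT x|lborel. of_real (hartree u x) * u x * f x) = coulomb (cross_density u ?v) (density_of u)"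
      by (subst integral_Re[symmetric, OF int3[OF f]])
        (simp add: coulomb_def cross_density_def hartree_eq_potential inner_complex_eq mult.assoc)
    have 4: "Re (LINT x|lborel. of_real (cmod (u x) powr (p - 2)) * u x * f x) =
        (LINT x|lborel. cmod (u x) powr (p - 2) * (u x \<bullet> ?v x))"
      by (subst integral_Re[symmetric, OF int4[OF f]]) (simp add: inner_complex_eq mult.assoc)
    have "Re (Z f) = energy_derivative p u ?v - l * (LINT x|lborel. u x \<bullet> ?v x)"
      unfolding Z_def energy_derivative_def using 1 2 3 4 by simp
    thus ?thesis using mult[OF vX] by simp
  qed
  have Z0: "Z f = 0" if f: "f \<in> test_functions" for f
  proof -
    have if': "(\<lambda>x. \<i> * f x) \<in> test_functions" by (rule test_functions_bounded_linear[OF f bounded_linear_mult_right])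
    have e: "(\<Sum>i\<in>UNIV. weak_gradient u x $ i * partial_deriv i (\<lambda>x. \<i> * f x) x) =
        \<i> * (\<Sum>i\<in>UNIV. weak_gradient u x $ i * partial_deriv i f x)" for x
      by (simp add: partial_deriv_cmult[OF f] sum_distrib_left mult.left_commute)
    have "Z (\<lambda>x. \<i> * f x) = \<i> * Z f"
      unfolding Z_def e by (simp add: mult.left_commute[of _ \<i>] right_diff_distrib distrib_left)
    thus ?thesis using Re_Z[OF f] Re_Z[OF if'] by (simp add: complex_eq_iff)
  qed
  show ?thesis
    unfolding weak_solution_def
  proof (intro conjI ballI)
    show "AE x in lborel. integrable lborel (\<lambda>y. (cmod (u y))\<^sup>2 / norm (x - y))"
      using bounded_potential_integrable[OF bu] by (simp add: density_of_def)
  qed (use int3 int4 Z0 in \<open>auto simp: Z_def\<close>)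
qed

theorem theorem1p4:
  fixes p c :: real and u :: "real^3 \<Rightarrow> complex"
  assumes "10/3 < p" and "p < 6" and "0 < c"
    and "u \<in> M_set p c"
  shows "\<exists>l::real. l \<le> 0 \<and> u \<in> H1 \<and> weak_solution p u l"
proof -
  have u: "u \<in> energy_space p"
    using V_set_energy_space(1)[OF assms(1,3)] assms(4) by (simp add: M_set_def)
  obtain l where l: "l \<le> 0"
    "\<And>v. v \<in> energy_space p \<Longrightarrow> energy_derivative p u v = l * (LINT x|lborel. u x \<bullet> v x)"
    using minimizer_has_multiplier[OF assms(1,3,4)] by blast
  have "weak_solution p u l" by (rule Euler_Lagrange[OF assms(1) u l(2)])
  thus ?thesis using l(1) energy_spaceD(1)[OF u] by blast
qed

end
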